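(* Let $(E,g)$ be a real analytic Riemannian manifold, $p\in E$, let $U$ be a real analytic function near $p$ with non-zero germ, $U(p)=0$ and $d_pU=0$, and let $\mu$ be a real analytic one-form near $p$ verifying the weak magnetism hypothesis. Let $f$ be the restriction to the unit sphere of the first non-zero jet of $U$ at $p$. Consider a non-equilibrium (non-constant) orbit of the Lagrangian system $L(x,v)=\tfrac12g_x(v,v)+\mu_x(v)-U(x)$ converging to $(p,0)$ in phase space as $t\to+\infty$. Then it is asymptotic in configuration space to some connected component of the set $\{q: q \text{ is a critical point of } f,\ f(q)\le 0\}$.
   Context: **System.** The Euler–Lagrange flow is given by $\dot x=v$, $\nabla_{\dot x}v=-\mathrm{grad}_gU(x)-\mathcal{R}_x(\iota_vd\mu(x))$, where $\nabla$ is the Levi-Civita connection and $\mathcal{R}_x:T_x^*E\to T_xE$ is Riesz duality. **Chart, jets.** A real analytic chart centered at $p$ with $g_{ij}(0)=\delta_{ij}$ is fixed, and a neighbourhood of $p$ is identified with a ball around the origin of $\mathbb{R}^n$. $U_l$ is the first non-zero homogeneous Taylor term of $U$ at the origin, of degree $l\ge2$, and $f=U_l|_{S^{n-1}}$ with $S^{n-1}$ the Euclidean unit sphere. **Weak magnetism hypothesis.** $d-l/2\ge1$, where $d$ is the smallest degree of a non-zero homogeneous Taylor term at the origin of the coefficients of $\mu$; if the germ of $\mu$ is zero the hypothesis is considered satisfied. **Asymptotic.** An orbit $t\mapsto(x(t),v(t))$ converging to $(p,0)$ as $t\to+\infty$ and not constant has $x(t)\ne0$ for all large $t$. It is asymptotic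 to $\Sigma\subset S^{n-1}$ in configuration space if the omega-limit set of $t\mapsto x(t)/\|x(t)\|$ is contained in $\Sigma$. *)

theory Defs
  imports "HOL-Analysis.Analysis"
begin

section \<open>Real analytic functions of several variables and Taylor terms\<close>

definition monomial_value :: "real^'n \<Rightarrow> ('n \<Rightarrow> nat) \<Rightarrow> real" where
  "monomial_value y \<alpha> = (\<Prod>i\<in>UNIV. (y $ i) ^ \<alpha> i)"

definition real_analytic_at :: "(real^'n \<Rightarrow> real) \<Rightarrow> real^'n \<Rightarrow> bool" where
  "real_analytic_at F a \<longleftrightarrow>
     (\<exists>(coef :: ('n \<Rightarrow> nat) \<Rightarrow> real) r. r > 0 \<and>
        (\<forall>y\<in>ball a r. ((\<lambda>\<alpha>. coef \<alpha> * monomial_value (y - a) \<alpha>) has_sum F y) UNIV))"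

definition real_analytic_on :: "(real^'n \<Rightarrow> real) \<Rightarrow> (real^'n) set \<Rightarrow> bool" where
  "real_analytic_on F S \<longleftrightarrow> (\<forall>a\<in>S. real_analytic_at F a)"

text \<open>The homogeneous Taylor term of degree \<open>k\<close> of \<open>F\<close> at the origin,
  \<open>D\<^sup>kF(0)(y,\<dots>,y) / k!\<close>. It depends only on the germ of \<open>F\<close> at the origin.\<close>

definition taylor_term :: "nat \<Rightarrow> (real^'n \<Rightarrow> real) \<Rightarrow> real^'n \<Rightarrow> real" where
  "taylor_term k F y = (deriv ^^ k) (\<lambda>t::real. F (t *\<^sub>R y)) 0 / fact k"

definition first_degree :: "(real^'n \<Rightarrow> real) \<Rightarrow> nat" where
  "first_degree F = (LEAST k. taylor_term k F \<noteq> (\<lambda>_. 0))"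

definition first_jet :: "(real^'n \<Rightarrow> real) \<Rightarrow> real^'n \<Rightarrow> real" where
  "first_jet F = taylor_term (first_degree F) F"

definition first_degree_form :: "(real^'n \<Rightarrow> real^'n) \<Rightarrow> nat" where
  "first_degree_form m = (LEAST k. \<exists>i. taylor_term k (\<lambda>y. m y $ i) \<noteq> (\<lambda>_. 0))"

section \<open>Real analytic Riemannian manifolds\<close>

text \<open>The underlying set of the manifold is the type \<open>'a\<close>. A chart is a pair of its domain and
  its coordinate map; the values of the coordinate map outside the domain are irrelevant.
  Likewise, everything given in coordinates is irrelevant outside the image of the chart.\<close>

type_synonym ('a, 'n) chart = "'a set \<times> ('a \<Rightarrow> real^'n)"

abbreviation chart_dom :: "('a, 'n) chart \<Rightarrow> 'a set" where
  "chart_dom \<equiv> fst"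

abbreviation chart_map :: "('a, 'n) chart \<Rightarrow> 'a \<Rightarrow> real^'n" where
  "chart_map \<equiv> snd"

definition chart_inv :: "('a, 'n) chart \<Rightarrow> real^'n \<Rightarrow> 'a" where
  "chart_inv c = inv_into (chart_dom c) (chart_map c)"

definition transition :: "('a, 'n) chart \<Rightarrow> ('a, 'n) chart \<Rightarrow> real^'n \<Rightarrow> real^'n" where
  "transition c c' = chart_map c' \<circ> chart_inv c"

definition is_chart :: "('a::topological_space, 'n::finite) chart \<Rightarrow> bool" where
  "is_chart c \<longleftrightarrow> open (chart_dom c) \<and> open (chart_map c ` chart_dom c) \<and>
     inj_on (chart_map c) (chart_dom c) \<and>
     homeomorphism (chart_dom c) (chart_map c ` chart_dom c) (chart_map c) (chart_inv c)"

definition analytic_atlas ::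
  "('a::{t2_space, second_countable_topology}, 'n::finite) chart set \<Rightarrow> bool" where
  "analytic_atlas A \<longleftrightarrow>
     (\<forall>c\<in>A. is_chart c) \<and> (\<Union>c\<in>A. chart_dom c) = UNIV \<and>
     (\<forall>c\<in>A. \<forall>c'\<in>A. \<forall>i.
        real_analytic_on (\<lambda>y. transition c c' y $ i) (chart_map c ` (chart_dom c \<inter> chart_dom c')))"

text \<open>Tensor fields are given by their coefficients in each chart of the atlas, subject to the
  transformation law under changes of charts.\<close>

definition analytic_metric ::
  "('a::{t2_space, second_countable_topology}, 'n::finite) chart set \<Rightarrow>
   (('a, 'n) chart \<Rightarrow> real^'n \<Rightarrow> real^'n^'n) \<Rightarrow> bool" where
  "analytic_metric A g \<longleftrightarrow>
     (\<forall>c\<in>A.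
        (\<forall>i j. real_analytic_on (\<lambda>y. g c y $ i $ j) (chart_map c ` chart_dom c)) \<and>
        (\<forall>y\<in>chart_map c ` chart_dom c.
           transpose (g c y) = g c y \<and> (\<forall>v. v \<noteq> 0 \<longrightarrow> v \<bullet> (g c y *v v) > 0))) \<and>
     (\<forall>c\<in>A. \<forall>c'\<in>A. \<forall>q\<in>chart_dom c \<inter> chart_dom c'.
        let D = frechet_derivative (transition c c') (at (chart_map c q)) in
        \<forall>v w. v \<bullet> (g c (chart_map c q) *v w) = D v \<bullet> (g c' (chart_map c' q) *v D w))"

definition analytic_riemannian_manifold ::
  "('a::{t2_space, second_countable_topology}, 'n::finite) chart set \<Rightarrow>
   (('a, 'n) chart \<Rightarrow> real^'n \<Rightarrow> real^'n^'n) \<Rightarrow> bool" where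
  "analytic_riemannian_manifold A g \<longleftrightarrow> analytic_atlas A \<and> analytic_metric A g"

definition analytic_function_on ::
  "('a::{t2_space, second_countable_topology}, 'n::finite) chart set \<Rightarrow>
   'a set \<Rightarrow> ('a \<Rightarrow> real) \<Rightarrow> bool" where
  "analytic_function_on A W U \<longleftrightarrow>
     (\<forall>c\<in>A. real_analytic_on (U \<circ> chart_inv c) (chart_map c ` (chart_dom c \<inter> W)))"

definition analytic_one_form_on ::
  "('a::{t2_space, second_countable_topology}, 'n::finite) chart set \<Rightarrow>
   'a set \<Rightarrow> (('a, 'n) chart \<Rightarrow> real^'n \<Rightarrow> real^'n) \<Rightarrow> bool" where
  "analytic_one_form_on A W \<mu> \<longleftrightarrow>
     (\<forall>c\<in>A. \<forall>i. real_analytic_on (\<lambda>y. \<mu> c y $ i) (chart_map c ` (chart_dom c \<inter> W))) \<and>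
     (\<forall>c\<in>A. \<forall>c'\<in>A. \<forall>q\<in>chart_dom c \<inter> chart_dom c' \<inter> W. \<forall>v.
        \<mu> c (chart_map c q) \<bullet> v =
        \<mu> c' (chart_map c' q) \<bullet> frechet_derivative (transition c c') (at (chart_map c q)) v)"

section \<open>The Euler--Lagrange flow\<close>

text \<open>In this group of definitions \<open>G\<close>, \<open>u\<close> and \<open>m\<close> are the coordinate expressions of the
  metric, of the potential and of the one-form in a chart.\<close>

definition partial :: "'n \<Rightarrow> (real^'n \<Rightarrow> real) \<Rightarrow> real^'n \<Rightarrow> real" where
  "partial i F y = frechet_derivative F (at y) (axis i 1)"

definition christoffel ::
  "(real^'n \<Rightarrow> real^'n^'n) \<Rightarrow> real^'n \<Rightarrow> 'n \<Rightarrow> 'n \<Rightarrow> 'n \<Rightarrow> real" where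
  "christoffel G y k i j =
     (\<Sum>l\<in>UNIV. matrix_inv (G y) $ k $ l *
        (partial i (\<lambda>z. G z $ j $ l) y + partial j (\<lambda>z. G z $ i $ l) y
         - partial l (\<lambda>z. G z $ i $ j) y)) / 2"

text \<open>The covariant derivative of the velocity field along a curve with position \<open>y\<close>,
  velocity \<open>v\<close> and second coordinate derivative \<open>a\<close>.\<close>

definition covariant_acceleration ::
  "(real^'n \<Rightarrow> real^'n^'n) \<Rightarrow> real^'n \<Rightarrow> real^'n \<Rightarrow> real^'n \<Rightarrow> real^'n" where
  "covariant_acceleration G y v a =
     (\<chi> k. a $ k + (\<Sum>i\<in>UNIV. \<Sum>j\<in>UNIV. christoffel G y k i j * v $ i * v $ j))"

definition riesz :: "(real^'n \<Rightarrow> real^'n^'n) \<Rightarrow> real^'n \<Rightarrow> real^'n \<Rightarrow> real^'n" where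
  "riesz G y \<xi> = matrix_inv (G y) *v \<xi>"

definition gradient :: "(real^'n \<Rightarrow> real^'n^'n) \<Rightarrow> (real^'n \<Rightarrow> real) \<Rightarrow> real^'n \<Rightarrow> real^'n" where
  "gradient G u y = riesz G y (\<chi> i. partial i u y)"

text \<open>The covector \<open>\<iota>\<^sub>v dm\<close>, with
  \<open>dm(v,w) = (\<Sum>j i. (\<partial>\<^sub>j m\<^sub>i - \<partial>\<^sub>i m\<^sub>j) v\<^sub>j w\<^sub>i)\<close>. With this convention the equation in
  \<open>is_orbit\<close> is the Euler--Lagrange equation of
  \<open>L(x,v) = g\<^sub>x(v,v)/2 + \<mu>\<^sub>x(v) - U(x)\<close>.\<close>

definition contract_d :: "(real^'n \<Rightarrow> real^'n) \<Rightarrow> real^'n \<Rightarrow> real^'n \<Rightarrow> real^'n" where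
  "contract_d m y v =
     (\<chi> i. \<Sum>j\<in>UNIV. v $ j * (partial j (\<lambda>z. m z $ i) y - partial i (\<lambda>z. m z $ j) y))"

text \<open>A phase curve over the time interval \<open>T\<close> consists of \<open>x(t)\<close> and, for each chart \<open>c\<close>,
  of the coordinates \<open>v c t\<close> of the velocity, relevant only when \<open>x(t)\<close> is in the domain of
  \<open>c\<close>.\<close>

definition is_orbit ::
  "('a::{t2_space, second_countable_topology}, 'n::finite) chart set \<Rightarrow>
   (('a, 'n) chart \<Rightarrow> real^'n \<Rightarrow> real^'n^'n) \<Rightarrow> 'a set \<Rightarrow>
   (('a, 'n) chart \<Rightarrow> real^'n \<Rightarrow> real^'n) \<Rightarrow> ('a \<Rightarrow> real) \<Rightarrow>
   real set \<Rightarrow> (real \<Rightarrow> 'a) \<Rightarrow> (('a, 'n) chart \<Rightarrow> real \<Rightarrow> real^'n) \<Rightarrow> bool" where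
  "is_orbit A g W \<mu> U T x v \<longleftrightarrow>
     is_interval T \<and> continuous_on T x \<and> x ` T \<subseteq> W \<and>
     (\<forall>c\<in>A. \<forall>t\<in>T. x t \<in> chart_dom c \<longrightarrow>
        ((\<lambda>s. chart_map c (x s)) has_vector_derivative v c t) (at t within T) \<and>
        (\<exists>a. (v c has_vector_derivative a) (at t within T) \<and>
           (let y = chart_map c (x t) in
            covariant_acceleration (g c) y (v c t) a =
              - gradient (g c) (U \<circ> chart_inv c) y
              - riesz (g c) y (contract_d (\<mu> c) y (v c t)))))"

text \<open>Convergence to the zero tangent vector at \<open>p\<close> in the topology of the tangent bundle.\<close>

definition converges_to_rest ::
  "('a::{t2_space, second_countable_topology}, 'n::finite) chart set \<Rightarrow>
   (real \<Rightarrow> 'a) \<Rightarrow> (('a, 'n) chart \<Rightarrow> real \<Rightarrow> real^'n) \<Rightarrow> 'a \<Rightarrow> bool" where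
  "converges_to_rest A x v p \<longleftrightarrow>
     (x \<longlongrightarrow> p) at_top \<and> (\<forall>c\<in>A. p \<in> chart_dom c \<longrightarrow> (v c \<longlongrightarrow> 0) at_top)"

section \<open>Weak magnetism, critical points on the sphere, asymptotic directions\<close>

definition weak_magnetism :: "(real^'n \<Rightarrow> real) \<Rightarrow> (real^'n \<Rightarrow> real^'n) \<Rightarrow> bool" where
  "weak_magnetism u m \<longleftrightarrow>
     (\<forall>\<^sub>F y in nhds 0. m y = 0) \<or>
     real (first_degree_form m) - real (first_degree u) / 2 \<ge> 1"

text \<open>Critical points of the restriction of \<open>F\<close> to the unit sphere: the differential vanishes on
  the tangent space of the sphere at \<open>q\<close>, which is the orthogonal complement of \<open>q\<close>.\<close>

definition sphere_critical_point :: "(real^'n \<Rightarrow> real) \<Rightarrow> real^'n \<Rightarrow> bool" where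
  "sphere_critical_point F q \<longleftrightarrow>
     q \<in> sphere 0 1 \<and> (\<forall>w. q \<bullet> w = 0 \<longrightarrow> frechet_derivative F (at q) w = 0)"

definition omega_limit :: "(real \<Rightarrow> 'b::topological_space) \<Rightarrow> 'b set" where
  "omega_limit \<theta> =
     {q. \<exists>s::nat \<Rightarrow> real. filterlim s at_top sequentially \<and> (\<lambda>k. \<theta> (s k)) \<longlonglongrightarrow> q}"

text \<open>If \<open>y\<close> vanished at arbitrarily large times, then \<open>0\<close> would be in this omega-limit set
  (as \<open>inverse 0 = 0\<close>), so for \<open>\<Sigma>\<close> in the unit sphere the condition also includes that \<open>y(t)\<close>
  is non-zero for all large \<open>t\<close>.\<close>

definition asymptotic_to :: "(real \<Rightarrow> real^'n) \<Rightarrow> (real^'n) set \<Rightarrow> bool" where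
  "asymptotic_to y \<Sigma> \<longleftrightarrow> omega_limit (\<lambda>t. y t /\<^sub>R norm (y t)) \<subseteq> \<Sigma>"

end

theory Submission
  imports Defs
begin

text \<open>In the chart write \<open>y\<close> for the position, \<open>v\<close> for the velocity, \<open>l\<close> for the degree and \<open>P\<close> for
  the first jet of the potential. The energy vanishes along the orbit, so \<open>\<parallel>v\<parallel>\<^sup>2 = O(\<parallel>y\<parallel>\<^sup>l)\<close>,
  and blowing up with \<open>r = \<parallel>y\<parallel>\<close>, \<open>q = y/r\<close>, \<open>w = v/r\<close>\<open>\<^sup>l\<^sup>/\<^sup>2\<close> and the clock \<open>\<rho> = r\<close>\<open>\<^sup>l\<^sup>/\<^sup>2\<^sup>-\<^sup>1\<close> gives,
  with \<open>\<xi> = w \<bullet> q\<close>, the system \<open>r' = \<rho> r \<xi>\<close>, \<open>q' = \<rho> (w - \<xi> q)\<close>,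
  \<open>w' = \<rho> (- \<nabla>P(q) - (l/2) \<xi> w + O(r))\<close>; weak magnetism is exactly what puts the magnetic
  force into the error \<open>O(r)\<close>. By conservation of energy
  \<open>\<xi>' \<ge> \<rho> ((1 + l/2) \<parallel>w - \<xi> q\<parallel>\<^sup>2 - C r)\<close>. As \<open>r' = \<rho> r \<xi>\<close>, the error is absorbed by a multiple of
  \<open>r\<close> wherever \<open>\<xi>\<close> is bounded away from \<open>0\<close>, which forces \<open>\<xi>\<close> to converge to some \<open>\<lambda> \<le> 0\<close>. Then
  \<open>w - \<xi> q\<close> tends to \<open>0\<close>, hence so does the gradient of \<open>P\<close> along the sphere at \<open>q\<close>, and \<open>P(q)\<close>
  tends to \<open>- \<lambda>\<^sup>2/2 \<le> 0\<close>. The omega-limit set of \<open>q\<close> is connected. No information on the set of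
  critical values is used.\<close>

section \<open>Taylor expansion of real analytic functions\<close>

text \<open>The factor 1 + l/2 comes from Euler's identity: the radial part of \<nabla>P(q) is l
  P(q), and zero energy replaces P(q) by minus half the squared norm of w, up to O(r). Together with
  the centrifugal term everything collects on the tangential part of w. For a magnetic term of order
  d, dm is O(r^(d-1)) and v is O(r^(l/2)), so the force is O(r^l), a factor r smaller than the
  leading force of order r^(l-1), exactly when d - 1 is at least l/2. That the rescaled time is
  infinite is read off from r: ln r tends to minus infinity, while its derivative is \<rho> \<xi>
  with \<xi> bounded. For the tangential gradient H, the function - w \<bullet> H tends to 0 with
  the tangential velocity, and its derivative is \<rho> times the squared norm of H up to vanishing
  terms; this forces H to tend to 0. Blowing up needs y \<noteq> 0. Since l \<ge> 2, zero energy
  bounds the speed by a multiple of the distance to the rest point, and Gronwall's argument shows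
  that rest cannot begin or end. Non-constancy, however, concerns all times, so rest has to be
  propagated back to times at which neither the chart nor the energy is known.\<close>

lemma finite_multi_indices_degree: "finite {\<alpha> :: 'n::finite \<Rightarrow> nat. sum \<alpha> UNIV = k}"
proof (rule finite_subset)
  show "{\<alpha> :: 'n \<Rightarrow> nat. sum \<alpha> UNIV = k} \<subseteq> PiE UNIV (\<lambda>_. {..k})"
    by (auto intro!: member_le_sum)
qed (simp add: finite_PiE)

lemma monomial_value_scaleR:
  "monomial_value (t *\<^sub>R y) \<alpha> = t ^ sum \<alpha> UNIV * monomial_value y \<alpha>"
  by (simp add: monomial_value_def power_mult_distrib prod.distrib power_sum)

lemma abs_monomial_value_le: "\<bar>monomial_value y \<alpha>\<bar> \<le> norm y ^ sum \<alpha> UNIV"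
  unfolding monomial_value_def abs_prod power_sum
  by (intro prod_mono) (simp add: power_abs component_le_norm_cart power_mono)

lemma real_polynomial_function_component: "real_polynomial_function (\<lambda>y::real^'n. y $ i)"
  by (intro real_polynomial_function.intros(1) bounded_linear_vec_nth)

lemma real_polynomial_function_monomial_value: "real_polynomial_function (\<lambda>y. monomial_value y \<alpha>)"
  unfolding monomial_value_def
  by (intro real_polynomial_function_prod real_polynomial_function_power
      real_polynomial_function_component) simp

text \<open>The product rule gives one term per coordinate. The term of \<open>i\<close> is at most
  \<open>\<alpha> i\<close> times the norm of \<open>y\<close> to the degree minus one, and the
  exponents add up to the degree.\<close>

lemma monomial_value_has_derivative:
  "\<exists>D. ((\<lambda>y. monomial_value y \<alpha>) has_derivative D) (at y) \<and>
     (\<forall>h. \<bar>D h\<bar> \<le> real (sum \<alpha> UNIV) * norm y ^ (sum \<alpha> UNIV - 1) * norm h)"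
proof -
  let ?D = "\<lambda>h. \<Sum>i\<in>UNIV. real (\<alpha> i) * (h $ i) * (y $ i) ^ (\<alpha> i - 1) * (\<Prod>j\<in>UNIV - {i}. (y $ j) ^ \<alpha> j)"
  have "((\<lambda>y. monomial_value y \<alpha>) has_derivative ?D) (at y)"
    unfolding monomial_value_def
    by (intro has_derivative_prod has_derivative_power bounded_linear.has_derivative[OF bounded_linear_vec_nth]
        has_derivative_ident)
  moreover have "\<bar>?D h\<bar> \<le> real (sum \<alpha> UNIV) * norm y ^ (sum \<alpha> UNIV - 1) * norm h" for h
  proof -
    have *: "\<bar>real (\<alpha> i) * (h $ i) * (y $ i) ^ (\<alpha> i - 1) * (\<Prod>j\<in>UNIV - {i}. (y $ j) ^ \<alpha> j)\<bar>
        \<le> real (\<alpha> i) * (norm y ^ (sum \<alpha> UNIV - 1) * norm h)" for i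
    \<comment> \<open>The exponent \<open>\<alpha> i - 1\<close> is truncated at 0; the factor
      \<open>real (\<alpha> i)\<close> removes the terms in which this matters.\<close>
    proof (cases "\<alpha> i = 0")
      case False
      have prd: "\<bar>\<Prod>j\<in>UNIV - {i}. (y $ j) ^ \<alpha> j\<bar> \<le> norm y ^ sum \<alpha> (UNIV - {i})"
        unfolding abs_prod power_sum
        by (intro prod_mono) (simp add: power_abs component_le_norm_cart power_mono)
      have "sum \<alpha> UNIV = \<alpha> i + sum \<alpha> (UNIV - {i})"
        by (simp add: sum.remove)
      with False have e: "sum \<alpha> UNIV - 1 = (\<alpha> i - 1) + sum \<alpha> (UNIV - {i})" by simp
      have "\<bar>(y $ i) ^ (\<alpha> i - 1) * (\<Prod>j\<in>UNIV - {i}. (y $ j) ^ \<alpha> j)\<bar> \<le> norm y ^ (sum \<alpha> UNIV - 1)"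
        unfolding e power_add abs_mult
        by (intro mult_mono prd) (simp_all add: power_abs component_le_norm_cart power_mono)
      then have "\<bar>h $ i\<bar> * \<bar>(y $ i) ^ (\<alpha> i - 1) * (\<Prod>j\<in>UNIV - {i}. (y $ j) ^ \<alpha> j)\<bar>
          \<le> norm h * norm y ^ (sum \<alpha> UNIV - 1)"
        by (intro mult_mono) (simp_all add: component_le_norm_cart)
      from mult_left_mono[OF this, of "real (\<alpha> i)"] show ?thesis
        by (simp add: abs_mult mult_ac)
    qed simp
    have "\<bar>?D h\<bar> \<le> (\<Sum>i\<in>UNIV. real (\<alpha> i) * (norm y ^ (sum \<alpha> UNIV - 1) * norm h))"
      by (rule order_trans[OF sum_abs sum_mono]) (rule *)
    also have "\<dots> = (\<Sum>i\<in>UNIV. real (\<alpha> i)) * (norm y ^ (sum \<alpha> UNIV - 1) * norm h)"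
      by (rule sum_distrib_right[symmetric])
    finally show ?thesis by (simp only: of_nat_sum mult.assoc)
  qed
  ultimately show ?thesis by (intro exI[of _ ?D] conjI allI)
qed

text \<open>Evaluating the series at the diagonal point \<open>y0\<close> bounds all coefficients at
  once: their absolute values, weighted by \<open>s\<close> to the degree, have a finite sum
  \<open>M\<close>. Regrouping by degree then yields homogeneous polynomials with geometric bounds,
  ready for termwise differentiation.\<close>

lemma real_analytic_at_homogeneous_series:
  fixes F :: "real^'n::finite \<Rightarrow> real"
  assumes "real_analytic_at F 0"
  obtains Q :: "nat \<Rightarrow> real^'n \<Rightarrow> real" and Q' M s where
    "s > 0" "M \<ge> 0"
    "\<And>k. real_polynomial_function (Q k)"
    "\<And>k t y. Q k (t *\<^sub>R y) = t ^ k * Q k y"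
    "\<And>k y. (Q k has_derivative Q' k y) (at y)"
    "\<And>k y. \<bar>Q k y\<bar> \<le> M * (norm y / s) ^ k"
    "\<And>k y h. \<bar>Q' k y h\<bar> \<le> M * (real k * norm y ^ (k - 1) / s ^ k) * norm h"
    "\<And>y. norm y < s \<Longrightarrow> (\<lambda>k. Q k y) sums F y"
proof -
  obtain coef r where r: "r > 0" and
    ser': "\<forall>y\<in>ball 0 r. ((\<lambda>\<alpha>. coef \<alpha> * monomial_value (y - 0) \<alpha>) has_sum F y) UNIV"
    using assms unfolding real_analytic_at_def by (elim exE conjE)
  have ser: "((\<lambda>\<alpha>. coef \<alpha> * monomial_value y \<alpha>) has_sum F y) UNIV" if "y \<in> ball 0 r" for y
    using ser' that by simp
  \<comment> \<open>With \<open>CARD('n)\<close> in the denominator the l1-norm of the diagonal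
    point is r/2, so it lies in the ball of convergence.\<close>
  define s where "s = r / (2 * real CARD('n))"
  have s: "s > 0" using r by (simp add: s_def)
  have s_r: "s \<le> r / 2"
  proof -
    have "real CARD('n) \<ge> 1" by (simp add: Suc_leI)
    then show ?thesis unfolding s_def using r by (simp add: field_simps)
  qed
  define y0 :: "real^'n" where "y0 = (\<chi> i. s)"
  have "norm y0 \<le> (\<Sum>i\<in>UNIV. \<bar>y0 $ i\<bar>)" by (rule norm_le_l1_cart)
  also have "\<dots> = real CARD('n) * s" using s by (simp add: y0_def)
  also have "\<dots> = r / 2" by (simp add: s_def)
  finally have "y0 \<in> ball 0 r" using r by simp
  from ser[OF this] have "(\<lambda>\<alpha>. coef \<alpha> * monomial_value y0 \<alpha>) summable_on UNIV"
    by (rule has_sum_imp_summable)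
  \<comment> \<open>Unconditional summability of a real family is absolute, which frees the bound
    from the signs of the coefficients.\<close>
  then have "(\<lambda>\<alpha>. norm (coef \<alpha> * monomial_value y0 \<alpha>)) summable_on UNIV"
    by (rule summable_on_iff_abs_summable_on_real[THEN iffD1])
  moreover have "monomial_value y0 \<alpha> = s ^ sum \<alpha> UNIV" for \<alpha>
    by (simp add: y0_def monomial_value_def power_sum)
  ultimately have summ: "(\<lambda>\<alpha>. \<bar>coef \<alpha>\<bar> * s ^ sum \<alpha> UNIV) summable_on UNIV"
    using s by (simp add: abs_mult)
  define M where "M = infsum (\<lambda>\<alpha>. \<bar>coef \<alpha>\<bar> * s ^ sum \<alpha> UNIV) UNIV"
  have M0: "M \<ge> 0" unfolding M_def using s by (intro infsum_nonneg) simp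
  define I :: "nat \<Rightarrow> ('n \<Rightarrow> nat) set" where "I k = {\<alpha>. sum \<alpha> UNIV = k}" for k
  have fin: "finite (I k)" for k by (simp add: I_def finite_multi_indices_degree)
  have I: "sum \<alpha> UNIV = k" if "\<alpha> \<in> I k" for \<alpha> k using that by (simp add: I_def)
  have MI: "(\<Sum>\<alpha>\<in>I k. \<bar>coef \<alpha>\<bar>) \<le> M / s ^ k" for k
  proof -
    have "(\<Sum>\<alpha>\<in>I k. \<bar>coef \<alpha>\<bar> * s ^ sum \<alpha> UNIV) \<le> M"
      unfolding M_def using s by (intro finite_sum_le_infsum summ fin) auto
    also have "(\<Sum>\<alpha>\<in>I k. \<bar>coef \<alpha>\<bar> * s ^ sum \<alpha> UNIV) = (\<Sum>\<alpha>\<in>I k. \<bar>coef \<alpha>\<bar>) * s ^ k"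
      by (simp add: sum_distrib_right I)
    finally show ?thesis using s by (simp add: field_simps)
  qed
  define Q where "Q k y = (\<Sum>\<alpha>\<in>I k. coef \<alpha> * monomial_value y \<alpha>)" for k y
  obtain D where D: "\<And>\<alpha> y. ((\<lambda>y. monomial_value y \<alpha>) has_derivative D \<alpha> y) (at y)"
    and Db: "\<And>\<alpha> y h. \<bar>D \<alpha> y h\<bar> \<le> real (sum \<alpha> UNIV) * norm y ^ (sum \<alpha> UNIV - 1) * norm (h::real^'n)"
    using monomial_value_has_derivative by metis
  define Q' where "Q' k y h = (\<Sum>\<alpha>\<in>I k. coef \<alpha> * D \<alpha> y h)" for k y h
  show ?thesis
  proof (rule that[OF s M0])
    show "real_polynomial_function (Q k)" for k
      unfolding Q_def
      by (intro real_polynomial_function_sum fin real_polynomial_function.intros(4)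
          real_polynomial_function.intros(2) real_polynomial_function_monomial_value)
    show "Q k (t *\<^sub>R y) = t ^ k * Q k y" for k t y
      by (simp add: Q_def monomial_value_scaleR I sum_distrib_left mult_ac)
    show "(Q k has_derivative Q' k y) (at y)" for k y
      unfolding Q_def Q'_def by (intro has_derivative_sum has_derivative_mult_right D)
    show "\<bar>Q k y\<bar> \<le> M * (norm y / s) ^ k" for k y
    proof -
      have "\<bar>Q k y\<bar> \<le> (\<Sum>\<alpha>\<in>I k. \<bar>coef \<alpha>\<bar> * norm y ^ k)"
        unfolding Q_def
      proof (rule order_trans[OF sum_abs], rule sum_mono)
        fix \<alpha> assume "\<alpha> \<in> I k"
        then show "\<bar>coef \<alpha> * monomial_value y \<alpha>\<bar> \<le> \<bar>coef \<alpha>\<bar> * norm y ^ k"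
          using abs_monomial_value_le[of y \<alpha>] by (simp add: abs_mult I mult_left_mono)
      qed
      also have "\<dots> \<le> M / s ^ k * norm y ^ k"
        unfolding sum_distrib_right[symmetric] by (intro mult_right_mono MI) simp
      finally show ?thesis by (simp add: power_divide)
    qed
    show "\<bar>Q' k y h\<bar> \<le> M * (real k * norm y ^ (k - 1) / s ^ k) * norm h" for k y h
    proof -
      have "\<bar>Q' k y h\<bar> \<le> (\<Sum>\<alpha>\<in>I k. \<bar>coef \<alpha>\<bar> * (real k * norm y ^ (k - 1) * norm h))"
        unfolding Q'_def
      proof (rule order_trans[OF sum_abs], rule sum_mono)
        fix \<alpha> assume "\<alpha> \<in> I k"
        then show "\<bar>coef \<alpha> * D \<alpha> y h\<bar> \<le> \<bar>coef \<alpha>\<bar> * (real k * norm y ^ (k - 1) * norm h)"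
          using Db[of \<alpha> y h] by (simp add: abs_mult I mult_left_mono)
      qed
      also have "\<dots> \<le> M / s ^ k * (real k * norm y ^ (k - 1) * norm h)"
        unfolding sum_distrib_right[symmetric] by (intro mult_right_mono MI) simp
      finally show ?thesis by (simp add: mult_ac)
    qed
    show "(\<lambda>k. Q k y) sums F y" if y: "norm y < s" for y
    proof -
      have "y \<in> ball 0 r" using y s_r r by simp
      then have h: "((\<lambda>\<alpha>. coef \<alpha> * monomial_value y \<alpha>) has_sum F y) UNIV" by (rule ser)
      \<comment> \<open>Each multi-index has exactly one degree, so the sum runs over pairs of a
        degree and a multi-index of that degree; the finite inner sums are the values
        \<open>Q k y\<close>.\<close>
      have bij: "bij_betw snd (Sigma UNIV I) UNIV"
        by (rule bij_betwI[where g = "\<lambda>\<alpha>. (sum \<alpha> UNIV, \<alpha>)"]) (auto simp: I_def)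
      have "((\<lambda>z. coef (snd z) * monomial_value y (snd z)) has_sum F y) (Sigma UNIV I)"
        using has_sum_reindex_bij_betw[OF bij, of "\<lambda>\<alpha>. coef \<alpha> * monomial_value y \<alpha>"] h by simp
      then have "((\<lambda>k. Q k y) has_sum F y) UNIV"
        by (rule has_sum_SigmaD) (simp add: Q_def fin)
      then show ?thesis by (rule has_sum_imp_sums)
    qed
  qed
qed

text \<open>Differentiation replaces the coefficients \<open>a\<close> by \<open>diffs a\<close>,
  and after k steps the constant coefficient is \<open>fact k * a k\<close>.\<close>

lemma higher_deriv_powser_0:
  fixes a :: "nat \<Rightarrow> real"
  assumes "R > 0" and "\<And>t. \<bar>t\<bar> < R \<Longrightarrow> (\<lambda>n. a n * t ^ n) sums f t"
  shows "(deriv ^^ k) f 0 / fact k = a k"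
proof -
  \<comment> \<open>Coefficients and function are both generalised, since the induction passes from
    \<open>f\<close> to \<open>deriv f\<close> and from \<open>a\<close> to
    \<open>diffs a\<close>.\<close>
  have *: "\<forall>a f. (\<forall>t. \<bar>t\<bar> < R \<longrightarrow> (\<lambda>n. a n * t ^ n) sums f t) \<longrightarrow> (deriv ^^ k) f 0 = fact k * a k"
  proof (induction k)
    case 0
    show ?case
    proof (intro allI impI)
      fix a :: "nat \<Rightarrow> real" and f assume "\<forall>t. \<bar>t\<bar> < R \<longrightarrow> (\<lambda>n. a n * t ^ n) sums f t"
      from this[rule_format, of 0] have "(\<lambda>n. a n * 0 ^ n) sums f 0" using \<open>R > 0\<close> by simp
      then have "f 0 = a 0" using powser_sums_zero sums_unique2 by blast
      then show "(deriv ^^ 0) f 0 = fact 0 * a 0" by simp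
    qed
  next
    case (Suc k)
    show ?case
    proof (intro allI impI)
      fix a :: "nat \<Rightarrow> real" and f assume s: "\<forall>t. \<bar>t\<bar> < R \<longrightarrow> (\<lambda>n. a n * t ^ n) sums f t"
      have "(\<lambda>n. diffs a n * t ^ n) sums deriv f t" if t: "\<bar>t\<bar> < R" for t
      proof -
        have sm: "\<And>t. norm t < R \<Longrightarrow> summable (\<lambda>n. a n * t ^ n)"
          using s by (auto simp: sums_iff)
        have sd: "summable (\<lambda>n. diffs a n * t ^ n)"
          using termdiff_converges[of t R a] t sm by auto
        have D: "DERIV (\<lambda>t. \<Sum>n. a n * t ^ n) t :> (\<Sum>n. diffs a n * t ^ n)"
          using termdiffs_strong'[where K = R and c = a and z = t] sm t by auto
        have ev: "\<forall>\<^sub>F u in nhds t. (\<Sum>n. a n * u ^ n) = f u"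
        proof -
          have "open {u. \<bar>u\<bar> < R}" by (intro open_Collect_less continuous_intros)
          then have "\<forall>\<^sub>F u in nhds t. u \<in> {u. \<bar>u\<bar> < R}"
            using t by (intro eventually_nhds_in_open) auto
          then show ?thesis by eventually_elim (use s in \<open>auto simp: sums_iff\<close>)
        qed
        have "DERIV f t :> (\<Sum>n. diffs a n * t ^ n)"
          using D DERIV_cong_ev[OF refl ev refl] by blast
        then have "deriv f t = (\<Sum>n. diffs a n * t ^ n)" by (rule DERIV_imp_deriv)
        with sd show ?thesis by (simp add: sums_iff)
      qed
      with Suc.IH have "(deriv ^^ k) (deriv f) 0 = fact k * diffs a k" by blast
      then show "(deriv ^^ Suc k) f 0 = fact (Suc k) * a (Suc k)"
        by (simp add: funpow_Suc_right diffs_def algebra_simps del: funpow.simps)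
    qed
  qed
  with assms(2) have "(deriv ^^ k) f 0 = fact k * a k" by blast
  then show ?thesis by simp
qed

text \<open>Along a line through the origin the homogeneous series is a power series in t, which
  identifies its terms with the Taylor terms. On half the radius the series and its derivative are
  dominated by convergent numerical series, so the remainder after degree l has the order of the
  next term, and its derivative one order less.\<close>

lemma real_analytic_at_taylor:
  fixes F :: "real^'n::finite \<Rightarrow> real"
  assumes an: "real_analytic_at F 0"
  shows "real_polynomial_function (taylor_term k F)"
    and "taylor_term k F (t *\<^sub>R y) = t ^ k * taylor_term k F y"
    and "(\<And>k. taylor_term k F = (\<lambda>_. 0)) \<Longrightarrow> \<forall>\<^sub>F y in nhds 0. F y = 0"
    and "(\<And>k. k < l \<Longrightarrow> taylor_term k F = (\<lambda>_. 0)) \<Longrightarrow>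
      \<exists>\<rho>>0. \<exists>C\<ge>0. \<forall>y. norm y < \<rho> \<longrightarrow> F differentiable (at y) \<and>
        \<bar>F y - taylor_term l F y\<bar> \<le> C * norm y ^ Suc l \<and>
        (\<forall>h. \<bar>frechet_derivative F (at y) h - frechet_derivative (taylor_term l F) (at y) h\<bar>
            \<le> C * norm y ^ l * norm h)"
proof -
  obtain Q Q' M s where s: "s > 0" and M: "M \<ge> 0"
    and pol: "\<And>k. real_polynomial_function (Q k)"
    and hom: "\<And>k t y. Q k (t *\<^sub>R y) = t ^ k * Q k y"
    and der: "\<And>k y. (Q k has_derivative Q' k y) (at y)"
    and bd: "\<And>k y. \<bar>Q k y\<bar> \<le> M * (norm y / s) ^ k"
    and bd': "\<And>k y h. \<bar>Q' k y h\<bar> \<le> M * (real k * norm y ^ (k - 1) / s ^ k) * norm h"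
    and sums: "\<And>y. norm y < s \<Longrightarrow> (\<lambda>k. Q k y) sums F y"
    by (rule real_analytic_at_homogeneous_series[OF an]) blast
  have T: "taylor_term k F = Q k" for k
  proof
    fix y
    have "(deriv ^^ k) (\<lambda>t. F (t *\<^sub>R y)) 0 / fact k = Q k y"
    proof (rule higher_deriv_powser_0)
      \<comment> \<open>The summand 1 keeps the radius meaningful at \<open>y = 0\<close>.\<close>
      show "s / (norm y + 1) > 0" using s by (simp add: add_nonneg_pos)
      fix t :: real assume "\<bar>t\<bar> < s / (norm y + 1)"
      then have "\<bar>t\<bar> * (norm y + 1) < s" by (simp add: pos_less_divide_eq add_nonneg_pos)
      then have "norm (t *\<^sub>R y) < s" by (simp add: algebra_simps)
      from sums[OF this] show "(\<lambda>n. Q n y * t ^ n) sums F (t *\<^sub>R y)"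
        by (simp add: hom mult.commute)
    qed
    then show "taylor_term k F y = Q k y" by (simp add: taylor_term_def)
  qed
  show "real_polynomial_function (taylor_term k F)" by (simp add: T pol)
  show "taylor_term k F (t *\<^sub>R y) = t ^ k * taylor_term k F y" by (simp add: T hom)
  show "\<forall>\<^sub>F y in nhds 0. F y = 0" if "\<And>k. taylor_term k F = (\<lambda>_. 0)"
  proof -
    have "\<forall>\<^sub>F y in nhds 0. y \<in> ball (0::real^'n) s"
      using s by (intro eventually_nhds_in_open) auto
    then show ?thesis
    proof eventually_elim
      case (elim y)
      then have "(\<lambda>k. Q k y) sums F y" by (intro sums) simp
      then show ?case using that by (simp add: T sums_iff)
    qed
  qed
  show "\<exists>\<rho>>0. \<exists>C\<ge>0. \<forall>y. norm y < \<rho> \<longrightarrow> F differentiable (at y) \<and>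
        \<bar>F y - taylor_term l F y\<bar> \<le> C * norm y ^ Suc l \<and>
        (\<forall>h. \<bar>frechet_derivative F (at y) h - frechet_derivative (taylor_term l F) (at y) h\<bar>
            \<le> C * norm y ^ l * norm h)"
    if low: "\<And>k. k < l \<Longrightarrow> taylor_term k F = (\<lambda>_. 0)"
  proof -
    have Q0: "Q k = (\<lambda>_. 0)" if "k < l" for k using low[OF that] by (simp add: T)
    have Q'0: "Q' k y = (\<lambda>_. 0)" if "k < l" for k y
      using der[of k y] unfolding Q0[OF that] using has_derivative_const has_derivative_unique by blast
    define \<rho> where "\<rho> = s / 2"
    have \<rho>: "\<rho> > 0" using s by (simp add: \<rho>_def)
    \<comment> \<open>Majorant of \<open>Q' k\<close> on the ball of radius
      \<open>\<rho> = s / 2\<close>: up to the factor M/s it is k (1/2)^(k-1), which is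
      summable.\<close>
    define b where "b k = M * (real k * (\<rho> ^ (k - 1)) / s ^ k)" for k
    have b_eq: "b (Suc k) = M / s * (real (Suc k) * (1/2) ^ k)" for k
      using s by (simp add: b_def \<rho>_def power_divide field_simps)
    have "summable (\<lambda>k. real (Suc k) * (1/2::real) ^ k)"
      using sums_summable[OF geometric_deriv_sums[of "1/2::real"]] by simp
    then have sb: "summable b"
      by (subst summable_Suc_iff[symmetric]) (simp add: b_eq summable_mult del: of_nat_Suc)
    have b0: "b k \<ge> 0" for k using M s \<rho> by (simp add: b_def)
    have Q'b: "\<bar>Q' k y h\<bar> \<le> b k * norm h" if "norm y \<le> \<rho>" for k y h
    proof (rule order_trans[OF bd'], rule mult_right_mono)
      show "M * (real k * norm y ^ (k - 1) / s ^ k) \<le> b k"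
        unfolding b_def using that M s \<rho>
        by (intro mult_left_mono divide_right_mono power_mono) auto
    qed simp
    have sQ': "summable (\<lambda>k. Q' k y h)" if "norm y \<le> \<rho>" for y h
      using Q'b[OF that] by (intro summable_comparison_test[OF _ summable_mult2[OF sb, of "norm h"]]) auto
    define g' where "g' y h = (\<Sum>k. Q' k y h)" for y h
    have "\<exists>g. \<forall>y\<in>ball 0 \<rho>. (\<lambda>n. Q n y) sums g y \<and> (g has_derivative g' y) (at y within ball 0 \<rho>)"
    proof (rule has_derivative_series)
      show "convex (ball (0::real^'n) \<rho>)" by simp
      show "(Q n has_derivative Q' n y) (at y within ball 0 \<rho>)" for n y
        using der by (rule has_derivative_at_withinI)
      show "(0::real^'n) \<in> ball 0 \<rho>" using \<rho> by simp
      show "(\<lambda>n. Q n 0) sums F 0" using sums[of 0] s by simp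
      \<comment> \<open>The partial sums of the derivatives converge uniformly in \<open>y\<close>,
        because the tails of \<open>b\<close> bound their tails.\<close>
      fix e :: real assume "e > 0"
      then obtain N where N: "\<And>n. n \<ge> N \<Longrightarrow> norm (\<Sum>i. b (i + n)) < e"
        using suminf_exist_split[OF _ sb] by blast
      show "\<forall>\<^sub>F n in sequentially. \<forall>y\<in>ball 0 \<rho>. \<forall>h. norm ((\<Sum>i<n. Q' i y h) - g' y h) \<le> e * norm h"
        unfolding eventually_sequentially
      proof (intro exI allI impI ballI)
        fix n y h assume n: "n \<ge> N" and y: "y \<in> ball (0::real^'n) \<rho>"
        then have y: "norm y \<le> \<rho>" by simp
        have "g' y h - (\<Sum>i<n. Q' i y h) = (\<Sum>i. Q' (i + n) y h)"
          unfolding g'_def using suminf_split_initial_segment[OF sQ'[OF y, of h], of n] by simp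
        also have "norm \<dots> \<le> (\<Sum>i. b (i + n) * norm h)"
          using Q'b[OF y] sb by (intro norm_suminf_le summable_mult2 summable_ignore_initial_segment) auto
        also have "\<dots> = (\<Sum>i. b (i + n)) * norm h"
          using sb by (intro suminf_mult2[symmetric] summable_ignore_initial_segment)
        also have "\<dots> \<le> e * norm h" using N[OF n] by (intro mult_right_mono) auto
        finally show "norm ((\<Sum>i<n. Q' i y h) - g' y h) \<le> e * norm h"
          by (simp add: norm_minus_commute)
      qed
    qed
    then obtain g where g: "\<And>y. y \<in> ball 0 \<rho> \<Longrightarrow> (\<lambda>n. Q n y) sums g y"
      "\<And>y. y \<in> ball 0 \<rho> \<Longrightarrow> (g has_derivative g' y) (at y within ball 0 \<rho>)" by blast
    have gF: "g y = F y" if "y \<in> ball 0 \<rho>" for y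
      using g(1)[OF that] sums[of y] that \<rho> by (simp add: \<rho>_def sums_iff)
    have dF: "(F has_derivative g' y) (at y)" if "y \<in> ball 0 \<rho>" for y
      using has_derivative_transform_within_open[OF _ open_ball that gF] g(2)[OF that] that
      by (simp add: at_within_open[OF that open_ball])
    \<comment> \<open>\<open>C1\<close> and \<open>C2\<close> bound the tails after degree l of the
      function and of its derivative: l + 1 powers of the norm of \<open>y\<close> (l for the
      derivative) are kept, and the remaining ones give powers of 1/2.\<close>
    define C1 where "C1 = (\<Sum>i. M / s ^ Suc l * (1/2) ^ i)"
    define C2 where "C2 = (\<Sum>i. M / s ^ Suc l * (real (i + Suc l) * (1/2) ^ i))"
    have sm1: "summable (\<lambda>i. M / s ^ Suc l * (1/2) ^ i)" by (intro summable_mult) simp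
    have "summable (\<lambda>i. real (Suc i) * (1/2::real) ^ i + real l * (1/2) ^ i)"
      using sums_summable[OF geometric_deriv_sums[of "1/2::real"]] by (intro summable_add summable_mult) auto
    then have sm2: "summable (\<lambda>i. M / s ^ Suc l * (real (i + Suc l) * (1/2) ^ i))"
      by (intro summable_mult) (simp add: algebra_simps)
    have C1: "C1 \<ge> 0" unfolding C1_def using M s by (intro suminf_nonneg sm1) auto
    have C2: "C2 \<ge> 0" unfolding C2_def using M s by (intro suminf_nonneg sm2) auto
    show ?thesis
    proof (rule exI[of _ \<rho>], intro conjI, rule \<rho>, rule exI[of _ "C1 + C2"], intro conjI allI impI)
      show "C1 + C2 \<ge> 0" using C1 C2 by auto
      fix y :: "real^'n" assume y: "norm y < \<rho>"
      have ys: "(norm y / s) ^ i \<le> (1/2) ^ i" for i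
        using y s by (intro power_mono) (auto simp: \<rho>_def field_simps)
      have F': "frechet_derivative F (at y) = g' y"
        using y by (intro frechet_derivative_at[symmetric] dF) simp
      have Q': "frechet_derivative (taylor_term l F) (at y) = Q' l y"
        unfolding T by (intro frechet_derivative_at[symmetric] der)
      show "F differentiable (at y)" using dF[of y] y unfolding differentiable_def by auto
      have Fs: "(\<lambda>i. Q i y) sums F y" using sums[of y] y s by (simp add: \<rho>_def)
      have "F y = (\<Sum>i. Q (i + Suc l) y) + (\<Sum>i<Suc l. Q i y)"
        unfolding sums_unique[OF Fs] by (rule suminf_split_initial_segment[OF sums_summable[OF Fs]])
      also have "(\<Sum>i<Suc l. Q i y) = Q l y" by (simp add: Q0)
      finally have "F y - taylor_term l F y = (\<Sum>i. Q (i + Suc l) y)" by (simp add: T)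
      also have "\<bar>\<dots>\<bar> \<le> (\<Sum>i. M / s ^ Suc l * (1/2) ^ i * norm y ^ Suc l)"
      proof (rule norm_suminf_le[of "\<lambda>i. Q (i + Suc l) y", unfolded real_norm_def])
        fix i
        have "\<bar>Q (i + Suc l) y\<bar> \<le> M / s ^ Suc l * norm y ^ Suc l * (norm y / s) ^ i"
          using bd[of "i + Suc l" y] unfolding power_add power_divide by (simp only: mult_ac times_divide_eq_left times_divide_eq_right)
        also have "\<dots> \<le> M / s ^ Suc l * norm y ^ Suc l * (1/2) ^ i"
          using M s by (intro mult_left_mono ys) auto
        finally show "\<bar>Q (i + Suc l) y\<bar> \<le> M / s ^ Suc l * (1/2) ^ i * norm y ^ Suc l"
          by (simp only: mult_ac)
      qed (rule summable_mult2[OF sm1])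
      also have "\<dots> = C1 * norm y ^ Suc l"
        unfolding C1_def by (rule suminf_mult2[OF sm1, symmetric])
      also have "\<dots> \<le> (C1 + C2) * norm y ^ Suc l" using C2 by (intro mult_right_mono) auto
      finally show "\<bar>F y - taylor_term l F y\<bar> \<le> (C1 + C2) * norm y ^ Suc l" .
      fix h
      have "g' y h = (\<Sum>i. Q' (i + Suc l) y h) + (\<Sum>i<Suc l. Q' i y h)"
        unfolding g'_def using y by (intro suminf_split_initial_segment sQ') simp
      also have "(\<Sum>i<Suc l. Q' i y h) = Q' l y h" by (simp add: Q'0)
      finally have "g' y h - Q' l y h = (\<Sum>i. Q' (i + Suc l) y h)" by simp
      also have "\<bar>\<dots>\<bar> \<le> (\<Sum>i. M / s ^ Suc l * (real (i + Suc l) * (1/2) ^ i) * (norm y ^ l * norm h))"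
      proof (rule norm_suminf_le[of "\<lambda>i. Q' (i + Suc l) y h", unfolded real_norm_def])
        fix i
        have e: "norm y ^ (i + Suc l - 1) / s ^ (i + Suc l) = norm y ^ l * (norm y / s) ^ i / s ^ Suc l"
          by (simp add: power_add power_divide mult_ac)
        have "M * (real (i + Suc l) * norm y ^ (i + Suc l - 1) / s ^ (i + Suc l)) * norm h
            = M / s ^ Suc l * (norm y ^ l * norm h) * real (i + Suc l) * (norm y / s) ^ i"
          unfolding times_divide_eq_right[symmetric] e by (simp only: mult_ac times_divide_eq_left times_divide_eq_right)
        then have "\<bar>Q' (i + Suc l) y h\<bar> \<le> M / s ^ Suc l * (norm y ^ l * norm h) * real (i + Suc l) * (norm y / s) ^ i"
          using bd'[of "i + Suc l" y h] by (simp only:)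
        also have "\<dots> \<le> M / s ^ Suc l * (norm y ^ l * norm h) * real (i + Suc l) * (1/2) ^ i"
          using M s by (intro mult_left_mono ys) auto
        finally show "\<bar>Q' (i + Suc l) y h\<bar>
            \<le> M / s ^ Suc l * (real (i + Suc l) * (1/2) ^ i) * (norm y ^ l * norm h)"
          by (simp only: mult_ac)
      qed (rule summable_mult2[OF sm2])
      also have "\<dots> = C2 * (norm y ^ l * norm h)"
        unfolding C2_def by (rule suminf_mult2[OF sm2, symmetric])
      also have "\<dots> \<le> (C1 + C2) * (norm y ^ l * norm h)" using C1 by (intro mult_right_mono) auto
      finally show "\<bar>frechet_derivative F (at y) h - frechet_derivative (taylor_term l F) (at y) h\<bar>
            \<le> (C1 + C2) * norm y ^ l * norm h"
        by (simp only: F' Q' mult.assoc)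
    qed
  qed
qed

section \<open>Crossing arguments\<close>

text \<open>The time \<open>s'\<close> is the first at which \<open>f\<close> equals
  \<open>lo\<close>, and \<open>s\<close> is the last before \<open>s'\<close> at which it equals
  \<open>hi\<close>; by the intermediate value theorem \<open>f\<close> cannot leave the strip in
  between.\<close>

lemma downcrossing:
  fixes f :: "real \<Rightarrow> real"
  assumes cont: "continuous_on {a..b} f" and ab: "a \<le> b" and hi: "f a \<ge> hi" and lo: "f b \<le> lo" and less: "lo < hi"
  obtains s s' where "a \<le> s" "s < s'" "s' \<le> b" "f s = hi" "f s' = lo"
    "\<And>t. s \<le> t \<Longrightarrow> t \<le> s' \<Longrightarrow> lo \<le> f t \<and> f t \<le> hi"
proof -
  let ?S = "{t\<in>{a..b}. f t = lo}"
  have neS: "?S \<noteq> {}" using IVT2'[of f b lo a] cont ab hi lo less by force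
  have coS: "compact ?S"
    unfolding compact_eq_bounded_closed
    using continuous_closed_preimage_constant[OF cont closed_atLeastAtMost]
    by (auto intro: bounded_subset[OF bounded_closed_interval[of a b]])
  from compact_attains_inf[OF coS neS]
  obtain s' where s': "s' \<in> ?S" "\<And>t. t \<in> ?S \<Longrightarrow> s' \<le> t" by blast
  have above: "f t \<ge> lo" if "a \<le> t" "t \<le> s'" for t
  proof (rule ccontr)
    assume "\<not> f t \<ge> lo"
    then have "\<exists>z\<ge>a. z \<le> t \<and> f z = lo"
      using that s' cont hi less by (intro IVT2') (auto intro: continuous_on_subset)
    then obtain z where "a \<le> z" "z \<le> t" "f z = lo" by blast
    with s' that have "z = t" by force
    with \<open>f z = lo\<close> \<open>\<not> f t \<ge> lo\<close> show False by simp
  qed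
  have cont': "continuous_on {a..s'} f" using cont s' by (auto intro: continuous_on_subset)
  let ?R = "{t\<in>{a..s'}. f t = hi}"
  have neR: "?R \<noteq> {}" using IVT2'[of f s' hi a] cont' s' hi less by force
  have coR: "compact ?R"
    unfolding compact_eq_bounded_closed
    using continuous_closed_preimage_constant[OF cont' closed_atLeastAtMost]
    by (auto intro: bounded_subset[OF bounded_closed_interval[of a s']])
  from compact_attains_sup[OF coR neR]
  obtain s where s: "s \<in> ?R" "\<And>t. t \<in> ?R \<Longrightarrow> t \<le> s" by blast
  have below: "f t \<le> hi" if "s \<le> t" "t \<le> s'" for t
  proof (rule ccontr)
    assume "\<not> f t \<le> hi"
    then have "\<exists>z\<ge>t. z \<le> s' \<and> f z = hi"
      using that s' s cont' less by (intro IVT2') (auto intro: continuous_on_subset)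
    then obtain z where "t \<le> z" "z \<le> s'" "f z = hi" by blast
    with s(2)[of z] s(1) that have "z = t" by simp
    with \<open>f z = hi\<close> \<open>\<not> f t \<le> hi\<close> show False by simp
  qed
  have "s \<noteq> s'" using s s' less by auto
  then show ?thesis using that[of s s'] s s' above below by force
qed

text \<open>The limit is the limes superior, taken as the infimum of the eventual upper bounds. A
  level strictly between \<open>b\<close> and this infimum is exceeded at arbitrarily late times,
  after which the hypothesis keeps \<open>f\<close> above \<open>b\<close>.\<close>

lemma convergent_if_no_downcrossings:
  fixes f :: "real \<Rightarrow> real"
  assumes bd: "\<And>t. t \<ge> t0 \<Longrightarrow> \<bar>f t\<bar> \<le> K"
    and no: "\<And>lo hi. lo < hi \<Longrightarrow> \<exists>T\<ge>t0. \<forall>s\<ge>T. \<forall>t\<ge>s. f s \<ge> hi \<longrightarrow> f t > lo"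
  shows "\<exists>L. (f \<longlongrightarrow> L) at_top"
proof -
  define S where "S = {h. \<exists>T\<ge>t0. \<forall>t\<ge>T. f t \<le> h}"
  have "K \<in> S" unfolding S_def using bd by (force simp: abs_le_iff)
  have bb: "bdd_below S"
  proof (rule bdd_belowI[of _ "- K"])
    fix h assume "h \<in> S"
    then obtain T where "T \<ge> t0" "f T \<le> h" unfolding S_def by auto
    with bd[of T] show "- K \<le> h" by auto
  qed
  define L where "L = Inf S"
  have "(f \<longlongrightarrow> L) at_top"
  proof (rule order_tendstoI)
    fix b assume "L < b"
    then obtain h where "h \<in> S" "h < b"
      unfolding L_def using cInf_less_iff[OF _ bb] \<open>K \<in> S\<close> by auto
    then show "\<forall>\<^sub>F t in at_top. f t < b"
      unfolding S_def eventually_at_top_linorder by force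
  next
    fix b assume "b < L"
    define m where "m = (b + L) / 2"
    have m: "b < m" "m < L" using \<open>b < L\<close> by (auto simp: m_def)
    obtain T where T: "T \<ge> t0" "\<And>s t. s \<ge> T \<Longrightarrow> t \<ge> s \<Longrightarrow> f s \<ge> m \<Longrightarrow> f t > b"
      using no[OF m(1)] by blast
    have "m \<notin> S" using cInf_lower[OF _ bb, of m] m by (auto simp: L_def)
    then obtain s where "s \<ge> T" "f s > m" using T(1) unfolding S_def by force
    with T(2) show "\<forall>\<^sub>F t in at_top. f t > b"
      unfolding eventually_at_top_linorder by force
  qed
  then show ?thesis by blast
qed

text \<open>\<open>\<xi> + (C/z) r\<close> increases where \<open>\<xi>\<close> stays on the far side of \<open>z \<noteq> 0\<close> from the origin. This
  excludes late downcrossings of intervals that avoid \<open>0\<close>, and every interval contains such a one.\<close>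

lemma almost_monotone_convergent:
  fixes r \<rho> \<xi> X :: "real \<Rightarrow> real"
  assumes r': "\<And>t. t \<ge> t0 \<Longrightarrow> (r has_real_derivative \<rho> t * r t * \<xi> t) (at t)"
    and \<xi>': "\<And>t. t \<ge> t0 \<Longrightarrow> (\<xi> has_real_derivative \<rho> t * X t) (at t)"
    and X: "\<And>t. t \<ge> t0 \<Longrightarrow> X t \<ge> - C * r t"
    and bd: "\<And>t. t \<ge> t0 \<Longrightarrow> \<bar>\<xi> t\<bar> \<le> K"
    and pos: "\<And>t. t \<ge> t0 \<Longrightarrow> r t > 0" "\<And>t. t \<ge> t0 \<Longrightarrow> \<rho> t > 0" and C: "C > 0"
    and r0: "(r \<longlongrightarrow> 0) at_top"
  shows "\<exists>L\<le>0. (\<xi> \<longlongrightarrow> L) at_top"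
proof -
  \<comment> \<open>The condition on \<open>\<kappa>\<close> makes \<open>\<xi> + \<kappa> r\<close>
    non-decreasing while \<open>\<xi>\<close> lies between \<open>lo\<close> and \<open>hi\<close>:
    its derivative is at least \<open>\<rho> * r * (\<kappa> * \<xi> - C)\<close>.\<close>
  have step: "\<exists>T\<ge>t0. \<forall>s\<ge>T. \<forall>t\<ge>s. \<xi> s \<ge> hi \<longrightarrow> \<xi> t > lo"
    if less: "lo < hi" and \<kappa>: "\<And>z. lo \<le> z \<Longrightarrow> z \<le> hi \<Longrightarrow> \<kappa> * z \<ge> C" for lo hi \<kappa>
  proof -
    \<comment> \<open>Beyond \<open>T\<close> the term \<open>\<kappa> r\<close> changes by at most
      half the height of the interval; the summand 1 covers \<open>\<kappa> = 0\<close>.\<close>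
    have "(hi - lo) / (2 * (\<bar>\<kappa>\<bar> + 1)) > 0" using less by simp
    from order_tendstoD(2)[OF r0 this] obtain T where T: "\<And>t. t \<ge> T \<Longrightarrow> r t < (hi - lo) / (2 * (\<bar>\<kappa>\<bar> + 1))"
      unfolding eventually_at_top_linorder by blast
    have "\<xi> t > lo" if st: "s \<ge> max T t0" "t \<ge> s" "\<xi> s \<ge> hi" for s t
    proof (rule ccontr)
      assume "\<not> \<xi> t > lo"
      have "continuous_on {s..t} \<xi>"
        by (intro DERIV_atLeastAtMost_imp_continuous_on) (meson \<xi>' st(1) max.boundedE order_trans)
      then obtain a b where ab: "s \<le> a" "a < b" "b \<le> t" "\<xi> a = hi" "\<xi> b = lo"
        "\<And>u. a \<le> u \<Longrightarrow> u \<le> b \<Longrightarrow> lo \<le> \<xi> u \<and> \<xi> u \<le> hi"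
        by (rule downcrossing[of s t \<xi> hi lo]) (use st less \<open>\<not> \<xi> t > lo\<close> in auto)
      have "\<xi> a + \<kappa> * r a \<le> \<xi> b + \<kappa> * r b"
      proof (rule DERIV_nonneg_imp_nondecreasing[of a b "\<lambda>u. \<xi> u + \<kappa> * r u"])
        show "a \<le> b" using ab by simp
        fix u assume u: "a \<le> u" "u \<le> b"
        then have t0: "u \<ge> t0" using ab st by simp
        have "((\<lambda>u. \<xi> u + \<kappa> * r u) has_real_derivative \<rho> u * X u + \<kappa> * (\<rho> u * r u * \<xi> u)) (at u)"
          by (intro DERIV_add DERIV_cmult \<xi>' r' t0)
        moreover have "\<rho> u * X u + \<kappa> * (\<rho> u * r u * \<xi> u) \<ge> 0"
        proof -
          have "\<kappa> * \<xi> u \<ge> C" using \<kappa> ab(6) u by blast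
          then have "r u * (\<kappa> * \<xi> u) \<ge> r u * C" using pos t0 by (intro mult_left_mono) (auto simp: less_imp_le)
          then have "X u + \<kappa> * (r u * \<xi> u) \<ge> 0" using X[OF t0] by (simp add: mult_ac)
          then have "\<rho> u * (X u + \<kappa> * (r u * \<xi> u)) \<ge> 0" using pos(2)[OF t0] by simp
          then show ?thesis by (simp add: algebra_simps)
        qed
        ultimately show "\<exists>y. ((\<lambda>u. \<xi> u + \<kappa> * r u) has_real_derivative y) (at u) \<and> y \<ge> 0" by blast
      qed
      then have "hi - lo \<le> \<kappa> * (r b - r a)" using ab by (simp add: algebra_simps)
      also have "\<dots> \<le> \<bar>\<kappa>\<bar> * \<bar>r b - r a\<bar>" by (metis abs_ge_self abs_mult)
      also have "\<dots> \<le> (\<bar>\<kappa>\<bar> + 1) * ((hi - lo) / (2 * (\<bar>\<kappa>\<bar> + 1)))"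
      proof (intro mult_mono)
        have "0 < r a" "0 < r b" "r a < (hi - lo) / (2 * (\<bar>\<kappa>\<bar> + 1))" "r b < (hi - lo) / (2 * (\<bar>\<kappa>\<bar> + 1))"
          using pos T ab st by auto
        then show "\<bar>r b - r a\<bar> \<le> (hi - lo) / (2 * (\<bar>\<kappa>\<bar> + 1))" by (simp add: abs_le_iff)
      qed auto
      also have "\<dots> = (hi - lo) / 2" by (simp add: field_simps)
      finally show False using less by simp
    qed
    then show ?thesis by (intro exI[of _ "max T t0"]) auto
  qed
  have "\<exists>T\<ge>t0. \<forall>s\<ge>T. \<forall>t\<ge>s. \<xi> s \<ge> hi \<longrightarrow> \<xi> t > lo" if less: "lo < hi" for lo hi
  proof (cases "hi > 0")
    case True
    \<comment> \<open>The interval from \<open>m\<close> to \<open>hi\<close> lies in the positive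
      half-line, where \<open>C / m\<close> fulfils the condition of \<open>step\<close>.\<close>
    define m where "m = (max lo 0 + hi) / 2"
    have m: "0 < m" "lo < m" "m < hi" using True less by (auto simp: m_def)
    have "\<exists>T\<ge>t0. \<forall>s\<ge>T. \<forall>t\<ge>s. \<xi> s \<ge> hi \<longrightarrow> \<xi> t > m"
      by (rule step[where \<kappa> = "C / m"]) (use m C in \<open>auto simp: field_simps\<close>)
    then show ?thesis using m by (meson less_trans)
  next
    case False
    \<comment> \<open>The interval from \<open>lo\<close> to \<open>m\<close> lies in the negative
      half-line, where the negative coefficient \<open>C / m\<close> works; a descent from
      \<open>hi\<close> to \<open>lo\<close> has to cross it.\<close>
    define m where "m = (lo + hi) / 2"
    have m: "lo < m" "m < hi" "m < 0" using False less by (auto simp: m_def)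
    have "\<exists>T\<ge>t0. \<forall>s\<ge>T. \<forall>t\<ge>s. \<xi> s \<ge> m \<longrightarrow> \<xi> t > lo"
    proof (rule step[where \<kappa> = "C / m"])
      fix z assume z: "z \<le> m"
      have "C * z \<le> C * m" using z C by simp
      then show "C / m * z \<ge> C" using m by (simp add: field_simps)
    qed (use m in simp)
    then show ?thesis using m by (meson less_imp_le order_trans)
  qed
  then obtain L where L: "(\<xi> \<longlongrightarrow> L) at_top"
    using convergent_if_no_downcrossings[of t0 \<xi> K] bd by blast
  \<comment> \<open>With \<open>L\<close> positive the radius would be non-decreasing from some time
    on, although it is positive and tends to 0.\<close>
  have "L \<le> 0"
  proof (rule ccontr)
    assume "\<not> L \<le> 0"
    then obtain T where T: "\<And>t. t \<ge> T \<Longrightarrow> \<xi> t > 0"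
      using order_tendstoD(1)[OF L, of 0] unfolding eventually_at_top_linorder by auto
    define a where "a = max T t0"
    have "r a \<le> r t" if "t \<ge> a" for t
    proof (rule DERIV_nonneg_imp_nondecreasing[of a t r])
      show "a \<le> t" by fact
      fix u assume "a \<le> u" "u \<le> t"
      then have "u \<ge> T" "u \<ge> t0" by (auto simp: a_def)
      with T pos have "\<rho> u * r u * \<xi> u \<ge> 0" by (simp add: less_imp_le)
      with r'[OF \<open>u \<ge> t0\<close>] show "\<exists>y. (r has_real_derivative y) (at u) \<and> y \<ge> 0" by blast
    qed
    then have "\<forall>\<^sub>F t in at_top. r a \<le> r t" unfolding eventually_at_top_linorder by blast
    then have "r a \<le> 0" using tendsto_lowerbound[OF r0] by simp
    with pos(1)[of a] show False by (simp add: a_def)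
  qed
  with L show ?thesis by blast
qed

text \<open>While \<open>N \<ge> \<epsilon>\<close>, the function \<open>F - (\<kappa>/K) N\<close> increases, so an upcrossing of \<open>N\<close> from
  \<open>\<epsilon>\<close> to \<open>2\<epsilon>\<close> contradicts the Cauchy criterion for \<open>F\<close>; and \<open>F + (\<kappa>/K) ln r\<close> increases as
  well, so \<open>N \<ge> \<epsilon>\<close> cannot persist. Comparing derivatives in this way avoids passing to the
  time \<open>\<tau>\<close> with \<open>d\<tau> = \<rho> dt\<close>.\<close>

lemma tendsto_0_if_dissipated:
  fixes F F' N N' r \<rho> \<xi> :: "real \<Rightarrow> real"
  assumes r': "\<And>t. t \<ge> t0 \<Longrightarrow> (r has_real_derivative \<rho> t * r t * \<xi> t) (at t)"
    and F': "\<And>t. t \<ge> t0 \<Longrightarrow> (F has_real_derivative \<rho> t * F' t) (at t)"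
    and N': "\<And>t. t \<ge> t0 \<Longrightarrow> (N has_real_derivative \<rho> t * N' t) (at t)"
    and bd: "\<And>t. t \<ge> t0 \<Longrightarrow> \<bar>\<xi> t\<bar> \<le> K" "\<And>t. t \<ge> t0 \<Longrightarrow> N' t \<le> K" and K: "K > 0"
    and pos: "\<And>t. t \<ge> t0 \<Longrightarrow> r t > 0" "\<And>t. t \<ge> t0 \<Longrightarrow> \<rho> t > 0" "\<And>t. t \<ge> t0 \<Longrightarrow> N t \<ge> 0"
    and r0: "(r \<longlongrightarrow> 0) at_top"
    and FL: "(F \<longlongrightarrow> L) at_top"
    and diss: "\<And>\<epsilon>. \<epsilon> > 0 \<Longrightarrow> \<exists>\<kappa>>0. \<forall>\<^sub>F t in at_top. N t \<ge> \<epsilon> \<longrightarrow> F' t \<ge> \<kappa>"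
  shows "(N \<longlongrightarrow> 0) at_top"
proof (rule order_tendstoI)
  fix b :: real assume "b < 0"
  then show "\<forall>\<^sub>F t in at_top. b < N t"
    unfolding eventually_at_top_linorder using pos(3) by (intro exI[of _ t0]) force
next
  fix b :: real assume "0 < b"
  define \<epsilon> where "\<epsilon> = b / 2"
  have \<epsilon>: "\<epsilon> > 0" using \<open>0 < b\<close> by (simp add: \<epsilon>_def)
  obtain \<kappa> where \<kappa>: "\<kappa> > 0" and ev: "\<forall>\<^sub>F t in at_top. N t \<ge> \<epsilon> \<longrightarrow> F' t \<ge> \<kappa>"
    using diss[OF \<epsilon>] by blast
  \<comment> \<open>An upcrossing of \<open>N\<close> from \<open>\<epsilon>\<close> to
    \<open>2 * \<epsilon>\<close> raises \<open>F\<close> by at least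
    \<open>\<kappa> / K * \<epsilon> = 4 * \<delta>\<close>, whereas late values of \<open>F\<close>
    differ by less than \<open>2 * \<delta>\<close>.\<close>
  define \<delta> where "\<delta> = \<kappa> / K * \<epsilon> / 4"
  have \<delta>: "\<delta> > 0" using \<epsilon> \<kappa> K by (simp add: \<delta>_def)
  from ev tendstoD[OF FL \<delta>] have "\<forall>\<^sub>F t in at_top. (N t \<ge> \<epsilon> \<longrightarrow> F' t \<ge> \<kappa>) \<and> dist (F t) L < \<delta>"
    by (rule eventually_conj)
  then obtain T0 where T0: "\<And>t. t \<ge> T0 \<Longrightarrow> (N t \<ge> \<epsilon> \<longrightarrow> F' t \<ge> \<kappa>) \<and> dist (F t) L < \<delta>"
    unfolding eventually_at_top_linorder by blast
  define T where "T = max T0 t0"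
  have T: "t \<ge> t0" "N t \<ge> \<epsilon> \<Longrightarrow> F' t \<ge> \<kappa>" "dist (F t) L < \<delta>" if "t \<ge> T" for t
    using T0[of t] that by (auto simp: T_def)
  have "\<exists>t\<ge>T. N t < \<epsilon>"
  proof (rule ccontr)
    assume "\<not> ?thesis"
    then have N: "N t \<ge> \<epsilon>" if "t \<ge> T" for t using that by force
    have "F T + \<kappa> / K * ln (r T) \<le> F t + \<kappa> / K * ln (r t)" if "t \<ge> T" for t
    proof (rule DERIV_nonneg_imp_nondecreasing[of T t "\<lambda>u. F u + \<kappa> / K * ln (r u)"])
      show "T \<le> t" by fact
      fix u assume u: "T \<le> u" "u \<le> t"
      note t0 = T(1)[OF u(1)]
      have "((\<lambda>u. F u + \<kappa> / K * ln (r u)) has_real_derivative \<rho> u * F' u + \<kappa> / K * (1 / r u * (\<rho> u * r u * \<xi> u))) (at u)"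
        using pos(1)[OF t0] by (intro DERIV_add DERIV_cmult F' t0 DERIV_chain2[OF _ r'] DERIV_ln_divide)
      moreover have "\<rho> u * F' u + \<kappa> / K * (1 / r u * (\<rho> u * r u * \<xi> u)) = \<rho> u * (F' u + \<kappa> / K * \<xi> u)"
        using pos(1)[OF t0] by (simp add: field_simps)
      moreover have "F' u + \<kappa> / K * \<xi> u \<ge> 0"
      proof -
        have "\<kappa> / K * \<xi> u \<ge> \<kappa> / K * (- K)" using bd(1)[OF t0] \<kappa> K by (intro mult_left_mono) auto
        then show ?thesis using T(2)[OF u(1) N[OF u(1)]] K by simp
      qed
      ultimately show "\<exists>y. ((\<lambda>u. F u + \<kappa> / K * ln (r u)) has_real_derivative y) (at u) \<and> y \<ge> 0"
        using pos(2)[OF t0] by (metis less_imp_le mult_nonneg_nonneg)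
    qed
    note incr = this
    \<comment> \<open>Monotonicity of \<open>F + \<kappa> / K * ln r\<close>, with \<open>F\<close>
      below \<open>L + \<delta>\<close>, keeps \<open>ln r\<close> above \<open>m\<close>.\<close>
    define m where "m = (F T + \<kappa> / K * ln (r T) - L - \<delta>) * K / \<kappa>"
    have "filterlim r (at_right 0) at_top"
      using r0 pos(1) by (intro tendsto_imp_filterlim_at_right) (auto simp: eventually_at_top_linorder)
    then have "filterlim (\<lambda>t. ln (r t)) at_bot at_top"
      by (rule filterlim_compose[OF ln_at_0])
    then have "\<forall>\<^sub>F t in at_top. ln (r t) < m" by (simp add: filterlim_at_bot_dense)
    then obtain t1 where t1: "\<And>t. t \<ge> t1 \<Longrightarrow> ln (r t) < m"
      unfolding eventually_at_top_linorder by blast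
    define t where "t = max t1 T"
    have "F T + \<kappa> / K * ln (r T) - L - \<delta> \<le> \<kappa> / K * ln (r t)"
      using incr[of t] T(3)[of t] by (simp add: t_def dist_real_def)
    then have "m \<le> ln (r t)" using \<kappa> K by (simp add: m_def field_simps)
    with t1[of t] show False by (simp add: t_def)
  qed
  then obtain s where s: "s \<ge> T" "N s < \<epsilon>" by blast
  have "N t < b" if st: "t \<ge> s" for t
  proof (rule ccontr)
    assume "\<not> N t < b"
    then have b: "N t \<ge> 2 * \<epsilon>" by (simp add: \<epsilon>_def)
    \<comment> \<open>An upcrossing of \<open>N\<close> is a downcrossing of
      \<open>- N\<close>.\<close>
    have "continuous_on {s..t} (\<lambda>t. - N t)"
      by (intro continuous_on_minus DERIV_atLeastAtMost_imp_continuous_on) (meson N' T(1) s(1) order_trans)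
    then obtain a c where ac: "s \<le> a" "a < c" "c \<le> t" "- N a = - \<epsilon>" "- N c = - (2 * \<epsilon>)"
      "\<And>u. a \<le> u \<Longrightarrow> u \<le> c \<Longrightarrow> - (2 * \<epsilon>) \<le> - N u \<and> - N u \<le> - \<epsilon>"
      by (rule downcrossing[of s t _ "- \<epsilon>" "- (2 * \<epsilon>)"]) (use st s b \<epsilon> in auto)
    have "F a - \<kappa> / K * N a \<le> F c - \<kappa> / K * N c"
    proof (rule DERIV_nonneg_imp_nondecreasing[of a c "\<lambda>u. F u - \<kappa> / K * N u"])
      show "a \<le> c" using ac by simp
      fix u assume u: "a \<le> u" "u \<le> c"
      then have uT: "u \<ge> T" using s ac by simp
      note t0 = T(1)[OF uT]
      have "((\<lambda>u. F u - \<kappa> / K * N u) has_real_derivative \<rho> u * F' u - \<kappa> / K * (\<rho> u * N' u)) (at u)"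
        by (intro DERIV_diff DERIV_cmult F' N' t0)
      moreover have "\<rho> u * F' u - \<kappa> / K * (\<rho> u * N' u) = \<rho> u * (F' u - \<kappa> / K * N' u)"
        by (simp add: algebra_simps)
      moreover have "F' u - \<kappa> / K * N' u \<ge> 0"
      proof -
        have "\<kappa> / K * N' u \<le> \<kappa> / K * K" using bd(2)[OF t0] \<kappa> K by (intro mult_left_mono) auto
        moreover have "N u \<ge> \<epsilon>" using ac(6)[OF u] by simp
        ultimately show ?thesis using T(2)[OF uT] K by simp
      qed
      ultimately show "\<exists>y. ((\<lambda>u. F u - \<kappa> / K * N u) has_real_derivative y) (at u) \<and> y \<ge> 0"
        using pos(2)[OF t0] by (metis less_imp_le mult_nonneg_nonneg)
    qed
    then have "\<kappa> / K * (N c - N a) \<le> F c - F a" by (simp only: right_diff_distrib)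
    moreover have "N c - N a = \<epsilon>" using ac by simp
    ultimately have "\<kappa> / K * \<epsilon> \<le> F c - F a" by (simp only:)
    also have "\<dots> < 2 * \<delta>"
      using T(3)[of a] T(3)[of c] ac s by (simp add: dist_real_def)
    finally have "\<kappa> / K * \<epsilon> < 2 * \<delta>" .
    moreover have "\<kappa> / K * \<epsilon> = 4 * \<delta>" by (simp add: \<delta>_def)
    ultimately have "4 * \<delta> < 2 * \<delta>" by (simp only:)
    with \<delta> show False by simp
  qed
  then show "\<forall>\<^sub>F t in at_top. N t < b" unfolding eventually_at_top_linorder by blast
qed

section \<open>The blown-up system\<close>

text \<open>The blown-up equations of \<open>y' = v\<close>, \<open>v' = - D y + \<dots>\<close> for \<open>r = \<parallel>y\<parallel>\<close>, \<open>q = y/r\<close>,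
  \<open>w = v/r\<^sup>\<beta>\<close>, \<open>\<rho> = r\<^sup>\<beta>\<^sup>-\<^sup>1\<close>, where \<open>D\<close> is the gradient of \<open>P\<close>, homogeneous of degree
  \<open>2\<beta>\<close>.\<close>

lemma blow_up_limit:
  fixes r \<rho> :: "real \<Rightarrow> real" and q w e :: "real \<Rightarrow> 'a::euclidean_space"
    and P :: "'a \<Rightarrow> real" and D :: "'a \<Rightarrow> 'a" and D' :: "'a \<Rightarrow> 'a \<Rightarrow> 'a"
  assumes r': "\<And>t. t \<ge> t0 \<Longrightarrow> (r has_real_derivative \<rho> t * r t * (w t \<bullet> q t)) (at t)"
    and q': "\<And>t. t \<ge> t0 \<Longrightarrow> (q has_vector_derivative \<rho> t *\<^sub>R (w t - (w t \<bullet> q t) *\<^sub>R q t)) (at t)"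
    and w': "\<And>t. t \<ge> t0 \<Longrightarrow>
      (w has_vector_derivative \<rho> t *\<^sub>R (e t - D (q t) - (\<beta> * (w t \<bullet> q t)) *\<^sub>R w t)) (at t)"
    and err: "\<And>t. t \<ge> t0 \<Longrightarrow> norm (e t) \<le> C * r t"
    and energy: "\<And>t. t \<ge> t0 \<Longrightarrow> \<bar>(w t \<bullet> w t) / 2 + P (q t)\<bar> \<le> C * r t"
    and q1: "\<And>t. t \<ge> t0 \<Longrightarrow> norm (q t) = 1"
    and pos: "\<And>t. t \<ge> t0 \<Longrightarrow> r t > 0" "\<And>t. t \<ge> t0 \<Longrightarrow> \<rho> t > 0"
    and r0: "(r \<longlongrightarrow> 0) at_top"
    and PB: "\<And>y. norm y = 1 \<Longrightarrow> \<bar>P y\<bar> \<le> B"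
    and DB: "\<And>y. norm y = 1 \<Longrightarrow> norm (D y) \<le> B"
    and euler: "\<And>y. norm y = 1 \<Longrightarrow> D y \<bullet> y = 2 * \<beta> * P y"
    and D': "\<And>y. norm y = 1 \<Longrightarrow> (D has_derivative D' y) (at y)"
    and D'B: "\<And>y h. norm y = 1 \<Longrightarrow> norm (D' y h) \<le> B * norm h"
    and \<beta>: "\<beta> \<ge> 0" and C: "C > 0"
  shows "\<exists>L\<le>0. ((\<lambda>t. P (q t)) \<longlongrightarrow> L) at_top \<and>
    ((\<lambda>t. D (q t) - (D (q t) \<bullet> q t) *\<^sub>R q t) \<longlongrightarrow> 0) at_top"
proof -
  have "\<forall>\<^sub>F t in at_top. r t < 1" using r0 by (rule order_tendstoD) simp
  then obtain T where T: "\<And>t. t \<ge> T \<Longrightarrow> r t < 1" unfolding eventually_at_top_linorder by blast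
  define t1 where "t1 = max T t0"
  have t1: "t \<ge> t0" "r t \<le> 1" if "t \<ge> t1" for t using that T[of t] by (auto simp: t1_def)
  have B: "B \<ge> 0" using PB[OF q1[of t0]] by auto
  \<comment> \<open>Taking \<open>K \<ge> 1\<close> turns the bound \<open>K\<close> on the squared
    norm of \<open>w\<close> into the bound \<open>K * K\<close>, hence into the bound
    \<open>K\<close> on the norm.\<close>
  define K where "K = 1 + 2 * (C + B)"
  have K: "K \<ge> 1" using B C by (simp add: K_def)
  have Cr: "C * r t \<le> C" if "t \<ge> t1" for t using t1[OF that] C by simp
  have wK: "norm (w t) \<le> K" if t: "t \<ge> t1" for t
  proof -
    have "w t \<bullet> w t \<le> 2 * (C + B)"
      using energy[OF t1(1)[OF t]] PB[OF q1[OF t1(1)[OF t]]] Cr[OF t] by (simp add: abs_le_iff)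
    also have "\<dots> \<le> K" by (simp add: K_def)
    also have "K \<le> K * K" using K mult_left_mono[of 1 K K] by simp
    finally have "(norm (w t))\<^sup>2 \<le> K\<^sup>2"
      unfolding power2_norm_eq_inner by (simp only: power2_eq_square)
    then show ?thesis by (rule power2_le_imp_le) (use K in simp)
  qed
  define \<xi> where "\<xi> t = w t \<bullet> q t" for t
  \<comment> \<open>The squared norm of the part of \<open>w\<close> tangent to the sphere.\<close>
  define N where "N t = w t \<bullet> w t - \<xi> t * \<xi> t" for t
  define \<eta> where "\<eta> t = w t - \<xi> t *\<^sub>R q t" for t
  have qq: "q t \<bullet> q t = 1" if "t \<ge> t1" for t using q1[OF t1(1)[OF that]] by (simp add: norm_eq_1)
  have N\<eta>: "N t = \<eta> t \<bullet> \<eta> t" if "t \<ge> t1" for t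
    using qq[OF that] by (simp add: N_def \<eta>_def inner_diff_left inner_diff_right \<xi>_def inner_commute)
  have \<xi>K: "\<bar>\<xi> t\<bar> \<le> K" if t: "t \<ge> t1" for t
    using Cauchy_Schwarz_ineq2[of "w t" "q t"] q1[OF t1(1)[OF t]] wK[OF t] by (simp add: \<xi>_def)
  define X where "X t = (e t - D (q t) - (\<beta> * \<xi> t) *\<^sub>R w t) \<bullet> q t + N t" for t
  have \<xi>': "(\<xi> has_real_derivative \<rho> t * X t) (at t)" if t: "t \<ge> t1" for t
  proof -
    have "(\<xi> has_vector_derivative w t \<bullet> (\<rho> t *\<^sub>R (w t - (w t \<bullet> q t) *\<^sub>R q t))
       + (\<rho> t *\<^sub>R (e t - D (q t) - (\<beta> * (w t \<bullet> q t)) *\<^sub>R w t)) \<bullet> q t) (at t)"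
      unfolding \<xi>_def
      by (intro bounded_bilinear.has_vector_derivative[OF bounded_bilinear_inner] w' q' t1(1)[OF t])
    moreover have "w t \<bullet> (\<rho> t *\<^sub>R (w t - (w t \<bullet> q t) *\<^sub>R q t))
       + (\<rho> t *\<^sub>R (e t - D (q t) - (\<beta> * (w t \<bullet> q t)) *\<^sub>R w t)) \<bullet> q t = \<rho> t * X t"
      by (simp add: X_def N_def \<xi>_def inner_diff_right algebra_simps)
    ultimately show ?thesis by (simp add: has_real_derivative_iff_has_vector_derivative)
  qed
  \<comment> \<open>Euler's identity turns \<open>- (D (q t) \<bullet> q t)\<close> into
    \<open>- 2 * \<beta> * P (q t)\<close>, which the energy bounds below by
    \<open>\<beta> * (w t \<bullet> w t) - 2 * \<beta> * C * r t\<close>. Together with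
    \<open>- \<beta> * \<xi> t * \<xi> t\<close> this is \<open>\<beta> * N t\<close> up to the
    error.\<close>
  have X: "X t \<ge> (1 + \<beta>) * N t - (1 + 2 * \<beta>) * C * r t" if t: "t \<ge> t1" for t
  proof -
    have "\<bar>e t \<bullet> q t\<bar> \<le> C * r t"
      using Cauchy_Schwarz_ineq2[of "e t" "q t"] q1[OF t1(1)[OF t]] err[OF t1(1)[OF t]] by simp
    moreover have "D (q t) \<bullet> q t = 2 * \<beta> * P (q t)" using euler q1 t1(1)[OF t] by blast
    moreover have "2 * \<beta> * P (q t) \<le> 2 * \<beta> * (C * r t - (w t \<bullet> w t) / 2)"
      using energy[OF t1(1)[OF t]] \<beta> by (intro mult_left_mono) (auto simp: abs_le_iff)
    ultimately show ?thesis
      by (simp add: X_def N_def \<xi>_def inner_diff_left algebra_simps abs_le_iff)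
  qed
  have N0: "N t \<ge> 0" if "t \<ge> t1" for t using N\<eta>[OF that] by simp
  have "\<exists>L\<le>0. (\<xi> \<longlongrightarrow> L) at_top"
  proof (rule almost_monotone_convergent[of t1 r \<rho> \<xi> X "(1 + 2 * \<beta>) * C" K])
    show "(r has_real_derivative \<rho> t * r t * \<xi> t) (at t)" if "t \<ge> t1" for t
      using r'[OF t1(1)[OF that]] by (simp add: \<xi>_def)
    show "X t \<ge> - ((1 + 2 * \<beta>) * C) * r t" if "t \<ge> t1" for t
    proof -
      have "(1 + \<beta>) * N t \<ge> 0" using N0[OF that] \<beta> by simp
      then show ?thesis using X[OF that] by simp
    qed
  qed (use \<xi>' \<xi>K pos t1 \<beta> C r0 in auto)
  then obtain L where L: "L \<le> 0" "(\<xi> \<longlongrightarrow> L) at_top" by blast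
  define Y where "Y = C + B + \<beta> * K * K"
  have Y: "Y \<ge> 0" using B C \<beta> K by (simp add: Y_def)
  have accel: "norm (e t - D (q t) - (\<beta> * \<xi> t) *\<^sub>R w t) \<le> Y" if t: "t \<ge> t1" for t
  proof -
    have "norm (e t) \<le> C" using err[OF t1(1)[OF t]] Cr[OF t] by simp
    moreover have "norm (D (q t)) \<le> B" using DB q1 t1(1)[OF t] by blast
    moreover have "norm ((\<beta> * \<xi> t) *\<^sub>R w t) \<le> \<beta> * K * K"
      using \<xi>K[OF t] wK[OF t] \<beta> by (simp add: abs_mult mult_mono)
    moreover have "norm (e t - D (q t) - (\<beta> * \<xi> t) *\<^sub>R w t)
        \<le> norm (e t) + norm (D (q t)) + norm ((\<beta> * \<xi> t) *\<^sub>R w t)"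
      by (meson norm_triangle_ineq4 order_trans add_right_mono)
    ultimately show ?thesis by (simp add: Y_def)
  qed
  have NK: "N t \<le> K * K" if t: "t \<ge> t1" for t
  proof -
    have "w t \<bullet> w t \<le> K * K"
      using mult_mono[OF wK[OF t] wK[OF t]] K by (simp add: dot_square_norm power2_eq_square)
    then show ?thesis using zero_le_square[of "\<xi> t"] unfolding N_def by linarith
  qed
  define N' where "N' t = 2 * (w t \<bullet> (e t - D (q t) - (\<beta> * \<xi> t) *\<^sub>R w t)) - 2 * (\<xi> t * X t)" for t
  have N': "(N has_real_derivative \<rho> t * N' t) (at t)" if t: "t \<ge> t1" for t
  proof -
    let ?a = "\<rho> t *\<^sub>R (e t - D (q t) - (\<beta> * (w t \<bullet> q t)) *\<^sub>R w t)"
    have "((\<lambda>t. w t \<bullet> w t) has_vector_derivative w t \<bullet> ?a + ?a \<bullet> w t) (at t)"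
      by (intro bounded_bilinear.has_vector_derivative[OF bounded_bilinear_inner] w' t1(1)[OF t])
    then have "((\<lambda>t. w t \<bullet> w t) has_real_derivative w t \<bullet> ?a + ?a \<bullet> w t) (at t)"
      by (simp add: has_real_derivative_iff_has_vector_derivative)
    from DERIV_diff[OF this DERIV_mult[OF \<xi>'[OF t] \<xi>'[OF t]]]
    have "(N has_real_derivative (w t \<bullet> ?a + ?a \<bullet> w t) - (\<rho> t * X t * \<xi> t + \<rho> t * X t * \<xi> t)) (at t)"
      by (simp add: N_def[abs_def])
    moreover have "(w t \<bullet> ?a + ?a \<bullet> w t) - (\<rho> t * X t * \<xi> t + \<rho> t * X t * \<xi> t) = \<rho> t * N' t"
      unfolding N'_def \<xi>_def[symmetric] by (simp add: inner_commute algebra_simps)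
    ultimately show ?thesis by simp
  qed
  \<comment> \<open>One constant for both dissipation arguments: relative to the clock it bounds
    \<xi> and the rates of \<open>N\<close> and of the squared norm of the tangential gradient; the
    last of these accounts for \<open>16 * B * B * K\<close>.\<close>
  define K1 where "K1 = 2 * K * Y + 2 * K * (Y + K * K) + K + 16 * B * B * K"
  have K1: "K1 \<ge> K" "K1 > 0" "K1 \<ge> 2 * K * Y + 2 * K * (Y + K * K)" "K1 \<ge> 16 * B * B * K"
  proof -
    have "2 * K * Y \<ge> 0" "2 * K * (Y + K * K) \<ge> 0" "16 * B * B * K \<ge> 0" using K Y B by auto
    then show "K1 \<ge> K" "K1 > 0" "K1 \<ge> 2 * K * Y + 2 * K * (Y + K * K)" "K1 \<ge> 16 * B * B * K"
      using K unfolding K1_def by linarith+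
  qed
  have N'K: "N' t \<le> K1" if t: "t \<ge> t1" for t
  proof -
    have "\<bar>w t \<bullet> (e t - D (q t) - (\<beta> * \<xi> t) *\<^sub>R w t)\<bar> \<le> K * Y"
      by (rule order_trans[OF Cauchy_Schwarz_ineq2 mult_mono[OF wK[OF t] accel[OF t]]]) (use K in auto)
    moreover have "\<bar>X t\<bar> \<le> Y + K * K"
    proof -
      have "\<bar>(e t - D (q t) - (\<beta> * \<xi> t) *\<^sub>R w t) \<bullet> q t\<bar> \<le> Y"
        using Cauchy_Schwarz_ineq2[of "e t - D (q t) - (\<beta> * \<xi> t) *\<^sub>R w t" "q t"] accel[OF t]
          q1[OF t1(1)[OF t]] by simp
      then show ?thesis using NK[OF t] N0[OF t] by (simp add: X_def abs_le_iff)
    qed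
    then have "\<bar>\<xi> t * X t\<bar> \<le> K * (Y + K * K)"
      unfolding abs_mult using \<xi>K[OF t] K by (intro mult_mono) auto
    ultimately have "N' t \<le> 2 * K * Y + 2 * K * (Y + K * K)" by (simp add: N'_def abs_le_iff)
    then show ?thesis using K1 by simp
  qed
  have r'\<xi>: "(r has_real_derivative \<rho> t * r t * \<xi> t) (at t)" if "t \<ge> t1" for t
    using r'[OF t1(1)[OF that]] by (simp add: \<xi>_def)
  have \<xi>K1: "\<bar>\<xi> t\<bar> \<le> K1" if "t \<ge> t1" for t using \<xi>K[OF that] K1 by simp
  have Nlim: "(N \<longlongrightarrow> 0) at_top"
  \<comment> \<open>The convergent function is \<open>\<xi>\<close> itself: while
    \<open>N \<ge> \<epsilon>\<close>, its rate \<open>X\<close> is at least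
    \<open>\<epsilon> / 2\<close> as soon as the error is below
    \<open>\<epsilon> / 2\<close>.\<close>
  proof (rule tendsto_0_if_dissipated[of t1 r \<rho> \<xi> \<xi> X N N' K1 L, OF r'\<xi> \<xi>' N' \<xi>K1 N'K K1(2) _ _ N0 r0 L(2)])
    fix \<epsilon> :: real assume \<epsilon>: "\<epsilon> > 0"
    have "((\<lambda>t. (1 + 2 * \<beta>) * C * r t) \<longlongrightarrow> (1 + 2 * \<beta>) * C * 0) at_top"
      by (intro tendsto_intros r0)
    then have "\<forall>\<^sub>F t in at_top. (1 + 2 * \<beta>) * C * r t < \<epsilon> / 2"
      by (rule order_tendstoD) (use \<epsilon> in simp)
    moreover have "\<forall>\<^sub>F t in at_top. t \<ge> t1" by (rule eventually_ge_at_top)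
    ultimately have "\<forall>\<^sub>F t in at_top. N t \<ge> \<epsilon> \<longrightarrow> X t \<ge> \<epsilon> / 2"
    proof eventually_elim
      case (elim t)
      have "(1 + \<beta>) * N t \<ge> N t" using N0[OF elim(2)] \<beta> by (simp add: distrib_right)
      then show ?case using X[OF elim(2)] elim(1) by auto
    qed
    then show "\<exists>\<kappa>>0. \<forall>\<^sub>F t in at_top. N t \<ge> \<epsilon> \<longrightarrow> X t \<ge> \<kappa>" using \<epsilon> by (intro exI[of _ "\<epsilon> / 2"]) simp
  qed (use pos t1 in auto)
  \<comment> \<open>The part of \<open>D\<close> tangent to the sphere; when \<open>D\<close> is the
    gradient of \<open>P\<close>, this is the gradient of the restriction of
    \<open>P\<close>.\<close>
  define H where "H t = D (q t) - (D (q t) \<bullet> q t) *\<^sub>R q t" for t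
  define d where "d t = D' (q t) (\<eta> t)" for t
  define H' where "H' t = d t - ((D (q t) \<bullet> \<eta> t + d t \<bullet> q t) *\<^sub>R q t + (D (q t) \<bullet> q t) *\<^sub>R \<eta> t)" for t
  have q\<eta>: "(q has_vector_derivative \<rho> t *\<^sub>R \<eta> t) (at t)" if "t \<ge> t1" for t
    using q'[OF t1(1)[OF that]] by (simp add: \<eta>_def \<xi>_def)
  have H': "(H has_vector_derivative \<rho> t *\<^sub>R H' t) (at t)" if t: "t \<ge> t1" for t
  proof -
    have "((D \<circ> q) has_vector_derivative D' (q t) (\<rho> t *\<^sub>R \<eta> t)) (at t)"
      by (rule vector_derivative_diff_chain_within[OF q\<eta>[OF t]])
        (use D'[OF q1[OF t1(1)[OF t]]] in \<open>rule has_derivative_at_withinI\<close>)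
    moreover have lin: "linear (D' (q t))"
      using D'[OF q1[OF t1(1)[OF t]]] by (rule has_derivative_linear)
    ultimately have Dq: "((\<lambda>t. D (q t)) has_vector_derivative \<rho> t *\<^sub>R d t) (at t)"
      by (simp add: d_def linear_scale comp_def)
    have "((\<lambda>t. D (q t) \<bullet> q t) has_vector_derivative D (q t) \<bullet> (\<rho> t *\<^sub>R \<eta> t) + (\<rho> t *\<^sub>R d t) \<bullet> q t) (at t)"
      by (intro bounded_bilinear.has_vector_derivative[OF bounded_bilinear_inner] Dq q\<eta>[OF t])
    then have "((\<lambda>t. D (q t) \<bullet> q t) has_real_derivative D (q t) \<bullet> (\<rho> t *\<^sub>R \<eta> t) + (\<rho> t *\<^sub>R d t) \<bullet> q t) (at t)"
      by (simp add: has_real_derivative_iff_has_vector_derivative)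
    from has_vector_derivative_diff[OF Dq has_vector_derivative_scaleR[OF this q\<eta>[OF t]]]
    show ?thesis
      unfolding H_def[abs_def] H'_def by (simp add: algebra_simps)
  qed
  have Hq: "H t \<bullet> q t = 0" if "t \<ge> t1" for t
    using qq[OF that] by (simp add: H_def inner_diff_left)
  have DqB: "norm (D (q t)) \<le> B" "\<bar>D (q t) \<bullet> q t\<bar> \<le> B" if t: "t \<ge> t1" for t
    using DB[OF q1[OF t1(1)[OF t]]] Cauchy_Schwarz_ineq2[of "D (q t)" "q t"] q1[OF t1(1)[OF t]] by auto
  have HB: "norm (H t) \<le> 2 * B" if t: "t \<ge> t1" for t
  proof -
    have "norm (H t) \<le> norm (D (q t)) + norm ((D (q t) \<bullet> q t) *\<^sub>R q t)"
      unfolding H_def by (rule norm_triangle_ineq4)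
    then show ?thesis using DqB[OF t] q1[OF t1(1)[OF t]] by simp
  qed
  have H'B: "norm (H' t) \<le> 4 * B * norm (\<eta> t)" if t: "t \<ge> t1" for t
  proof -
    have d: "norm (d t) \<le> B * norm (\<eta> t)" unfolding d_def by (rule D'B[OF q1[OF t1(1)[OF t]]])
    have "\<bar>D (q t) \<bullet> \<eta> t\<bar> \<le> B * norm (\<eta> t)"
      by (rule order_trans[OF Cauchy_Schwarz_ineq2 mult_right_mono[OF DqB(1)[OF t]]]) simp
    moreover have "\<bar>d t \<bullet> q t\<bar> \<le> B * norm (\<eta> t)"
      using Cauchy_Schwarz_ineq2[of "d t" "q t"] d q1[OF t1(1)[OF t]] by simp
    ultimately have "norm ((D (q t) \<bullet> \<eta> t + d t \<bullet> q t) *\<^sub>R q t) \<le> 2 * B * norm (\<eta> t)"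
      using q1[OF t1(1)[OF t]] by (simp add: abs_le_iff)
    moreover have "norm ((D (q t) \<bullet> q t) *\<^sub>R \<eta> t) \<le> B * norm (\<eta> t)"
      using DqB(2)[OF t] by (simp add: mult_right_mono)
    moreover have "norm (H' t) \<le> norm (d t) + (norm ((D (q t) \<bullet> \<eta> t + d t \<bullet> q t) *\<^sub>R q t) + norm ((D (q t) \<bullet> q t) *\<^sub>R \<eta> t))"
      unfolding H'_def by (meson norm_triangle_ineq norm_triangle_ineq4 order_trans add_left_mono)
    ultimately show ?thesis using d by simp
  qed
  have \<eta>lim: "((\<lambda>t. norm (\<eta> t)) \<longlongrightarrow> 0) at_top"
  proof -
    have "((\<lambda>t. sqrt (N t)) \<longlongrightarrow> sqrt 0) at_top" by (intro tendsto_intros Nlim)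
    moreover have "\<forall>\<^sub>F t in at_top. sqrt (N t) = norm (\<eta> t)"
      using eventually_ge_at_top[of t1] by eventually_elim (simp add: N\<eta> norm_eq_sqrt_inner)
    ultimately show ?thesis by (simp add: tendsto_cong)
  qed
  have \<eta>K: "norm (\<eta> t) \<le> K" if t: "t \<ge> t1" for t
  proof -
    have "(norm (\<eta> t))\<^sup>2 \<le> K\<^sup>2"
      using NK[OF t] unfolding N\<eta>[OF t] power2_norm_eq_inner by (simp only: power2_eq_square)
    then show ?thesis by (rule power2_le_imp_le) (use K in simp)
  qed
  \<comment> \<open>The sign makes \<open>F\<close> grow: the force \<open>- D\<close> pairs with
    \<open>H\<close> to minus the squared norm of \<open>H\<close>, and the other terms of its rate
    are controlled by \<open>r\<close> and the norm of \<open>\<eta>\<close>. As \<open>H\<close> is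
    orthogonal to \<open>q\<close>, \<open>F\<close> sees only the tangential part of
    \<open>w\<close> and tends to 0.\<close>
  define F where "F t = - (w t \<bullet> H t)" for t
  define F' where "F' t = - (w t \<bullet> H' t + (e t - D (q t) - (\<beta> * \<xi> t) *\<^sub>R w t) \<bullet> H t)" for t
  have F': "(F has_real_derivative \<rho> t * F' t) (at t)" if t: "t \<ge> t1" for t
  proof -
    have "((\<lambda>t. w t \<bullet> H t) has_vector_derivative w t \<bullet> (\<rho> t *\<^sub>R H' t)
        + (\<rho> t *\<^sub>R (e t - D (q t) - (\<beta> * (w t \<bullet> q t)) *\<^sub>R w t)) \<bullet> H t) (at t)"
      by (intro bounded_bilinear.has_vector_derivative[OF bounded_bilinear_inner] H' t w' t1(1)[OF t])
    from has_vector_derivative_minus[OF this] show ?thesis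
      unfolding F_def[abs_def] F'_def has_real_derivative_iff_has_vector_derivative \<xi>_def
      by (simp add: algebra_simps)
  qed
  have wH: "w t \<bullet> H t = \<eta> t \<bullet> H t" if "t \<ge> t1" for t
    using Hq[OF that] by (simp add: \<eta>_def inner_diff_left inner_commute[of "q t"])
  have wHB: "\<bar>w t \<bullet> H t\<bar> \<le> norm (\<eta> t) * (2 * B)" if t: "t \<ge> t1" for t
    unfolding wH[OF t] by (rule order_trans[OF Cauchy_Schwarz_ineq2 mult_left_mono[OF HB[OF t]]]) simp
  have Flim: "(F \<longlongrightarrow> 0) at_top"
  proof (rule Lim_null_comparison)
    show "\<forall>\<^sub>F t in at_top. norm (F t) \<le> norm (\<eta> t) * (2 * B)"
      using eventually_ge_at_top[of t1] by eventually_elim (use wHB in \<open>simp add: F_def\<close>)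
    show "((\<lambda>t. norm (\<eta> t) * (2 * B)) \<longlongrightarrow> 0) at_top"
      using tendsto_mult_right[OF \<eta>lim, of "2 * B"] by simp
  qed
  define M where "M t = H t \<bullet> H t" for t
  have M': "(M has_real_derivative \<rho> t * (2 * (H t \<bullet> H' t))) (at t)" if t: "t \<ge> t1" for t
  proof -
    have "(M has_vector_derivative H t \<bullet> (\<rho> t *\<^sub>R H' t) + (\<rho> t *\<^sub>R H' t) \<bullet> H t) (at t)"
      unfolding M_def[abs_def]
      by (intro bounded_bilinear.has_vector_derivative[OF bounded_bilinear_inner] H' t)
    then show ?thesis
      by (simp add: has_real_derivative_iff_has_vector_derivative inner_commute algebra_simps)
  qed
  have M'K: "2 * (H t \<bullet> H' t) \<le> K1" if t: "t \<ge> t1" for t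
  proof -
    have "norm (H' t) \<le> 4 * B * K"
      using H'B[OF t] mult_left_mono[OF \<eta>K[OF t], of "4 * B"] B by simp
    then have "\<bar>H t \<bullet> H' t\<bar> \<le> 2 * B * (4 * B * K)"
      by (intro order_trans[OF Cauchy_Schwarz_ineq2] mult_mono HB t) (use B K in auto)
    then show ?thesis using K1(4) by (simp add: abs_le_iff)
  qed
  define A where "A = 4 * B * K + 2 * B * \<beta> * K"
  have F'M: "F' t \<ge> M t - (2 * B * C * r t + A * norm (\<eta> t))" if t: "t \<ge> t1" for t
  proof -
    have "\<bar>w t \<bullet> H' t\<bar> \<le> K * (4 * B * norm (\<eta> t))"
      by (rule order_trans[OF Cauchy_Schwarz_ineq2 mult_mono[OF wK[OF t] H'B[OF t]]]) (use K in auto)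
    moreover have "\<bar>e t \<bullet> H t\<bar> \<le> C * r t * (2 * B)"
      by (rule order_trans[OF Cauchy_Schwarz_ineq2 mult_mono[OF err[OF t1(1)[OF t]] HB[OF t]]])
        (use C pos(1)[OF t1(1)[OF t]] in auto)
    moreover have "D (q t) \<bullet> H t = M t"
    proof -
      have "D (q t) = H t + (D (q t) \<bullet> q t) *\<^sub>R q t" by (simp add: H_def)
      then have "D (q t) \<bullet> H t = H t \<bullet> H t + (D (q t) \<bullet> q t) * (q t \<bullet> H t)"
        by (metis inner_add_left inner_scaleR_left)
      then show ?thesis using Hq[OF t] by (simp add: M_def inner_commute)
    qed
    moreover have "\<bar>\<beta> * \<xi> t * (w t \<bullet> H t)\<bar> \<le> \<beta> * K * (norm (\<eta> t) * (2 * B))"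
      unfolding abs_mult using \<beta> \<xi>K[OF t] wHB[OF t] B K
      by (intro mult_mono) auto
    ultimately show ?thesis
      by (simp add: F'_def A_def inner_diff_left abs_le_iff algebra_simps)
  qed
  have Mlim: "(M \<longlongrightarrow> 0) at_top"
  proof (rule tendsto_0_if_dissipated[of t1 r \<rho> \<xi> F F' M "\<lambda>t. 2 * (H t \<bullet> H' t)" K1 0, OF r'\<xi> F' M' \<xi>K1 M'K K1(2) _ _ _ r0 Flim])
    fix \<epsilon> :: real assume \<epsilon>: "\<epsilon> > 0"
    have "((\<lambda>t. 2 * B * C * r t + A * norm (\<eta> t)) \<longlongrightarrow> 2 * B * C * 0 + A * 0) at_top"
      by (intro tendsto_intros r0 \<eta>lim)
    then have "\<forall>\<^sub>F t in at_top. 2 * B * C * r t + A * norm (\<eta> t) < \<epsilon> / 2"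
      by (rule order_tendstoD) (use \<epsilon> in simp)
    moreover have "\<forall>\<^sub>F t in at_top. t \<ge> t1" by (rule eventually_ge_at_top)
    ultimately have "\<forall>\<^sub>F t in at_top. M t \<ge> \<epsilon> \<longrightarrow> F' t \<ge> \<epsilon> / 2"
    proof eventually_elim
      case (elim t)
      then show ?case using F'M[OF elim(2)] by auto
    qed
    then show "\<exists>\<kappa>>0. \<forall>\<^sub>F t in at_top. M t \<ge> \<epsilon> \<longrightarrow> F' t \<ge> \<kappa>" using \<epsilon> by (intro exI[of _ "\<epsilon> / 2"]) simp
  qed (use pos t1 in \<open>auto simp: M_def\<close>)
  have "(H \<longlongrightarrow> 0) at_top"
  proof (rule tendsto_norm_zero_cancel)
    have "((\<lambda>t. sqrt (M t)) \<longlongrightarrow> sqrt 0) at_top" by (intro tendsto_intros Mlim)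
    then show "((\<lambda>t. norm (H t)) \<longlongrightarrow> 0) at_top" by (simp add: M_def norm_eq_sqrt_inner)
  qed
  \<comment> \<open>The energy relation makes \<open>P (q t)\<close> equal to
    \<open>- (N t + \<xi> t * \<xi> t) / 2\<close> up to \<open>C * r t\<close>. Here
    \<open>L\<close> is the limit of \<open>\<xi>\<close>, and the limit claimed by the lemma is
    \<open>- (L * L) / 2\<close>.\<close>
  moreover have "((\<lambda>t. P (q t)) \<longlongrightarrow> - (L * L) / 2) at_top"
  proof (rule Lim_transform2)
    show "((\<lambda>t. - (N t + \<xi> t * \<xi> t) / 2) \<longlongrightarrow> - (L * L) / 2) at_top"
      using tendsto_divide[OF tendsto_minus[OF tendsto_add[OF Nlim tendsto_mult[OF L(2) L(2)]]] tendsto_const, of 2]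
      by simp
    show "((\<lambda>t. - (N t + \<xi> t * \<xi> t) / 2 - P (q t)) \<longlongrightarrow> 0) at_top"
    proof (rule Lim_null_comparison)
      show "\<forall>\<^sub>F t in at_top. norm (- (N t + \<xi> t * \<xi> t) / 2 - P (q t)) \<le> C * r t"
        using eventually_ge_at_top[of t1]
      proof eventually_elim
        case (elim t)
        have "- (N t + \<xi> t * \<xi> t) / 2 - P (q t) = - ((w t \<bullet> w t) / 2 + P (q t))" by (simp add: N_def)
        then show ?case using energy[OF t1(1)[OF elim]] by (simp only: real_norm_def abs_minus_cancel)
      qed
      show "((\<lambda>t. C * r t) \<longlongrightarrow> 0) at_top" using tendsto_mult_left[OF r0, of C] by simp
    qed
  qed
  moreover have "- (L * L) / 2 \<le> 0" by simp
  ultimately show ?thesis unfolding H_def by blast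
qed

section \<open>Gradients of homogeneous polynomials and the change to blown-up variables\<close>

lemma real_polynomial_function_gradient:
  fixes f :: "real^'n::finite \<Rightarrow> real"
  assumes "real_polynomial_function f"
  shows "\<exists>D :: real^'n \<Rightarrow> real^'n. (\<forall>i. real_polynomial_function (\<lambda>y. D y $ i)) \<and>
    (\<forall>y. (f has_derivative (\<lambda>h. D y \<bullet> h)) (at y))"
  using assms
proof (induction rule: real_polynomial_function.induct)
  case (linear f)
  have "(f has_derivative (\<lambda>h. (\<chi> i. f (axis i 1)) \<bullet> h)) (at y)" for y
  proof -
    have "f h = (\<chi> i. f (axis i 1)) \<bullet> h" for h
    proof -
      have "f h = f (\<Sum>i\<in>UNIV. h $ i *\<^sub>R axis i 1)"
        using basis_expansion[of h] by (simp add: scalar_mult_eq_scaleR)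
      also have "\<dots> = (\<Sum>i\<in>UNIV. h $ i * f (axis i 1))"
        using bounded_linear.linear[OF linear] by (simp add: linear_sum linear_scale)
      finally show ?thesis by (simp add: inner_vec_def mult.commute)
    qed
    then have "f = (\<lambda>h. (\<chi> i. f (axis i 1)) \<bullet> h)" by blast
    then show ?thesis using bounded_linear_imp_has_derivative[OF linear] by metis
  qed
  then show ?case
    by (intro exI[of _ "\<lambda>_. \<chi> i. f (axis i 1)"]) (simp add: real_polynomial_function.intros(2))
next
  case (const c)
  show ?case by (intro exI[of _ "\<lambda>_. 0"]) (simp add: real_polynomial_function.intros(2))
next
  case (add f g)
  then obtain D E where
    D: "\<And>i. real_polynomial_function (\<lambda>y. D y $ i)" "\<And>y. (f has_derivative (\<lambda>h. D y \<bullet> h)) (at y)"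
    and E: "\<And>i. real_polynomial_function (\<lambda>y. E y $ i)" "\<And>y. (g has_derivative (\<lambda>h. E y \<bullet> h)) (at y)"
    by metis
  have "((\<lambda>y. f y + g y) has_derivative (\<lambda>h. (D y + E y) \<bullet> h)) (at y)" for y
    using has_derivative_add[OF D(2) E(2)] by (simp add: inner_add_left)
  with D(1) E(1) show ?case
    by (intro exI[of _ "\<lambda>y. D y + E y"]) (simp add: real_polynomial_function.intros(3))
next
  case (mult f g)
  then obtain D E where
    D: "\<And>i. real_polynomial_function (\<lambda>y. D y $ i)" "\<And>y. (f has_derivative (\<lambda>h. D y \<bullet> h)) (at y)"
    and E: "\<And>i. real_polynomial_function (\<lambda>y. E y $ i)" "\<And>y. (g has_derivative (\<lambda>h. E y \<bullet> h)) (at y)"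
    by metis
  have "((\<lambda>y. f y * g y) has_derivative (\<lambda>h. (f y *\<^sub>R E y + g y *\<^sub>R D y) \<bullet> h)) (at y)" for y
    using has_derivative_mult[OF D(2) E(2)] by (simp add: inner_add_left algebra_simps)
  moreover have "real_polynomial_function (\<lambda>y. (f y *\<^sub>R E y + g y *\<^sub>R D y) $ i)" for i
    using mult D(1) E(1) by (simp add: real_polynomial_function.intros(3,4))
  ultimately show ?case by (intro exI[of _ "\<lambda>y. f y *\<^sub>R E y + g y *\<^sub>R D y"]) simp
qed

text \<open>The rows of the derivative are gradients of polynomials; they are continuous, hence
  bounded on a compact set.\<close>

lemma polynomial_field_derivative_bounded:
  fixes D :: "real^'n::finite \<Rightarrow> real^'n"
  assumes "\<And>i. real_polynomial_function (\<lambda>y. D y $ i)" and S: "compact S"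
  shows "\<exists>D' B. (\<forall>y. (D has_derivative D' y) (at y)) \<and> (\<forall>y\<in>S. \<forall>h. norm (D' y h) \<le> B * norm h)"
proof -
  obtain G where G: "\<And>i j. real_polynomial_function (\<lambda>y. G i y $ j)"
    "\<And>i y. ((\<lambda>y. D y $ i) has_derivative (\<lambda>h. G i y \<bullet> (h::real^'n))) (at y)"
    using real_polynomial_function_gradient[OF assms(1)] by metis
  have bd: "\<exists>B. \<forall>y\<in>S. norm (G i y) \<le> B" for i
  proof -
    have "continuous_on S (\<lambda>y. \<chi> j. G i y $ j)"
      by (intro continuous_on_vec_lambda continuous_on_polymonial_function real_polynomial_function_eq[THEN iffD1] G)
    then have "bounded (G i ` S)"
      using compact_continuous_image[OF _ S] compact_imp_bounded by auto
    then show ?thesis by (auto simp: bounded_iff)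
  qed
  then obtain b where b: "\<And>i y. y \<in> S \<Longrightarrow> norm (G i y) \<le> b i" by metis
  show ?thesis
  proof (intro exI conjI allI ballI)
    show "(D has_derivative (\<lambda>h. \<chi> i. G i y \<bullet> h)) (at y)" for y
    proof -
      have "((\<lambda>y. D y \<bullet> b) has_derivative (\<lambda>h. (\<chi> i. G i y \<bullet> h) \<bullet> b)) (at y)" if "b \<in> Basis" for b
        using that G(2) by (auto simp: Basis_vec_def inner_axis)
      then show ?thesis by (subst has_derivative_componentwise_within) blast
    qed
    fix y h assume y: "y \<in> S"
    have "norm (\<chi> i. G i y \<bullet> h) \<le> (\<Sum>i\<in>UNIV. \<bar>G i y \<bullet> h\<bar>)"
      using norm_le_l1_cart[of "\<chi> i. G i y \<bullet> h"] by simp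
    also have "\<dots> \<le> (\<Sum>i\<in>UNIV. b i * norm h)"
      by (intro sum_mono order_trans[OF Cauchy_Schwarz_ineq2] mult_right_mono b y) simp
    finally show "norm (\<chi> i. G i y \<bullet> h) \<le> (\<Sum>i\<in>UNIV. b i) * norm h"
      by (simp add: sum_distrib_right)
  qed
qed

text \<open>Both claims come from differentiating \<open>P (t *\<^sub>R y) = t ^ l * P y\<close>: in
  t at t = 1 for Euler's identity, in y for the homogeneity of the gradient.\<close>

lemma homogeneous_gradient:
  fixes P :: "'a::euclidean_space \<Rightarrow> real"
  assumes hom: "\<And>t y. P (t *\<^sub>R y) = t ^ l * P y"
    and D: "\<And>y. (P has_derivative (\<lambda>h. D y \<bullet> h)) (at y)" and l: "l \<ge> 1"
  shows "D y \<bullet> y = real l * P y" and "t \<noteq> 0 \<Longrightarrow> D (t *\<^sub>R y) = t ^ (l - 1) *\<^sub>R D y"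
proof -
  have "((\<lambda>t. P (t *\<^sub>R y)) has_derivative (\<lambda>h. D y \<bullet> (h *\<^sub>R y))) (at 1)"
  proof (rule has_derivative_compose[of "\<lambda>t. t *\<^sub>R y"])
    show "((\<lambda>t. t *\<^sub>R y) has_derivative (\<lambda>h. h *\<^sub>R y)) (at (1::real))"
      by (auto intro!: derivative_eq_intros)
  qed (use D[of y] in simp)
  then have "((\<lambda>t. t ^ l * P y) has_real_derivative D y \<bullet> y) (at 1)"
    unfolding hom has_field_derivative_def by (simp add: mult_commute_abs)
  moreover have "((\<lambda>t. t ^ l * P y) has_real_derivative real l * P y) (at 1)"
    by (auto intro!: derivative_eq_intros)
  ultimately show "D y \<bullet> y = real l * P y" by (rule DERIV_unique)
  assume t: "t \<noteq> 0"
  have "((\<lambda>y. P (t *\<^sub>R y)) has_derivative (\<lambda>h. D (t *\<^sub>R y) \<bullet> (t *\<^sub>R h))) (at y)"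
    by (rule has_derivative_compose[of "\<lambda>y. t *\<^sub>R y", OF _ D]) (auto intro!: derivative_eq_intros)
  moreover have "((\<lambda>y. P (t *\<^sub>R y)) has_derivative (\<lambda>h. t ^ l * (D y \<bullet> h))) (at y)"
    unfolding hom by (intro has_derivative_mult_right D)
  ultimately have eq: "(\<lambda>h. D (t *\<^sub>R y) \<bullet> (t *\<^sub>R h)) = (\<lambda>h. t ^ l * (D y \<bullet> h))"
    by (rule has_derivative_unique)
  have tl: "t ^ l = t * t ^ (l - 1)" using l by (cases l) auto
  have "D (t *\<^sub>R y) \<bullet> h = (t ^ (l - 1) *\<^sub>R D y) \<bullet> h" for h
    using fun_cong[OF eq, of h] t by (simp add: tl)
  then show "D (t *\<^sub>R y) = t ^ (l - 1) *\<^sub>R D y" by (rule vector_eq_rdot[THEN iffD1, rule_format])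
qed

lemma continuous_bounded_on_sphere:
  fixes f :: "'a::euclidean_space \<Rightarrow> 'b::real_normed_vector"
  assumes "continuous_on UNIV f"
  shows "\<exists>B\<ge>0. \<forall>z\<in>sphere 0 1. norm (f z) \<le> B"
proof -
  have "bounded (f ` sphere 0 1)"
    by (intro compact_imp_bounded compact_continuous_image continuous_on_subset[OF assms] compact_sphere) simp
  then show ?thesis unfolding bounded_pos by (auto intro: less_imp_le)
qed

text \<open>With \<open>R\<close> equal to r^(l/2) and the clock R/r, the residual of the
  acceleration is divided by r^(l-1) and the energy by r^l, so that both estimates become errors of
  order r.\<close>

lemma direction_limit:
  fixes P :: "real^'n::finite \<Rightarrow> real" and y v a :: "real \<Rightarrow> real^'n"
  assumes P: "\<And>t y. P (t *\<^sub>R y) = t ^ l * P y" "\<And>y. (P has_derivative (\<lambda>h. D y \<bullet> h)) (at y)"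
    and Dpol: "\<And>i. real_polynomial_function (\<lambda>y. D y $ i)" and l: "l \<ge> 1"
    and y': "\<And>t. t \<ge> t0 \<Longrightarrow> (y has_vector_derivative v t) (at t)"
    and v': "\<And>t. t \<ge> t0 \<Longrightarrow> (v has_vector_derivative a t) (at t)"
    and a: "\<And>t. t \<ge> t0 \<Longrightarrow> norm (a t + D (y t)) \<le> C * norm (y t) ^ l"
    and en: "\<And>t. t \<ge> t0 \<Longrightarrow> \<bar>(v t \<bullet> v t) / 2 + P (y t)\<bar> \<le> C * norm (y t) ^ Suc l"
    and y0: "\<And>t. t \<ge> t0 \<Longrightarrow> y t \<noteq> 0" and lim: "(y \<longlongrightarrow> 0) at_top" and C: "C > 0"
  defines "q \<equiv> \<lambda>t. y t /\<^sub>R norm (y t)"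
  shows "\<exists>L\<le>0. ((\<lambda>t. P (q t)) \<longlongrightarrow> L) at_top \<and>
    ((\<lambda>t. D (q t) - (D (q t) \<bullet> q t) *\<^sub>R q t) \<longlongrightarrow> 0) at_top"
proof -
  obtain D' B0 where D': "\<And>y. (D has_derivative D' y) (at y)"
    and B0: "\<And>y h. y \<in> sphere 0 1 \<Longrightarrow> norm (D' y h) \<le> B0 * norm h"
    using polynomial_field_derivative_bounded[of D, OF Dpol compact_sphere, of 0 1] by metis
  have cont: "continuous_on UNIV P" "continuous_on UNIV D"
    using P(2) D' by (meson continuous_at_imp_continuous_on has_derivative_continuous)+
  obtain B1 where B1: "\<And>z. z \<in> sphere 0 1 \<Longrightarrow> norm (P z) \<le> B1"
    using continuous_bounded_on_sphere[OF cont(1)] by blast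
  obtain B2 where B2: "\<And>z. z \<in> sphere 0 1 \<Longrightarrow> norm (D z) \<le> B2"
    using continuous_bounded_on_sphere[OF cont(2)] by blast
  define B where "B = max B0 (max B1 B2)"
  note homD = homogeneous_gradient[of P l D, OF P l]
  define r where "r t = norm (y t)" for t
  \<comment> \<open>A real power, because l may be odd.\<close>
  define R where "R t = r t powr (real l / 2)" for t
  define w where "w t = v t /\<^sub>R R t" for t
  define e where "e t = (a t + D (y t)) /\<^sub>R r t ^ (l - 1)" for t
  have pw: "z ^ l = z * z ^ (l - 1)" for z :: real using l by (cases l) auto
  have r: "r t > 0" if "t \<ge> t0" for t using y0[OF that] by (simp add: r_def)
  have R: "R t > 0" if "t \<ge> t0" for t using r[OF that] by (simp add: R_def)
  \<comment> \<open>By this relation, multiplying by the clock and dividing by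
    \<open>r t ^ (l - 1)\<close> amounts to dividing by \<open>R t\<close>, as \<open>a t\<close> is
    in the derivative of \<open>w\<close>.\<close>
  have RR: "R t * R t = r t * r t ^ (l - 1)" if "t \<ge> t0" for t
  proof -
    have "R t * R t = r t powr real l" by (simp add: R_def powr_add[symmetric])
    also have "\<dots> = r t ^ l" using r[OF that] by (simp add: powr_realpow)
    finally show ?thesis by (simp only: pw)
  qed
  have r': "(r has_real_derivative (v t \<bullet> y t) / r t) (at t)" if t: "t \<ge> t0" for t
  proof -
    have "((\<lambda>t. norm (y t)) has_derivative (\<lambda>h. (h *\<^sub>R v t) \<bullet> sgn (y t))) (at t)"
      using y'[OF t] y0[OF t] unfolding has_vector_derivative_def
      by (intro has_derivative_compose[OF _ has_derivative_norm]) auto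
    moreover have "(\<lambda>h. (h *\<^sub>R v t) \<bullet> sgn (y t)) = (*) ((v t \<bullet> y t) / r t)"
      by (simp add: fun_eq_iff r_def sgn_div_norm divide_inverse mult_ac)
    ultimately show ?thesis
      unfolding r_def[abs_def] has_field_derivative_def by simp
  qed
  have wq: "R t / r t * r t * (w t \<bullet> q t) = (v t \<bullet> y t) / r t" if "t \<ge> t0" for t
    using r[OF that] R[OF that] by (simp add: w_def q_def r_def[symmetric] field_simps)
  show ?thesis
  proof (rule blow_up_limit[of t0 r "\<lambda>t. R t / r t" w q e D "real l / 2" C P B D'])
    fix t assume t: "t \<ge> t0"
    note rt = r[OF t] and Rt = R[OF t]
    show "(r has_real_derivative R t / r t * r t * (w t \<bullet> q t)) (at t)"
      unfolding wq[OF t] by (rule r'[OF t])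
    have "((\<lambda>t. inverse (r t)) has_real_derivative - (inverse (r t) * ((v t \<bullet> y t) / r t) * inverse (r t))) (at t)"
      using rt by (intro DERIV_inverse' r' t) auto
    from has_vector_derivative_scaleR[OF this y'[OF t]]
    have "(q has_vector_derivative inverse (r t) *\<^sub>R v t
       + (- (inverse (r t) * ((v t \<bullet> y t) / r t) * inverse (r t))) *\<^sub>R y t) (at t)"
      by (simp add: q_def r_def[symmetric])
    moreover have "(R t / r t) *\<^sub>R (w t - (w t \<bullet> q t) *\<^sub>R q t) = inverse (r t) *\<^sub>R v t
       + (- (inverse (r t) * ((v t \<bullet> y t) / r t) * inverse (r t))) *\<^sub>R y t"
      using rt Rt by (simp add: w_def q_def r_def[symmetric] scaleR_diff_right field_simps)
    ultimately show "(q has_vector_derivative (R t / r t) *\<^sub>R (w t - (w t \<bullet> q t) *\<^sub>R q t)) (at t)" by simp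
    have "(R has_real_derivative real l / 2 * r t powr (real l / 2 - 1) * ((v t \<bullet> y t) / r t)) (at t)"
      unfolding R_def[abs_def] using DERIV_fun_powr[OF r'[OF t] rt, of "real l / 2"] by simp
    moreover have "r t powr (real l / 2 - 1) = R t / r t"
      using rt by (simp add: R_def powr_diff)
    ultimately have R': "(R has_real_derivative real l / 2 * (R t / r t) * ((v t \<bullet> y t) / r t)) (at t)" by simp
    have "((\<lambda>t. inverse (R t)) has_real_derivative
        - (inverse (R t) * (real l / 2 * (R t / r t) * ((v t \<bullet> y t) / r t)) * inverse (R t))) (at t)"
      using Rt by (intro DERIV_inverse' R') auto
    from has_vector_derivative_scaleR[OF this v'[OF t]]
    have "(w has_vector_derivative inverse (R t) *\<^sub>R a t +
        (- (inverse (R t) * (real l / 2 * (R t / r t) * ((v t \<bullet> y t) / r t)) * inverse (R t))) *\<^sub>R v t) (at t)"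
      unfolding w_def[abs_def] .
    moreover have "(R t / r t) *\<^sub>R (e t - D (q t) - (real l / 2 * (w t \<bullet> q t)) *\<^sub>R w t) =
        inverse (R t) *\<^sub>R a t +
        (- (inverse (R t) * (real l / 2 * (R t / r t) * ((v t \<bullet> y t) / r t)) * inverse (R t))) *\<^sub>R v t"
    proof -
      have "D (y t) = D (r t *\<^sub>R q t)" using rt by (simp add: q_def r_def)
      also have "\<dots> = r t ^ (l - 1) *\<^sub>R D (q t)" using rt by (intro homD) auto
      finally have "D (q t) = D (y t) /\<^sub>R r t ^ (l - 1)" using rt by simp
      then have "e t - D (q t) = a t /\<^sub>R r t ^ (l - 1)" by (simp add: e_def scaleR_add_right)
      moreover have "R t / r t / r t ^ (l - 1) = inverse (R t)"
        using RR[OF t] rt Rt by (simp add: field_simps)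
      ultimately have 1: "(R t / r t) *\<^sub>R (e t - D (q t)) = inverse (R t) *\<^sub>R a t"
        by (simp add: divide_inverse)
      have "w t \<bullet> q t = (v t \<bullet> y t) / (R t * r t)"
        by (simp add: w_def q_def r_def[symmetric] divide_inverse mult_ac)
      then have 2: "(R t / r t) *\<^sub>R ((real l / 2 * (w t \<bullet> q t)) *\<^sub>R w t) =
        (inverse (R t) * (real l / 2 * (R t / r t) * ((v t \<bullet> y t) / r t)) * inverse (R t)) *\<^sub>R v t"
        using rt Rt by (simp add: w_def field_simps)
      show ?thesis unfolding scaleR_diff_right[of _ "e t - D (q t)"] 1 2 by simp
    qed
    ultimately show "(w has_vector_derivative
        (R t / r t) *\<^sub>R (e t - D (q t) - (real l / 2 * (w t \<bullet> q t)) *\<^sub>R w t)) (at t)" by simp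
    have "norm (e t) = norm (a t + D (y t)) / r t ^ (l - 1)"
      using rt by (simp add: e_def divide_inverse mult.commute)
    also have "\<dots> \<le> C * norm (y t) ^ l / r t ^ (l - 1)"
      using rt by (intro divide_right_mono a t) auto
    also have "\<dots> = C * r t" using rt by (simp add: pw r_def[symmetric])
    finally show "norm (e t) \<le> C * r t" .
    have rl: "R t * R t = r t ^ l" using RR[OF t] by (simp only: pw)
    have "P (y t) = P (r t *\<^sub>R q t)" using rt by (simp add: q_def r_def)
    then have "P (q t) = P (y t) / r t ^ l" using rt P(1) by simp
    moreover have "w t \<bullet> w t = (v t \<bullet> v t) / r t ^ l"
      unfolding rl[symmetric] by (simp add: w_def divide_inverse)
    ultimately have "(w t \<bullet> w t) / 2 + P (q t) = ((v t \<bullet> v t) / 2 + P (y t)) / r t ^ l"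
      by (simp add: add_divide_distrib)
    then have "\<bar>(w t \<bullet> w t) / 2 + P (q t)\<bar> = \<bar>(v t \<bullet> v t) / 2 + P (y t)\<bar> / r t ^ l"
      using rt by simp
    also have "\<dots> \<le> C * norm (y t) ^ Suc l / r t ^ l"
      using rt by (intro divide_right_mono en t) auto
    also have "\<dots> = C * r t" using rt by (simp add: r_def)
    finally show "\<bar>(w t \<bullet> w t) / 2 + P (q t)\<bar> \<le> C * r t" .
    show "norm (q t) = 1" using rt by (simp add: q_def r_def)
    show "r t > 0" "R t / r t > 0" using rt Rt by auto
  next
    show "(r \<longlongrightarrow> 0) at_top" unfolding r_def[abs_def] using tendsto_norm_zero[OF lim] .
    show "\<bar>P z\<bar> \<le> B" "norm (D z) \<le> B" if "norm z = 1" for z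
      using that B1[of z] B2[of z] by (auto simp: B_def)
    show "D z \<bullet> z = 2 * (real l / 2) * P z" for z using homD(1) by simp
    show "(D has_derivative D' z) (at z)" for z by (rule D')
    show "norm (D' z h) \<le> B * norm h" if "norm z = 1" for z h
    proof -
      have "norm (D' z h) \<le> B0 * norm h" using that by (intro B0) simp
      also have "\<dots> \<le> B * norm h" by (intro mult_right_mono) (auto simp: B_def)
      finally show ?thesis .
    qed
  qed (use C in auto)
qed

section \<open>Estimates at the rest point\<close>

text \<open>A finite family shares a neighbourhood and a constant, the sum of the individual ones.
  The index type will be the coordinates, pairs of coordinates, or \<open>unit\<close>.\<close>

lemma taylor_family:
  fixes F :: "'i::finite \<Rightarrow> real^'n::finite \<Rightarrow> real"
  assumes an: "\<And>i. real_analytic_at (F i) 0" and low: "\<And>k i. k < l \<Longrightarrow> taylor_term k (F i) = (\<lambda>_. 0)"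
  shows "\<exists>C\<ge>0. \<forall>\<^sub>F y in nhds 0. \<forall>i. F i differentiable (at y) \<and>
        \<bar>F i y - taylor_term l (F i) y\<bar> \<le> C * norm y ^ Suc l \<and>
        (\<forall>h. \<bar>frechet_derivative (F i) (at y) h - frechet_derivative (taylor_term l (F i)) (at y) h\<bar>
            \<le> C * norm y ^ l * norm h)"
proof -
  have "\<exists>\<rho> C. \<rho> > 0 \<and> C \<ge> 0 \<and> (\<forall>y. norm y < \<rho> \<longrightarrow> F i differentiable (at y) \<and>
        \<bar>F i y - taylor_term l (F i) y\<bar> \<le> C * norm y ^ Suc l \<and>
        (\<forall>h. \<bar>frechet_derivative (F i) (at y) h - frechet_derivative (taylor_term l (F i)) (at y) h\<bar>
            \<le> C * norm y ^ l * norm h))" for i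
    using real_analytic_at_taylor(4)[OF an, of l i] low by blast
  then obtain \<rho> C where \<rho>: "\<And>i. \<rho> i > 0" and C: "\<And>i. C i \<ge> 0" and
    est: "\<And>i y. norm y < \<rho> i \<Longrightarrow> F i differentiable (at y) \<and>
        \<bar>F i y - taylor_term l (F i) y\<bar> \<le> C i * norm y ^ Suc l \<and>
        (\<forall>h. \<bar>frechet_derivative (F i) (at y) h - frechet_derivative (taylor_term l (F i)) (at y) h\<bar>
            \<le> C i * norm y ^ l * norm h)"
    by metis
  have Ci: "C i \<le> (\<Sum>i\<in>UNIV. C i)" for i using C by (intro member_le_sum) auto
  have "\<forall>\<^sub>F y in nhds 0. \<forall>i. norm (y::real^'n) < \<rho> i"
  proof (rule eventually_all_finite)
    fix i
    have "\<forall>\<^sub>F y in nhds 0. y \<in> ball (0::real^'n) (\<rho> i)"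
      using \<rho> by (intro eventually_nhds_in_open) auto
    then show "\<forall>\<^sub>F y in nhds 0. norm (y::real^'n) < \<rho> i" by simp
  qed
  then have "\<forall>\<^sub>F y in nhds 0. \<forall>i. F i differentiable (at y) \<and>
        \<bar>F i y - taylor_term l (F i) y\<bar> \<le> (\<Sum>i\<in>UNIV. C i) * norm y ^ Suc l \<and>
        (\<forall>h. \<bar>frechet_derivative (F i) (at y) h - frechet_derivative (taylor_term l (F i)) (at y) h\<bar>
            \<le> (\<Sum>i\<in>UNIV. C i) * norm y ^ l * norm h)"
  proof eventually_elim
    case (elim y)
    show ?case
    proof (intro allI conjI)
      fix i and h :: "real^'n"
      note e = est[OF elim[rule_format, of i]]
      from e show "F i differentiable (at y)" by blast
      have "C i * norm y ^ Suc l \<le> (\<Sum>i\<in>UNIV. C i) * norm y ^ Suc l"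
        by (intro mult_right_mono Ci) simp
      with e show "\<bar>F i y - taylor_term l (F i) y\<bar> \<le> (\<Sum>i\<in>UNIV. C i) * norm y ^ Suc l" by linarith
      have "C i * norm y ^ l * norm h \<le> (\<Sum>i\<in>UNIV. C i) * norm y ^ l * norm h"
        by (intro mult_right_mono Ci) simp_all
      with e show "\<bar>frechet_derivative (F i) (at y) h - frechet_derivative (taylor_term l (F i)) (at y) h\<bar>
            \<le> (\<Sum>i\<in>UNIV. C i) * norm y ^ l * norm h" by (meson order_trans)
    qed
  qed
  moreover have "(\<Sum>i\<in>UNIV. C i) \<ge> 0" using C by (simp add: sum_nonneg)
  ultimately show ?thesis by blast
qed

text \<open>Taylor expansion at order 0: the leading term is constant, so the remainder has order 1
  and the partial derivatives stay bounded.\<close>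

lemma metric_estimate:
  fixes G :: "real^'n::finite \<Rightarrow> real^'n^'n"
  assumes an: "\<And>i j. real_analytic_at (\<lambda>y. G y $ i $ j) 0"
  shows "\<exists>C\<ge>0. \<forall>\<^sub>F y in nhds 0. \<forall>i j. (\<lambda>z. G z $ i $ j) differentiable (at y) \<and>
    \<bar>G y $ i $ j - G 0 $ i $ j\<bar> \<le> C * norm y \<and> (\<forall>k. \<bar>partial k (\<lambda>z. G z $ i $ j) y\<bar> \<le> C)"
proof -
  define F where "F p y = G y $ fst p $ snd p" for p :: "'n \<times> 'n" and y
  have T0: "taylor_term 0 (F p) = (\<lambda>_. F p 0)" for p by (simp add: taylor_term_def fun_eq_iff)
  have "\<exists>C\<ge>0. \<forall>\<^sub>F y in nhds 0. \<forall>p. F p differentiable (at y) \<and>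
        \<bar>F p y - taylor_term 0 (F p) y\<bar> \<le> C * norm y ^ Suc 0 \<and>
        (\<forall>h. \<bar>frechet_derivative (F p) (at y) h - frechet_derivative (taylor_term 0 (F p)) (at y) h\<bar>
            \<le> C * norm y ^ 0 * norm h)"
    by (rule taylor_family) (use an in \<open>auto simp: F_def[abs_def]\<close>)
  then obtain C where C: "C \<ge> 0" and ev: "\<forall>\<^sub>F y in nhds 0. \<forall>p. F p differentiable (at y) \<and>
        \<bar>F p y - F p 0\<bar> \<le> C * norm y \<and> (\<forall>h. \<bar>frechet_derivative (F p) (at y) h\<bar> \<le> C * norm h)"
    by (auto simp: T0)
  from ev have "\<forall>\<^sub>F y in nhds 0. \<forall>i j. (\<lambda>z. G z $ i $ j) differentiable (at y) \<and>
    \<bar>G y $ i $ j - G 0 $ i $ j\<bar> \<le> C * norm y \<and> (\<forall>k. \<bar>partial k (\<lambda>z. G z $ i $ j) y\<bar> \<le> C)"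
  proof eventually_elim
    case (elim y)
    show ?case
    proof (intro allI)
      fix i j
      have "\<bar>frechet_derivative (F (i, j)) (at y) (axis k 1)\<bar> \<le> C" for k
        using elim[rule_format, of "(i, j)"] by (metis mult.right_neutral norm_axis_1)
      then show "(\<lambda>z. G z $ i $ j) differentiable (at y) \<and>
        \<bar>G y $ i $ j - G 0 $ i $ j\<bar> \<le> C * norm y \<and> (\<forall>k. \<bar>partial k (\<lambda>z. G z $ i $ j) y\<bar> \<le> C)"
        using elim[rule_format, of "(i, j)"] by (simp add: F_def[abs_def] partial_def)
    qed
  qed
  with C show ?thesis by blast
qed

text \<open>The bound on the gradient extends from the sphere by homogeneity; Euler's identity then
  carries it over to \<open>P\<close>.\<close>

lemma homogeneous_bounds:
  fixes P :: "'a::euclidean_space \<Rightarrow> real"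
  assumes hom: "\<And>t y. P (t *\<^sub>R y) = t ^ l * P y"
    and D: "\<And>y. (P has_derivative (\<lambda>h. D y \<bullet> h)) (at y)" and l: "l \<ge> 1"
    and cont: "continuous_on UNIV D"
  shows "\<exists>B\<ge>0. \<forall>y. \<bar>P y\<bar> \<le> B * norm y ^ l \<and> (y \<noteq> 0 \<longrightarrow> norm (D y) \<le> B * norm y ^ (l - 1))"
proof -
  obtain B where B: "B \<ge> 0" "\<And>z. z \<in> sphere 0 1 \<Longrightarrow> norm (D z) \<le> B"
    using continuous_bounded_on_sphere[OF cont] by blast
  have Db: "norm (D y) \<le> B * norm y ^ (l - 1)" if "y \<noteq> 0" for y
  proof -
    have "D y = D (norm y *\<^sub>R (y /\<^sub>R norm y))" using that by simp
    also have "\<dots> = norm y ^ (l - 1) *\<^sub>R D (y /\<^sub>R norm y)"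
      using that by (intro homogeneous_gradient(2)[OF hom D l]) simp
    finally have "norm (D y) = norm y ^ (l - 1) * norm (D (y /\<^sub>R norm y))" by simp
    also have "\<dots> \<le> norm y ^ (l - 1) * B" using that by (intro mult_left_mono B) auto
    finally show ?thesis by (simp add: mult.commute)
  qed
  have Pb: "\<bar>P y\<bar> \<le> B * norm y ^ l" for y
  proof (cases "y = 0")
    case True
    then show ?thesis using hom[of 0 y] l by (simp add: power_0_left)
  next
    case False
    have "real l * \<bar>P y\<bar> = \<bar>D y \<bullet> y\<bar>"
      using homogeneous_gradient(1)[OF hom D l, of y] by (simp add: abs_mult)
    also have "\<dots> \<le> B * norm y ^ (l - 1) * norm y"
      by (rule order_trans[OF Cauchy_Schwarz_ineq2 mult_right_mono[OF Db[OF False]]]) simp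
    also have "\<dots> = B * norm y ^ l" using l by (cases l) auto
    finally have "real l * \<bar>P y\<bar> \<le> B * norm y ^ l" .
    moreover have "1 * \<bar>P y\<bar> \<le> real l * \<bar>P y\<bar>" using l by (intro mult_right_mono) auto
    ultimately show ?thesis by simp
  qed
  show ?thesis using B(1) Db Pb by blast
qed

lemma polynomial_field_continuous:
  fixes D :: "real^'n::finite \<Rightarrow> real^'n"
  assumes "\<And>i. real_polynomial_function (\<lambda>y. D y $ i)"
  shows "continuous_on S D"
proof -
  have "continuous_on S (\<lambda>y. \<chi> i. D y $ i)"
    by (intro continuous_on_vec_lambda continuous_on_polymonial_function real_polynomial_function_eq[THEN iffD1] assms)
  then show ?thesis by simp
qed

text \<open>An analytic function all of whose Taylor terms vanish is zero near the origin, so for a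
  non-zero germ the \<open>LEAST\<close> is attained.\<close>

lemma first_degree_properties:
  fixes u :: "real^'n::finite \<Rightarrow> real"
  assumes an: "real_analytic_at u 0" and nz: "\<not> (\<forall>\<^sub>F y in nhds 0. u y = 0)"
  shows "taylor_term (first_degree u) u \<noteq> (\<lambda>_. 0)" "k < first_degree u \<Longrightarrow> taylor_term k u = (\<lambda>_. 0)"
proof -
  have "\<exists>k. taylor_term k u \<noteq> (\<lambda>_. 0)" using real_analytic_at_taylor(3)[OF an] nz by blast
  then show "taylor_term (first_degree u) u \<noteq> (\<lambda>_. 0)"
    unfolding first_degree_def by (rule LeastI_ex)
  show "k < first_degree u \<Longrightarrow> taylor_term k u = (\<lambda>_. 0)"
    unfolding first_degree_def using not_less_Least by blast
qed

lemma real_analytic_at_differentiable: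
  fixes u :: "real^'n::finite \<Rightarrow> real"
  assumes an: "real_analytic_at u 0"
  shows "u differentiable (at 0)"
  using real_analytic_at_taylor(4)[OF an, of 0] by (metis less_nat_zero_code norm_zero)

text \<open>The Taylor terms of degree 0 and 1 are the value and the differential at the
  origin.\<close>

lemma first_degree_ge_2:
  fixes u :: "real^'n::finite \<Rightarrow> real"
  assumes an: "real_analytic_at u 0" and nz: "\<not> (\<forall>\<^sub>F y in nhds 0. u y = 0)"
    and u0: "u 0 = 0" and du: "frechet_derivative u (at 0) = (\<lambda>_. 0)"
  shows "first_degree u \<ge> 2"
proof -
  have "taylor_term 0 u = (\<lambda>_. 0)" using u0 by (simp add: taylor_term_def fun_eq_iff)
  moreover have "taylor_term 1 u = (\<lambda>_. 0)"
  proof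
    fix y
    have "(u has_derivative (\<lambda>_. 0)) (at (0 *\<^sub>R y))"
      using real_analytic_at_differentiable[OF an] du by (metis frechet_derivative_works scaleR_zero_left)
    then have "((\<lambda>t. u (t *\<^sub>R y)) has_derivative (\<lambda>h. 0)) (at 0)"
      by (rule has_derivative_compose[of "\<lambda>t. t *\<^sub>R y" "\<lambda>h. h *\<^sub>R y", rotated])
        (auto intro!: derivative_eq_intros)
    then have "((\<lambda>t. u (t *\<^sub>R y)) has_real_derivative 0) (at 0)"
      by (simp add: has_field_derivative_def mult_zero_left[abs_def])
    then show "taylor_term 1 u y = 0" by (simp add: taylor_term_def DERIV_imp_deriv)
  qed
  ultimately have "first_degree u \<noteq> 0 \<and> first_degree u \<noteq> 1"
    using first_degree_properties(1)[OF an nz] by metis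
  then show ?thesis by linarith
qed

lemma potential_estimate:
  fixes u :: "real^'n::finite \<Rightarrow> real"
  assumes an: "real_analytic_at u 0" and nz: "\<not> (\<forall>\<^sub>F y in nhds 0. u y = 0)"
    and D: "\<And>y. (first_jet u has_derivative (\<lambda>h. D y \<bullet> h)) (at y)"
  shows "\<exists>C\<ge>0. \<forall>\<^sub>F y in nhds 0. u differentiable (at y) \<and>
    \<bar>u y - first_jet u y\<bar> \<le> C * norm y ^ Suc (first_degree u) \<and>
    (\<forall>i. \<bar>partial i u y - D y $ i\<bar> \<le> C * norm y ^ first_degree u)"
proof -
  have D': "frechet_derivative (first_jet u) (at y) = (\<lambda>h. D y \<bullet> h)" for y
    by (intro frechet_derivative_at[symmetric] D)
  have "\<exists>C\<ge>0. \<forall>\<^sub>F y in nhds 0. \<forall>i::unit. u differentiable (at y) \<and>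
        \<bar>u y - taylor_term (first_degree u) u y\<bar> \<le> C * norm y ^ Suc (first_degree u) \<and>
        (\<forall>h. \<bar>frechet_derivative u (at y) h - frechet_derivative (taylor_term (first_degree u) u) (at y) h\<bar>
            \<le> C * norm y ^ first_degree u * norm h)"
    by (rule taylor_family[of "\<lambda>_. u"]) (use an first_degree_properties(2)[OF an nz] in auto)
  then obtain C where C: "C \<ge> 0" and ev: "\<forall>\<^sub>F y in nhds 0. u differentiable (at y) \<and>
        \<bar>u y - first_jet u y\<bar> \<le> C * norm y ^ Suc (first_degree u) \<and>
        (\<forall>h. \<bar>frechet_derivative u (at y) h - D y \<bullet> h\<bar> \<le> C * norm y ^ first_degree u * norm h)"
    unfolding first_jet_def[symmetric] D' by auto
  from ev have "\<forall>\<^sub>F y in nhds 0. u differentiable (at y) \<and>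
    \<bar>u y - first_jet u y\<bar> \<le> C * norm y ^ Suc (first_degree u) \<and>
    (\<forall>i. \<bar>partial i u y - D y $ i\<bar> \<le> C * norm y ^ first_degree u)"
  proof eventually_elim
    case (elim y)
    have "\<bar>partial i u y - D y $ i\<bar> \<le> C * norm y ^ first_degree u" for i
      using elim[THEN conjunct2, THEN conjunct2, rule_format, of "axis i 1"] by (simp add: partial_def inner_axis)
    with elim show ?case by blast
  qed
  with C show ?thesis by blast
qed

text \<open>A field of order d has partial derivatives of order d - 1, and weak magnetism puts the
  degree of the potential below \<open>2 * (d - 1)\<close> or at it. Squares are estimated because
  half that degree need not be an integer.\<close>

lemma magnetic_estimate:
  fixes m :: "real^'n::finite \<Rightarrow> real^'n"
  assumes an: "\<And>i. real_analytic_at (\<lambda>y. m y $ i) 0" and weak: "weak_magnetism u m"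
  shows "\<exists>C\<ge>0. \<forall>\<^sub>F y in nhds 0. y \<noteq> 0 \<longrightarrow>
    (\<forall>i j. (partial j (\<lambda>z. m z $ i) y)\<^sup>2 \<le> C * norm y ^ first_degree u)"
proof (cases "\<forall>\<^sub>F y in nhds 0. m y = 0")
  case True
  then have "\<forall>\<^sub>F y in nhds 0. \<forall>\<^sub>F z in nhds y. m z = 0" by (simp add: eventually_eventually)
  then have "\<forall>\<^sub>F y in nhds 0. \<forall>i j. partial j (\<lambda>z. m z $ i) y = 0"
  proof eventually_elim
    case (elim y)
    show ?case
    proof (intro allI)
      fix i j
      have "\<forall>\<^sub>F z in nhds y. m z $ i = 0" using elim by eventually_elim simp
      then obtain S where S: "open S" "y \<in> S" "\<And>z. z \<in> S \<Longrightarrow> m z $ i = 0"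
        unfolding eventually_nhds by blast
      have "((\<lambda>z. m z $ i) has_derivative (\<lambda>_. 0)) (at y)"
        by (rule has_derivative_transform_within_open[OF has_derivative_const S(1,2)]) (simp add: S(3))
      then have "frechet_derivative (\<lambda>z. m z $ i) (at y) = (\<lambda>_. 0)"
        by (rule frechet_derivative_at[symmetric])
      then show "partial j (\<lambda>z. m z $ i) y = 0" by (simp add: partial_def)
    qed
  qed
  then show ?thesis by (intro exI[of _ 0]) (auto elim: eventually_mono)
next
  case False
  define d where "d = first_degree_form m"
  have dl: "first_degree u \<le> 2 * (d - 1)" and d1: "d \<ge> 1"
  proof -
    have "real d - real (first_degree u) / 2 \<ge> 1"
      using weak False unfolding weak_magnetism_def d_def by blast
    then have "real (first_degree u) + 2 \<le> real (2 * d)" by simp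
    then have "first_degree u + 2 \<le> 2 * d" by linarith
    then show "first_degree u \<le> 2 * (d - 1)" "d \<ge> 1" by auto
  qed
  have low: "taylor_term k (\<lambda>y. m y $ i) = (\<lambda>_. 0)" if "k < d" for k i
    using not_less_Least[of k "\<lambda>k. \<exists>i. taylor_term k (\<lambda>y. m y $ i) \<noteq> (\<lambda>_. 0)"] that
    unfolding d_def first_degree_form_def by blast
  obtain D where D: "\<And>i j. real_polynomial_function (\<lambda>y. D i y $ j)"
    "\<And>i y. (taylor_term d (\<lambda>y. m y $ i) has_derivative (\<lambda>h. D i y \<bullet> (h::real^'n))) (at y)"
    using real_polynomial_function_gradient[OF real_analytic_at_taylor(1)[OF an]] by metis
  have "\<exists>B\<ge>0. \<forall>y. \<bar>taylor_term d (\<lambda>y. m y $ i) y\<bar> \<le> B * norm y ^ d \<and>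
      (y \<noteq> 0 \<longrightarrow> norm (D i y) \<le> B * norm y ^ (d - 1))" for i
    by (rule homogeneous_bounds[OF real_analytic_at_taylor(2)[OF an] D(2) d1 polynomial_field_continuous[OF D(1)]])
  then obtain B where B: "\<And>i. B i \<ge> 0" "\<And>i y. y \<noteq> 0 \<Longrightarrow> norm (D i y) \<le> B i * norm y ^ (d - 1)"
    by metis
  have D': "frechet_derivative (taylor_term d (\<lambda>y. m y $ i)) (at y) = (\<lambda>h. D i y \<bullet> h)" for i y
    by (intro frechet_derivative_at[symmetric] D)
  obtain C where C: "C \<ge> 0" and ev: "\<forall>\<^sub>F y in nhds 0. \<forall>i. (\<lambda>y. m y $ i) differentiable (at y) \<and>
        \<bar>m y $ i - taylor_term d (\<lambda>y. m y $ i) y\<bar> \<le> C * norm y ^ Suc d \<and>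
        (\<forall>h. \<bar>frechet_derivative (\<lambda>y. m y $ i) (at y) h - D i y \<bullet> h\<bar> \<le> C * norm y ^ d * norm h)"
    using taylor_family[of "\<lambda>i y. m y $ i" d, OF an low] unfolding D' by blast
  define K where "K = C + (\<Sum>i\<in>UNIV. B i)"
  have Bi: "B i \<le> (\<Sum>i\<in>UNIV. B i)" for i using B by (intro member_le_sum) auto
  have K: "K \<ge> 0" using C B by (simp add: K_def sum_nonneg)
  have "\<forall>\<^sub>F y in nhds 0. y \<in> ball (0::real^'n) 1" by (intro eventually_nhds_in_open) auto
  with ev have "\<forall>\<^sub>F y in nhds 0. y \<noteq> 0 \<longrightarrow>
    (\<forall>i j. (partial j (\<lambda>z. m z $ i) y)\<^sup>2 \<le> K\<^sup>2 * norm y ^ first_degree u)"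
  proof eventually_elim
    case (elim y)
    show ?case
    proof (intro impI allI)
      fix i j assume y: "y \<noteq> 0"
      have y1: "norm y \<le> 1" using elim(2) by simp
      have "\<bar>partial j (\<lambda>z. m z $ i) y - D i y $ j\<bar> \<le> C * norm y ^ d"
        using elim(1)[rule_format, of i, THEN conjunct2, THEN conjunct2, rule_format, of "axis j 1"]
        by (simp add: partial_def inner_axis)
      moreover have "C * norm y ^ d \<le> C * norm y ^ (d - 1)"
        using y1 C by (intro mult_left_mono power_decreasing) auto
      moreover have "\<bar>D i y $ j\<bar> \<le> B i * norm y ^ (d - 1)"
        using B(2)[OF y] component_le_norm_cart order_trans by blast
      moreover have "B i * norm y ^ (d - 1) \<le> (\<Sum>i\<in>UNIV. B i) * norm y ^ (d - 1)"
        by (intro mult_right_mono Bi) simp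
      ultimately have "\<bar>partial j (\<lambda>z. m z $ i) y\<bar> \<le> K * norm y ^ (d - 1)"
        by (simp add: K_def distrib_right)
      then have "(partial j (\<lambda>z. m z $ i) y)\<^sup>2 \<le> (K * norm y ^ (d - 1))\<^sup>2"
        by (metis abs_ge_zero power2_abs power_mono)
      also have "\<dots> = K\<^sup>2 * norm y ^ (2 * (d - 1))"
        by (simp add: power_mult_distrib power_mult[symmetric] mult.commute)
      also have "\<dots> \<le> K\<^sup>2 * norm y ^ first_degree u"
        using y1 dl by (intro mult_left_mono power_decreasing) auto
      finally show "(partial j (\<lambda>z. m z $ i) y)\<^sup>2 \<le> K\<^sup>2 * norm y ^ first_degree u" .
    qed
  qed
  then show ?thesis by (intro exI[of _ "K\<^sup>2"]) simp
qed

section \<open>The equation of motion with lowered index, and conservation of energy\<close>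

definition christoffel_form :: "(real^'n \<Rightarrow> real^'n^'n) \<Rightarrow> real^'n \<Rightarrow> real^'n \<Rightarrow> real^'n" where
  "christoffel_form G y v = (\<chi> l. (\<Sum>i\<in>UNIV. \<Sum>j\<in>UNIV.
     (partial i (\<lambda>z. G z $ j $ l) y + partial j (\<lambda>z. G z $ i $ l) y - partial l (\<lambda>z. G z $ i $ j) y)
       * v $ i * v $ j) / 2)"

definition energy :: "(real^'n \<Rightarrow> real^'n^'n) \<Rightarrow> (real^'n \<Rightarrow> real) \<Rightarrow> real^'n \<Rightarrow> real^'n \<Rightarrow> real" where
  "energy G u y v = (v \<bullet> (G y *v v)) / 2 + u y"

text \<open>Taking the inverse metric out of the Christoffel symbols leaves the symbols of the first
  kind; contracted twice with \<open>v\<close> they form the covector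
  \<open>christoffel_form\<close>.\<close>

lemma covariant_acceleration_eq:
  "covariant_acceleration G y v a = a + matrix_inv (G y) *v christoffel_form G y v"
proof -
  have "(\<Sum>i\<in>UNIV. \<Sum>j\<in>UNIV. christoffel G y k i j * v $ i * v $ j)
      = (matrix_inv (G y) *v christoffel_form G y v) $ k" for k
  proof -
    define S where "S i j l = partial i (\<lambda>z. G z $ j $ l) y + partial j (\<lambda>z. G z $ i $ l) y
      - partial l (\<lambda>z. G z $ i $ j) y" for i j l
    have "(\<Sum>i\<in>UNIV. \<Sum>j\<in>UNIV. christoffel G y k i j * v $ i * v $ j)
        = (\<Sum>i\<in>UNIV. \<Sum>j\<in>UNIV. \<Sum>l\<in>UNIV. matrix_inv (G y) $ k $ l * (S i j l * v $ i * v $ j) / 2)"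
      by (simp add: christoffel_def S_def[symmetric] sum_distrib_right sum_divide_distrib mult.assoc)
    also have "\<dots> = (\<Sum>l\<in>UNIV. \<Sum>i\<in>UNIV. \<Sum>j\<in>UNIV. matrix_inv (G y) $ k $ l * (S i j l * v $ i * v $ j) / 2)"
      by (subst sum.swap[of _ UNIV UNIV], rule sum.swap[THEN trans], intro sum.cong refl sum.swap)
    also have "\<dots> = (matrix_inv (G y) *v christoffel_form G y v) $ k"
      by (simp add: matrix_vector_mult_def christoffel_form_def S_def[symmetric] sum_distrib_left sum_divide_distrib)
    finally show ?thesis .
  qed
  then show ?thesis by (simp add: covariant_acceleration_def vec_eq_iff)
qed

text \<open>Multiplication by the metric clears every inverse matrix, so that later estimates
  concern only \<open>G\<close> itself and its derivatives.\<close>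

lemma lowered_euler_lagrange:
  assumes inv: "invertible (G y)"
    and eq: "covariant_acceleration G y v a = - gradient G u y - riesz G y (contract_d m y v)"
  shows "G y *v a = - ((\<chi> i. partial i u y) + contract_d m y v + christoffel_form G y v)"
proof -
  have AI: "G y *v (matrix_inv (G y) *v z) = z" for z
    using someI_ex[OF inv[unfolded invertible_def]] unfolding matrix_inv_def by (simp add: matrix_vector_mul_assoc)
  have "G y *v (a + matrix_inv (G y) *v christoffel_form G y v)
      = G y *v (- gradient G u y - riesz G y (contract_d m y v))"
    using eq by (simp add: covariant_acceleration_eq)
  then have e: "G y *v a + christoffel_form G y v = - (\<chi> i. partial i u y) - contract_d m y v"
    by (simp add: gradient_def riesz_def matrix_vector_right_distrib matrix_vector_mult_diff_distrib
        AI vec.neg)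
  have "G y *v a = (G y *v a + christoffel_form G y v) - christoffel_form G y v" by simp
  also have "\<dots> = - ((\<chi> i. partial i u y) + contract_d m y v + christoffel_form G y v)"
    unfolding e by simp
  finally show ?thesis .
qed

text \<open>The coefficients of dm are antisymmetric: the magnetic force does no work.\<close>

lemma inner_contract_d: "v \<bullet> contract_d m y v = 0"
proof -
  define d where "d i j = partial j (\<lambda>z. m z $ i) y" for i j
  have "v \<bullet> contract_d m y v = (\<Sum>i\<in>UNIV. \<Sum>j\<in>UNIV. v $ i * (v $ j * (d i j - d j i)))"
    by (simp add: contract_d_def inner_vec_def sum_distrib_left d_def)
  also have "\<dots> = (\<Sum>i\<in>UNIV. \<Sum>j\<in>UNIV. v $ i * v $ j * d i j) - (\<Sum>i\<in>UNIV. \<Sum>j\<in>UNIV. v $ i * v $ j * d j i)"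
    by (simp add: sum_subtractf[symmetric] algebra_simps)
  also have "(\<Sum>i\<in>UNIV. \<Sum>j\<in>UNIV. v $ i * v $ j * d j i) = (\<Sum>i\<in>UNIV. \<Sum>j\<in>UNIV. v $ i * v $ j * d i j)"
    by (subst sum.swap) (simp add: mult.commute)
  finally show ?thesis by simp
qed

text \<open>Contracted with three copies of \<open>v\<close>, the three groups of partial
  derivatives have equal sums; two cancel, and half the change of the metric along \<open>v\<close>
  remains.\<close>

lemma inner_christoffel_form:
  "v \<bullet> christoffel_form G y v =
     (\<Sum>i\<in>UNIV. \<Sum>j\<in>UNIV. v $ i * (\<Sum>k\<in>UNIV. partial k (\<lambda>z. G z $ i $ j) y * v $ k) * v $ j) / 2"
proof -
  define g where "g i j k = partial k (\<lambda>z. G z $ i $ j) y * (v $ i * v $ j * v $ k)" for i j k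
  have "v \<bullet> christoffel_form G y v
      = (\<Sum>l\<in>UNIV. \<Sum>i\<in>UNIV. \<Sum>j\<in>UNIV. (g j l i + g i l j - g i j l) / 2)"
    by (simp add: inner_vec_def christoffel_form_def g_def sum_distrib_left sum_divide_distrib algebra_simps)
  also have "\<dots> = ((\<Sum>l\<in>UNIV. \<Sum>i\<in>UNIV. \<Sum>j\<in>UNIV. g j l i) + (\<Sum>l\<in>UNIV. \<Sum>i\<in>UNIV. \<Sum>j\<in>UNIV. g i l j)
      - (\<Sum>l\<in>UNIV. \<Sum>i\<in>UNIV. \<Sum>j\<in>UNIV. g i j l)) / 2"
    by (simp add: sum.distrib sum_subtractf sum_divide_distrib[symmetric])
  also have "(\<Sum>l\<in>UNIV. \<Sum>i\<in>UNIV. \<Sum>j\<in>UNIV. g j l i) = (\<Sum>l\<in>UNIV. \<Sum>i\<in>UNIV. \<Sum>j\<in>UNIV. g i l j)"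
    by (intro sum.cong refl sum.swap)
  also have "(\<Sum>l\<in>UNIV. \<Sum>i\<in>UNIV. \<Sum>j\<in>UNIV. g i l j) = (\<Sum>i\<in>UNIV. \<Sum>j\<in>UNIV. \<Sum>k\<in>UNIV. g i j k)"
    by (rule sum.swap)
  also have "(\<Sum>l\<in>UNIV. \<Sum>i\<in>UNIV. \<Sum>j\<in>UNIV. g i j l) = (\<Sum>i\<in>UNIV. \<Sum>l\<in>UNIV. \<Sum>j\<in>UNIV. g i j l)"
    by (rule sum.swap)
  also have "\<dots> = (\<Sum>i\<in>UNIV. \<Sum>j\<in>UNIV. \<Sum>k\<in>UNIV. g i j k)"
    by (intro sum.cong refl sum.swap)
  finally show ?thesis
    by (simp add: g_def sum_distrib_left sum_distrib_right mult_ac)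
qed

lemma chain_rule_partial:
  fixes F :: "real^'n::finite \<Rightarrow> real"
  assumes "F differentiable (at (Y t))" and Y: "(Y has_vector_derivative V) (at t within J)"
  shows "((\<lambda>s. F (Y s)) has_real_derivative (\<Sum>k\<in>UNIV. partial k F (Y t) * V $ k)) (at t within J)"
proof -
  have F: "(F has_derivative frechet_derivative F (at (Y t))) (at (Y t))"
    using assms(1) by (simp add: frechet_derivative_works)
  then have "((F \<circ> Y) has_vector_derivative frechet_derivative F (at (Y t)) V) (at t within J)"
    using vector_derivative_diff_chain_within[OF Y] has_derivative_at_withinI by blast
  moreover have "frechet_derivative F (at (Y t)) V = (\<Sum>k\<in>UNIV. partial k F (Y t) * V $ k)"
  proof -
    have "frechet_derivative F (at (Y t)) V = frechet_derivative F (at (Y t)) (\<Sum>k\<in>UNIV. V $ k *\<^sub>R axis k 1)"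
      using basis_expansion[of V] by (simp add: scalar_mult_eq_scaleR)
    also have "\<dots> = (\<Sum>k\<in>UNIV. V $ k * frechet_derivative F (at (Y t)) (axis k 1))"
      using has_derivative_linear[OF F] by (simp add: linear_sum linear_scale)
    finally show ?thesis by (simp add: partial_def mult.commute)
  qed
  ultimately show ?thesis
    by (simp add: has_real_derivative_iff_has_vector_derivative comp_def)
qed

text \<open>The work of the Christoffel term compensates the change of the metric in the kinetic
  energy, the work of the gradient compensates the change of \<open>u\<close>, and the magnetic term
  does no work. Derivatives are taken within \<open>J\<close> to include endpoints of the time
  interval.\<close>

lemma energy_derivative:
  fixes Y V :: "real \<Rightarrow> real^'n::finite"
  assumes Y: "(Y has_vector_derivative V t) (at t within J)"
    and V: "(V has_vector_derivative a) (at t within J)"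
    and G: "\<And>i j. (\<lambda>z. G z $ i $ j) differentiable (at (Y t))" and u: "u differentiable (at (Y t))"
    and sym: "transpose (G (Y t)) = G (Y t)"
    and eq: "G (Y t) *v a = - ((\<chi> i. partial i u (Y t)) + contract_d m (Y t) (V t) + christoffel_form G (Y t) (V t))"
  shows "((\<lambda>s. energy G u (Y s) (V s)) has_real_derivative 0) (at t within J)"
proof -
  have Vi: "((\<lambda>s. V s $ i) has_real_derivative a $ i) (at t within J)" for i
    using bounded_linear.has_vector_derivative[OF bounded_linear_vec_nth V]
    by (simp add: has_real_derivative_iff_has_vector_derivative)
  define dG where "dG i j = (\<Sum>k\<in>UNIV. partial k (\<lambda>z. G z $ i $ j) (Y t) * V t $ k)" for i j
  have Gij: "((\<lambda>s. G (Y s) $ i $ j) has_real_derivative dG i j) (at t within J)" for i j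
    unfolding dG_def by (rule chain_rule_partial[OF G Y])
  let ?d = "\<lambda>i j. a $ i * (G (Y t) $ i $ j * V t $ j) + (dG i j * V t $ j + a $ j * G (Y t) $ i $ j) * V t $ i"
  have "((\<lambda>s. (\<Sum>i\<in>UNIV. \<Sum>j\<in>UNIV. V s $ i * (G (Y s) $ i $ j * V s $ j)) / 2 + u (Y s)) has_real_derivative
      (\<Sum>i\<in>UNIV. \<Sum>j\<in>UNIV. ?d i j) / 2 + (\<Sum>k\<in>UNIV. partial k u (Y t) * V t $ k)) (at t within J)"
    by (intro DERIV_add DERIV_cdivide DERIV_sum DERIV_mult Vi Gij chain_rule_partial[OF u Y])
  moreover have "(\<lambda>s. energy G u (Y s) (V s)) = (\<lambda>s. (\<Sum>i\<in>UNIV. \<Sum>j\<in>UNIV. V s $ i * (G (Y s) $ i $ j * V s $ j)) / 2 + u (Y s))"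
    by (simp add: energy_def inner_vec_def matrix_vector_mult_def sum_distrib_left)
  moreover have "(\<Sum>i\<in>UNIV. \<Sum>j\<in>UNIV. ?d i j) / 2 + (\<Sum>k\<in>UNIV. partial k u (Y t) * V t $ k) = 0"
  proof -
    let ?A = "G (Y t)" and ?v = "V t"
    have "a \<bullet> (?A *v ?v) = (?A *v a) \<bullet> ?v"
      by (metis dot_lmul_matrix sym transpose_matrix_vector)
    then have s: "a \<bullet> (?A *v ?v) = ?v \<bullet> (?A *v a)" by (simp add: inner_commute)
    have "(\<Sum>i\<in>UNIV. \<Sum>j\<in>UNIV. ?d i j)
        = a \<bullet> (?A *v ?v) + ?v \<bullet> (?A *v a) + (\<Sum>i\<in>UNIV. \<Sum>j\<in>UNIV. ?v $ i * dG i j * ?v $ j)"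
      by (simp add: inner_vec_def matrix_vector_mult_def sum_distrib_left sum.distrib[symmetric] algebra_simps)
    also have "\<dots> = 2 * (?v \<bullet> (?A *v a)) + 2 * (?v \<bullet> christoffel_form G (Y t) ?v)"
      unfolding s inner_christoffel_form dG_def by simp
    also have "?v \<bullet> (?A *v a) = - (?v \<bullet> (\<chi> i. partial i u (Y t))) - ?v \<bullet> christoffel_form G (Y t) ?v"
      unfolding eq by (simp add: inner_add_right inner_diff_right inner_contract_d)
    finally show ?thesis by (simp add: inner_vec_def mult.commute)
  qed
  ultimately show ?thesis by simp
qed

section \<open>Orders of magnitude on the zero energy level\<close>

lemma norm_le_card_mult:
  fixes x :: "real^'n::finite"
  assumes "\<And>i. \<bar>x $ i\<bar> \<le> b"
  shows "norm x \<le> real CARD('n) * b"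
proof -
  have "norm x \<le> (\<Sum>i\<in>UNIV. \<bar>x $ i\<bar>)" by (rule norm_le_l1_cart)
  also have "\<dots> \<le> (\<Sum>i\<in>(UNIV::'n set). b)" by (intro sum_mono assms)
  finally show ?thesis by simp
qed

text \<open>As \<open>A\<close> is close to the identity, \<open>a\<close> has the order r^(l-1) of
  \<open>A *v a\<close>. Replacing \<open>A *v a\<close> by \<open>a\<close> then costs a further
  factor r, which is the order r^l of the remaining errors.\<close>

lemma acceleration_estimate:
  fixes A :: "real^'n::finite^'n" and a g k c d :: "real^'n"
  assumes eq: "A *v a = - (g + k + c)" and A: "\<And>x. norm (A *v x - x) \<le> C1 * r * norm x"
    and half: "C1 * r \<le> 1 / 2" and r: "0 \<le> r" "r \<le> 1" and l: "l \<ge> 1"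
    and g: "norm (g - d) \<le> C2 * r ^ l" and d: "norm d \<le> C3 * r ^ (l - 1)"
    and k: "norm k \<le> C4 * r ^ l" and c: "norm c \<le> C5 * r ^ l"
    and pos: "C1 \<ge> 0" "C2 \<ge> 0" "C3 \<ge> 0" "C4 \<ge> 0" "C5 \<ge> 0"
  shows "norm (a + d) \<le> (2 * C1 * (C2 + C3 + C4 + C5) + (C2 + C4 + C5)) * r ^ l"
proof -
  have rl: "r ^ l \<le> r ^ (l - 1)" using r by (intro power_decreasing) auto
  have rr: "r ^ l = r * r ^ (l - 1)" using l by (cases l) auto
  have "norm (g + k + c) \<le> norm (g - d) + norm d + norm k + norm c"
    using norm_triangle_ineq[of "g - d" d] norm_triangle_ineq[of g k] norm_triangle_ineq[of "g + k" c]
    by simp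
  also have "\<dots> \<le> C2 * r ^ (l - 1) + C3 * r ^ (l - 1) + C4 * r ^ (l - 1) + C5 * r ^ (l - 1)"
    using g d k c mult_left_mono[OF rl pos(2)] mult_left_mono[OF rl pos(4)] mult_left_mono[OF rl pos(5)]
    by simp
  finally have z: "norm (g + k + c) \<le> (C2 + C3 + C4 + C5) * r ^ (l - 1)" by (simp add: algebra_simps)
  \<comment> \<open>The second term is at most half of \<open>norm a\<close> and is absorbed on the
    left.\<close>
  have "norm a \<le> norm (A *v a) + norm (A *v a - a)"
    by (metis add_diff_cancel_left' diff_diff_eq2 norm_triangle_ineq4 add.commute)
  also have "\<dots> \<le> norm (g + k + c) + 1 / 2 * norm a"
    unfolding eq norm_minus_cancel
    using A[of a] mult_right_mono[OF half, of "norm a"] by (simp add: eq)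
  finally have na: "norm a \<le> 2 * norm (g + k + c)" by simp
  have "norm (A *v a - a) \<le> C1 * r * (2 * ((C2 + C3 + C4 + C5) * r ^ (l - 1)))"
    by (rule order_trans[OF A mult_left_mono]) (use na z pos r in auto)
  also have "\<dots> = 2 * C1 * (C2 + C3 + C4 + C5) * r ^ l" by (simp add: rr)
  finally have 1: "norm (A *v a - a) \<le> 2 * C1 * (C2 + C3 + C4 + C5) * r ^ l" .
  have "a + d = - (A *v a - a) - (g - d) - k - c" unfolding eq by simp
  also have "norm \<dots> \<le> norm (A *v a - a) + norm (g - d) + norm k + norm c"
    using norm_triangle_ineq4[of "- (A *v a - a)" "g - d"] norm_triangle_ineq4[of "- (A *v a - a) - (g - d)" k]
      norm_triangle_ineq4[of "- (A *v a - a) - (g - d) - k" c] by (simp only: norm_minus_cancel)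
  finally show ?thesis using 1 g k c by (simp add: distrib_right)
qed

text \<open>Both factors are known through their squares, so each product is bounded by a sum of
  squares; no half-integer powers arise.\<close>

lemma contract_d_bound:
  fixes m :: "real^'n::finite \<Rightarrow> real^'n"
  assumes m: "\<And>i j. (partial j (\<lambda>z. m z $ i) y)\<^sup>2 \<le> b" and v: "(norm v)\<^sup>2 \<le> b'"
  shows "norm (contract_d m y v) \<le> real CARD('n) * (real CARD('n) * (2 * (b + b')))"
proof (rule norm_le_card_mult)
  fix i
  have p: "\<bar>v $ j * partial k (\<lambda>z. m z $ i') y\<bar> \<le> b + b'" for j k i'
  proof -
    have "(v $ j)\<^sup>2 \<le> (norm v)\<^sup>2" by (metis component_le_norm_cart abs_ge_zero power2_abs power_mono)
    moreover have "\<bar>s * t\<bar> \<le> s\<^sup>2 + t\<^sup>2" for s t :: real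
    proof -
      have "2 * (\<bar>s\<bar> * \<bar>t\<bar>) \<le> s\<^sup>2 + t\<^sup>2" using sum_squares_bound[of "\<bar>s\<bar>" "\<bar>t\<bar>"] by simp
      moreover have "0 \<le> \<bar>s\<bar> * \<bar>t\<bar>" by simp
      ultimately show ?thesis unfolding abs_mult by linarith
    qed
    then have "\<bar>v $ j * partial k (\<lambda>z. m z $ i') y\<bar> \<le> (v $ j)\<^sup>2 + (partial k (\<lambda>z. m z $ i') y)\<^sup>2" .
    ultimately show ?thesis using m[of k i'] v by linarith
  qed
  have "\<bar>v $ j * (partial j (\<lambda>z. m z $ i) y - partial i (\<lambda>z. m z $ j) y)\<bar> \<le> 2 * (b + b')" for j
    using p[of j j i] p[of j i j] by (simp add: right_diff_distrib)
  then have "(\<Sum>j\<in>UNIV. \<bar>v $ j * (partial j (\<lambda>z. m z $ i) y - partial i (\<lambda>z. m z $ j) y)\<bar>)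
      \<le> (\<Sum>j\<in>(UNIV::'n set). 2 * (b + b'))"
    by (intro sum_mono)
  then show "\<bar>contract_d m y v $ i\<bar> \<le> real CARD('n) * (2 * (b + b'))"
    unfolding contract_d_def vec_lambda_beta sum_constant by (rule order_trans[OF sum_abs])
qed

lemma christoffel_form_bound:
  fixes G :: "real^'n::finite \<Rightarrow> real^'n^'n"
  assumes G: "\<And>i j k. \<bar>partial k (\<lambda>z. G z $ i $ j) y\<bar> \<le> C" and v: "(norm v)\<^sup>2 \<le> b"
  shows "norm (christoffel_form G y v) \<le> real CARD('n) * (real CARD('n) * (real CARD('n) * (3 * C * b)))"
proof (rule norm_le_card_mult)
  fix l
  define S where "S i j = partial i (\<lambda>z. G z $ j $ l) y + partial j (\<lambda>z. G z $ i $ l) y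
    - partial l (\<lambda>z. G z $ i $ j) y" for i j
  have C: "C \<ge> 0" using G order_trans[OF abs_ge_zero] by blast
  have b: "b \<ge> 0" using v by (meson order_trans zero_le_power2)
  have "\<bar>S i j * v $ i * v $ j\<bar> \<le> 3 * C * b" for i j
  proof -
    have "\<bar>S i j\<bar> \<le> 3 * C" using G[of i j l] G[of j i l] G[of l i j] by (simp add: S_def)
    moreover have "\<bar>v $ i * v $ j\<bar> \<le> norm v * norm v"
      unfolding abs_mult by (intro mult_mono component_le_norm_cart) auto
    then have "\<bar>v $ i * v $ j\<bar> \<le> b" using v by (simp add: power2_eq_square)
    ultimately have "\<bar>S i j\<bar> * \<bar>v $ i * v $ j\<bar> \<le> 3 * C * b" using C by (intro mult_mono) auto
    then show ?thesis by (simp add: abs_mult mult.assoc)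
  qed
  then have "(\<Sum>i\<in>UNIV. \<Sum>j\<in>UNIV. \<bar>S i j * v $ i * v $ j\<bar>) \<le> (\<Sum>i\<in>(UNIV::'n set). \<Sum>j\<in>(UNIV::'n set). 3 * C * b)"
    by (intro sum_mono)
  moreover have "\<bar>\<Sum>i\<in>UNIV. \<Sum>j\<in>UNIV. S i j * v $ i * v $ j\<bar> \<le> (\<Sum>i\<in>UNIV. \<Sum>j\<in>UNIV. \<bar>S i j * v $ i * v $ j\<bar>)"
    by (rule order_trans[OF sum_abs sum_mono]) (rule sum_abs)
  moreover have "\<bar>christoffel_form G y v $ l\<bar> = \<bar>\<Sum>i\<in>UNIV. \<Sum>j\<in>UNIV. S i j * v $ i * v $ j\<bar> / 2"
    by (simp add: christoffel_form_def S_def)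
  ultimately have "\<bar>christoffel_form G y v $ l\<bar> \<le> (\<Sum>i\<in>(UNIV::'n set). \<Sum>j\<in>(UNIV::'n set). 3 * C * b)"
    by linarith
  then show "\<bar>christoffel_form G y v $ l\<bar> \<le> real CARD('n) * (real CARD('n) * (3 * C * b))" by simp
qed

lemma near_identity:
  fixes A :: "real^'n::finite^'n"
  assumes "\<And>i j. \<bar>A $ i $ j - (mat 1 :: real^'n^'n) $ i $ j\<bar> \<le> c"
  shows "norm (A *v x - x) \<le> real CARD('n) * (real CARD('n) * c) * norm x"
proof -
  have "norm ((A - mat 1) *v x) \<le> real CARD('n) * (real CARD('n) * (c * norm x))"
  proof (rule norm_le_card_mult)
    fix i
    have "\<bar>((A - mat 1) *v x) $ i\<bar> \<le> (\<Sum>j\<in>UNIV. \<bar>(A - mat 1) $ i $ j * x $ j\<bar>)"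
      unfolding matrix_vector_mult_def vec_lambda_beta by (rule sum_abs)
    also have "\<dots> \<le> (\<Sum>j\<in>(UNIV::'n set). c * norm x)"
    proof (rule sum_mono)
      fix j
      show "\<bar>(A - mat 1) $ i $ j * x $ j\<bar> \<le> c * norm x"
        unfolding abs_mult using assms[of i j]
        by (intro mult_mono component_le_norm_cart) auto
    qed
    finally show "\<bar>((A - mat 1) *v x) $ i\<bar> \<le> real CARD('n) * (c * norm x)" by simp
  qed
  then show ?thesis by (simp add: matrix_vector_mult_diff_rdistrib mult_ac)
qed

text \<open>Zero energy ties the velocity to the position: \<open>v \<bullet> v\<close> is
  \<open>- 2 * u y\<close> up to a factor near 1, hence of order l. The Christoffel term, quadratic
  in \<open>v\<close>, and the magnetic term then have order l too, and at order l - 1 the force is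
  \<open>- D y\<close>.\<close>

lemma zero_energy_estimates:
  fixes G :: "real^'n::finite \<Rightarrow> real^'n^'n"
  assumes G: "\<And>i j. real_analytic_at (\<lambda>y. G y $ i $ j) 0" and G0: "G 0 = mat 1"
    and an: "real_analytic_at u 0" and nz: "\<not> (\<forall>\<^sub>F y in nhds 0. u y = 0)"
    and u0: "u 0 = 0" and du: "frechet_derivative u (at 0) = (\<lambda>_. 0)"
    and m: "\<And>i. real_analytic_at (\<lambda>y. m y $ i) 0" and weak: "weak_magnetism u m"
    and D: "\<And>i. real_polynomial_function (\<lambda>y. D y $ i)"
      "\<And>y. (first_jet u has_derivative (\<lambda>h. D y \<bullet> h)) (at y)"
  shows "\<exists>\<epsilon>>0. \<exists>K>0. \<forall>y. norm y < \<epsilon> \<longrightarrow> norm y < 1 \<and> u differentiable (at y) \<and>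
    (\<forall>i j. (\<lambda>z. G z $ i $ j) differentiable (at y)) \<and>
    (\<forall>v. energy G u y v = 0 \<longrightarrow> (norm v)\<^sup>2 \<le> K * norm y ^ first_degree u \<and>
      \<bar>(v \<bullet> v) / 2 + first_jet u y\<bar> \<le> K * norm y ^ Suc (first_degree u) \<and>
      (\<forall>a. y \<noteq> 0 \<longrightarrow> G y *v a = - ((\<chi> i. partial i u y) + contract_d m y v + christoffel_form G y v) \<longrightarrow>
        norm (a + D y) \<le> K * norm y ^ first_degree u))"
proof -
  define l where "l = first_degree u"
  have l: "l \<ge> 1" using first_degree_ge_2[OF an nz u0 du] by (simp add: l_def)
  have hom: "first_jet u (t *\<^sub>R y) = t ^ l * first_jet u y" for t y
    unfolding l_def first_jet_def by (rule real_analytic_at_taylor(2)[OF an])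
  obtain CG where CG: "CG \<ge> 0" and evG: "\<forall>\<^sub>F y in nhds 0. \<forall>i j. (\<lambda>z. G z $ i $ j) differentiable (at y) \<and>
    \<bar>G y $ i $ j - G 0 $ i $ j\<bar> \<le> CG * norm y \<and> (\<forall>k. \<bar>partial k (\<lambda>z. G z $ i $ j) y\<bar> \<le> CG)"
    using metric_estimate[OF G] by blast
  obtain Cu where Cu: "Cu \<ge> 0" and evu: "\<forall>\<^sub>F y in nhds 0. u differentiable (at y) \<and>
    \<bar>u y - first_jet u y\<bar> \<le> Cu * norm y ^ Suc l \<and> (\<forall>i. \<bar>partial i u y - D y $ i\<bar> \<le> Cu * norm y ^ l)"
    using potential_estimate[OF an nz D(2)] unfolding l_def by blast
  obtain Cm where Cm: "Cm \<ge> 0" and evm: "\<forall>\<^sub>F y in nhds 0. y \<noteq> 0 \<longrightarrow>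
    (\<forall>i j. (partial j (\<lambda>z. m z $ i) y)\<^sup>2 \<le> Cm * norm y ^ l)"
    using magnetic_estimate[OF m weak] unfolding l_def by blast
  obtain B where B: "B \<ge> 0" "\<And>y. \<bar>first_jet u y\<bar> \<le> B * norm y ^ l"
    "\<And>y. y \<noteq> 0 \<Longrightarrow> norm (D y) \<le> B * norm y ^ (l - 1)"
    using homogeneous_bounds[OF hom D(2) l polynomial_field_continuous[OF D(1)]] by blast
  let ?n = "real CARD('n)"
  define C1 where "C1 = ?n * (?n * CG)"
  have C1: "C1 \<ge> 0" using CG by (simp add: C1_def)
  \<comment> \<open>In \<open>v \<bullet> v = - 2 * u y - v \<bullet> (G y *v v - v)\<close> the
    last term is at most half of \<open>v \<bullet> v\<close>, so the squared norm of
    \<open>v\<close> is at most 4 times \<open>\<bar>u y\<bar>\<close>.\<close>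
  define Kv where "Kv = 4 * (B + Cu)"
  have Kv: "Kv \<ge> 0" using B Cu by (simp add: Kv_def)
  define C2 C4 C5 where "C2 = ?n * Cu" and "C4 = ?n * (?n * (2 * (Cm + Kv)))"
    and "C5 = ?n * (?n * (?n * (3 * CG * Kv)))"
  have Cs: "C2 \<ge> 0" "C4 \<ge> 0" "C5 \<ge> 0" using Cu Cm Kv CG by (auto simp: C2_def C4_def C5_def)
  define K0 where "K0 = 2 * C1 * (C2 + B + C4 + C5) + (C2 + C4 + C5)"
  have K0: "K0 \<ge> 0" using C1 Cs B by (simp add: K0_def)
  define K where "K = Kv + (C1 * Kv / 2 + Cu) + K0 + 1"
  have K: "K > 0" "Kv \<le> K" "C1 * Kv / 2 + Cu \<le> K" "K0 \<le> K" using Kv C1 Cu K0 by (auto simp: K_def add_nonneg_pos)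
  have "\<forall>\<^sub>F y in nhds 0. y \<in> ball (0::real^'n) (min 1 (1 / (2 * (C1 + 1))))"
    using C1 by (intro eventually_nhds_in_open) auto
  with evG evu evm have "\<forall>\<^sub>F y in nhds 0. norm y < 1 \<and> u differentiable (at y) \<and>
    (\<forall>i j. (\<lambda>z. G z $ i $ j) differentiable (at y)) \<and>
    (\<forall>v. energy G u y v = 0 \<longrightarrow> (norm v)\<^sup>2 \<le> K * norm y ^ l \<and>
      \<bar>(v \<bullet> v) / 2 + first_jet u y\<bar> \<le> K * norm y ^ Suc l \<and>
      (\<forall>a. y \<noteq> 0 \<longrightarrow> G y *v a = - ((\<chi> i. partial i u y) + contract_d m y v + christoffel_form G y v) \<longrightarrow>
        norm (a + D y) \<le> K * norm y ^ l))"
  proof eventually_elim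
    case (elim y)
    have y1: "norm y < 1" using elim(4) by simp
    \<comment> \<open>This is the reason for the radius \<open>1 / (2 * (C1 + 1))\<close>, in which
      the summand 1 covers \<open>C1 = 0\<close>.\<close>
    have half: "C1 * norm y \<le> 1 / 2"
    proof -
      have "norm y * (2 * (C1 + 1)) < 1" using elim(4) C1 by (simp add: field_simps)
      then have "norm y * 2 + 2 * (C1 * norm y) < 1" by (simp add: algebra_simps)
      then show ?thesis using norm_ge_zero[of y] by linarith
    qed
    have near: "norm (G y *v x - x) \<le> C1 * norm y * norm x" for x
      using near_identity[of "G y" "CG * norm y" x] elim(1) G0 by (simp add: C1_def mult_ac)
    have uP: "\<bar>u y - first_jet u y\<bar> \<le> Cu * norm y ^ Suc l" using elim(2) by blast
    show ?case
    proof (intro conjI allI impI)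
      fix v assume E: "energy G u y v = 0"
      have w: "\<bar>v \<bullet> (G y *v v - v)\<bar> \<le> C1 * norm y * (norm v)\<^sup>2"
      proof -
        have "\<bar>v \<bullet> (G y *v v - v)\<bar> \<le> norm v * (C1 * norm y * norm v)"
          by (rule order_trans[OF Cauchy_Schwarz_ineq2 mult_left_mono[OF near]]) simp
        then show ?thesis by (simp add: power2_eq_square mult_ac)
      qed
      have vG: "v \<bullet> (G y *v v) = - 2 * u y" using E by (simp add: energy_def)
      have vv: "v \<bullet> v = - 2 * u y - v \<bullet> (G y *v v - v)" using vG by (simp add: inner_diff_right)
      have "\<bar>u y\<bar> \<le> (B + Cu) * norm y ^ l"
      proof -
        have "Cu * norm y ^ Suc l \<le> Cu * norm y ^ l"
          using y1 Cu by (intro mult_left_mono power_decreasing) auto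
        then have "\<bar>u y - first_jet u y\<bar> \<le> Cu * norm y ^ l" using uP by linarith
        moreover have "\<bar>u y\<bar> \<le> \<bar>first_jet u y\<bar> + \<bar>u y - first_jet u y\<bar>" by linarith
        ultimately show ?thesis using B(2)[of y] by (simp add: distrib_right)
      qed
      moreover have "C1 * norm y * (norm v)\<^sup>2 \<le> 1 / 2 * (norm v)\<^sup>2"
        by (intro mult_right_mono half) simp
      moreover have "(norm v)\<^sup>2 = v \<bullet> v" by (rule power2_norm_eq_inner)
      ultimately have "(norm v)\<^sup>2 \<le> 4 * ((B + Cu) * norm y ^ l)"
        using w vv by linarith
      then have v2: "(norm v)\<^sup>2 \<le> Kv * norm y ^ l" unfolding Kv_def by (simp only: mult.assoc)
      have KK: "Kv * norm y ^ l \<le> K * norm y ^ l" using K by (intro mult_right_mono) auto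
      then show "(norm v)\<^sup>2 \<le> K * norm y ^ l" using v2 by linarith
      have "(v \<bullet> v) / 2 + first_jet u y = - (v \<bullet> (G y *v v - v)) / 2 - (u y - first_jet u y)"
        using vv by simp
      moreover have "C1 * norm y * (norm v)\<^sup>2 \<le> C1 * norm y * (Kv * norm y ^ l)"
        using C1 by (intro mult_left_mono v2) auto
      ultimately have "\<bar>(v \<bullet> v) / 2 + first_jet u y\<bar> \<le> C1 * norm y * (Kv * norm y ^ l) / 2 + Cu * norm y ^ Suc l"
        using w uP by linarith
      also have "\<dots> = (C1 * Kv / 2 + Cu) * norm y ^ Suc l" by (simp add: algebra_simps)
      also have "\<dots> \<le> K * norm y ^ Suc l" using K by (intro mult_right_mono) auto
      finally show "\<bar>(v \<bullet> v) / 2 + first_jet u y\<bar> \<le> K * norm y ^ Suc l" .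
      fix a assume y0: "y \<noteq> 0"
        and eq: "G y *v a = - ((\<chi> i. partial i u y) + contract_d m y v + christoffel_form G y v)"
      have "norm (a + D y) \<le> K0 * norm y ^ l"
        unfolding K0_def
      proof (rule acceleration_estimate[OF eq near half])
        have "norm ((\<chi> i. partial i u y) - D y) \<le> ?n * (Cu * norm y ^ l)"
          by (rule norm_le_card_mult) (use elim(2) in simp)
        then show "norm ((\<chi> i. partial i u y) - D y) \<le> C2 * norm y ^ l" by (simp add: C2_def mult.assoc)
        show "norm (D y) \<le> B * norm y ^ (l - 1)" by (rule B(3)[OF y0])
        have "norm (contract_d m y v) \<le> ?n * (?n * (2 * (Cm * norm y ^ l + Kv * norm y ^ l)))"
          by (rule contract_d_bound[OF _ v2]) (use elim(3) y0 in blast)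
        then show "norm (contract_d m y v) \<le> C4 * norm y ^ l" by (simp add: C4_def algebra_simps)
        have "norm (christoffel_form G y v) \<le> ?n * (?n * (?n * (3 * CG * (Kv * norm y ^ l))))"
          by (rule christoffel_form_bound[OF _ v2]) (use elim(1) in blast)
        then show "norm (christoffel_form G y v) \<le> C5 * norm y ^ l" by (simp add: C5_def mult.assoc)
      qed (use y1 l C1 Cs B in auto)
      also have "\<dots> \<le> K * norm y ^ l" using K by (intro mult_right_mono) auto
      finally show "norm (a + D y) \<le> K * norm y ^ l" .
    qed (use y1 elim in auto)
  qed
  then obtain \<epsilon> where "\<epsilon> > 0" "\<forall>y. dist y 0 < \<epsilon> \<longrightarrow> (norm y < 1 \<and> u differentiable (at y) \<and>
    (\<forall>i j. (\<lambda>z. G z $ i $ j) differentiable (at y)) \<and>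
    (\<forall>v. energy G u y v = 0 \<longrightarrow> (norm v)\<^sup>2 \<le> K * norm y ^ l \<and>
      \<bar>(v \<bullet> v) / 2 + first_jet u y\<bar> \<le> K * norm y ^ Suc l \<and>
      (\<forall>a. y \<noteq> 0 \<longrightarrow> G y *v a = - ((\<chi> i. partial i u y) + contract_d m y v + christoffel_form G y v) \<longrightarrow>
        norm (a + D y) \<le> K * norm y ^ l)))"
    unfolding eventually_nhds_metric by blast
  then show ?thesis using K(1) unfolding l_def[symmetric] dist_0_norm[symmetric] dist_commute[of 0] by blast
qed

section \<open>Limit directions\<close>

text \<open>The closures of the tails of the direction curve are nested, compact and connected, so
  their intersection \<open>\<Omega>\<close> is non-empty and connected. It contains the omega-limit
  set, and continuous functions that converge along the curve are constant on it.\<close>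

lemma asymptotic_to_component:
  fixes y :: "real \<Rightarrow> real^'n::finite" and P :: "real^'n \<Rightarrow> real" and H :: "real^'n \<Rightarrow> real^'n"
  assumes cont: "continuous_on {t0..} y" and nz: "\<And>t. t \<ge> t0 \<Longrightarrow> y t \<noteq> 0"
    and P: "continuous_on UNIV P" "((\<lambda>t. P (y t /\<^sub>R norm (y t))) \<longlongrightarrow> L) at_top"
    and H: "continuous_on UNIV H" "((\<lambda>t. H (y t /\<^sub>R norm (y t))) \<longlongrightarrow> 0) at_top"
    and S: "\<And>z. norm z = 1 \<Longrightarrow> H z = 0 \<Longrightarrow> P z = L \<Longrightarrow> z \<in> S"
  shows "\<exists>\<Sigma>\<in>components S. asymptotic_to y \<Sigma>"
proof -
  define q where "q t = y t /\<^sub>R norm (y t)" for t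
  define F where "F n = closure (q ` {t0 + real n..})" for n :: nat
  have q1: "norm (q t) = 1" if "t \<ge> t0" for t using nz[OF that] by (simp add: q_def)
  have contq: "continuous_on {t0..} q"
    unfolding q_def[abs_def] using nz by (intro continuous_intros cont) auto
  have "bounded (q ` {t0 + real n..})" for n
    using q1 by (intro boundedI[of _ 1]) auto
  then have comp: "compact (F n)" for n by (simp add: F_def)
  have conn: "connected (F n)" for n
    unfolding F_def
    by (intro connected_imp_connected_closure connected_continuous_image continuous_on_subset[OF contq]
        convex_connected) auto
  have nest: "F n \<subseteq> F m" if "m \<le> n" for m n
    unfolding F_def using that by (intro closure_mono image_mono) auto
  define \<Omega> where "\<Omega> = \<Inter> (range F)"
  have "connected \<Omega>" unfolding \<Omega>_def by (rule connected_nest[OF comp conn nest])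
  have "\<Omega> \<noteq> {}" unfolding \<Omega>_def by (rule compact_nest[OF comp _ nest]) (auto simp: F_def)
  then obtain z0 where "z0 \<in> \<Omega>" by blast
  \<comment> \<open>On a whole tail \<open>f\<close> is within \<open>e\<close> of \<open>c\<close>,
    hence on its closure, hence on \<open>\<Omega>\<close>. This is applied to the norm, to
    \<open>P\<close> and to \<open>H\<close>.\<close>
  have val: "f z = c" if f: "continuous_on UNIV f" "((\<lambda>t. f (q t)) \<longlongrightarrow> c) at_top" and z: "z \<in> \<Omega>"
    for f :: "real^'n \<Rightarrow> 'c::metric_space" and c z
  proof -
    have "dist (f z) c \<le> 0 + e" if e: "e > 0" for e
    proof -
      obtain N where N: "\<And>t. t \<ge> N \<Longrightarrow> dist (f (q t)) c < e"
        using tendstoD[OF f(2) e] unfolding eventually_at_top_linorder by blast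
      obtain n :: nat where n: "N - t0 \<le> real n" using real_arch_simple by blast
      have "closed {z. dist (f z) c \<le> e}"
        by (intro closed_Collect_le continuous_intros f(1))
      moreover have "q ` {t0 + real n..} \<subseteq> {z. dist (f z) c \<le> e}"
      proof (rule image_subsetI)
        fix t assume "t \<in> {t0 + real n..}"
        then have "t \<ge> N" using n by simp
        then show "q t \<in> {z. dist (f z) c \<le> e}" using N[of t] by simp
      qed
      ultimately have "F n \<subseteq> {z. dist (f z) c \<le> e}" unfolding F_def by (rule closure_minimal[rotated])
      then show ?thesis using z by (auto simp: \<Omega>_def)
    qed
    then have "dist (f z) c \<le> 0" by (rule field_le_epsilon)
    then show ?thesis by simp
  qed
  have sub: "\<Omega> \<subseteq> S"
  proof
    fix z assume z: "z \<in> \<Omega>"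
    have "((\<lambda>t. norm (q t)) \<longlongrightarrow> 1) at_top"
      by (rule tendsto_eventually) (use q1 in \<open>auto simp: eventually_at_top_linorder\<close>)
    then have "norm z = 1" by (intro val[OF _ _ z] continuous_intros)
    then show "z \<in> S" using val[OF P[folded q_def] z] val[OF H[folded q_def] z] by (intro S)
  qed
  let ?\<Sigma> = "connected_component_set S z0"
  have "?\<Sigma> \<in> components S" using sub \<open>z0 \<in> \<Omega>\<close> by (intro componentsI) auto
  moreover have "\<Omega> \<subseteq> ?\<Sigma>"
    by (rule connected_component_maximal[OF \<open>z0 \<in> \<Omega>\<close> \<open>connected \<Omega>\<close> sub])
  moreover have "omega_limit q \<subseteq> \<Omega>"
  proof
    fix z assume "z \<in> omega_limit q"
    then obtain s where s: "filterlim s at_top sequentially" "(\<lambda>k. q (s k)) \<longlonglongrightarrow> z"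
      unfolding omega_limit_def by blast
    have "z \<in> F n" for n
    proof (rule Lim_in_closed_set[OF _ _ _ s(2)])
      show "closed (F n)" by (simp add: F_def)
      have "\<forall>\<^sub>F k in sequentially. t0 + real n \<le> s k"
        using s(1) by (simp add: filterlim_at_top)
      then show "\<forall>\<^sub>F k in sequentially. q (s k) \<in> F n"
        by eventually_elim (auto simp: F_def intro!: subsetD[OF closure_subset])
    qed simp
    then show "z \<in> \<Omega>" by (simp add: \<Omega>_def)
  qed
  ultimately show ?thesis
    unfolding asymptotic_to_def q_def[abs_def] by blast
qed

text \<open>Gronwall's argument in both time directions: \<open>\<phi> t * exp (- K * t)\<close>
  does not increase and \<open>\<phi> t * exp (K * t)\<close> does not decrease, so a zero spreads
  to later and to earlier times.\<close>

lemma vanishes_on_interval: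
  fixes \<phi> :: "real \<Rightarrow> real"
  assumes J: "is_interval J" and \<phi>': "\<And>t. t \<in> J \<Longrightarrow> (\<phi> has_real_derivative \<phi>' t) (at t within J)"
    and bd: "\<And>t. t \<in> J \<Longrightarrow> \<bar>\<phi>' t\<bar> \<le> K * \<phi> t" and nn: "\<And>t. t \<in> J \<Longrightarrow> \<phi> t \<ge> 0"
    and s: "s \<in> J" "\<phi> s = 0" and t: "t \<in> J"
  shows "\<phi> t = 0"
proof -
  have cont: "continuous_on J \<phi>" using \<phi>' by (rule DERIV_continuous_on)
  have zJ: "z \<in> J" if "a \<le> z" "z \<le> b" "a \<in> J" "b \<in> J" for a b z
    using mem_is_interval_1_I[OF J that(3,4,1,2)] .
  have der: "((\<lambda>z. \<phi> z * exp (k * z)) has_real_derivative (\<phi>' z + k * \<phi> z) * exp (k * z)) (at z)"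
    if z: "a < z" "z < b" and ab: "a \<in> J" "b \<in> J" for a b z k
  proof -
    have sub: "{a<..<b} \<subseteq> J" using zJ[OF _ _ ab] by (simp add: subset_iff)
    then have "z \<in> J" using z by (simp add: subset_iff)
    \<comment> \<open>At endpoints of \<open>J\<close> the derivative is one-sided; the monotonicity
      argument takes derivatives at interior points and continuity at the ends.\<close>
    have "z \<in> interior J" by (rule interiorI[OF open_greaterThanLessThan _ sub]) (use z in simp)
    then have "(\<phi> has_real_derivative \<phi>' z) (at z)"
      using \<phi>'[OF \<open>z \<in> J\<close>] by (simp only: at_within_interior)
    moreover have "((\<lambda>z. exp (k * z)) has_real_derivative exp (k * z) * k) (at z)"
      by (rule DERIV_chain2[OF DERIV_exp]) (use DERIV_cmult_Id in blast)
    ultimately have "((\<lambda>z. \<phi> z * exp (k * z)) has_real_derivative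
        \<phi>' z * exp (k * z) + exp (k * z) * k * \<phi> z) (at z)"
      by (rule DERIV_mult)
    moreover have "\<phi>' z * exp (k * z) + exp (k * z) * k * \<phi> z = (\<phi>' z + k * \<phi> z) * exp (k * z)"
      by algebra
    ultimately show ?thesis by (simp only:)
  qed
  have c: "continuous_on {a..b} (\<lambda>z. \<phi> z * exp (k * z))" if "a \<in> J" "b \<in> J" for a b k
    by (intro continuous_intros continuous_on_subset[OF cont]) (simp add: subset_iff zJ[OF _ _ that])
  show ?thesis
  proof (cases "s \<le> t")
    case True
    have "\<phi> s * exp (- K * s) \<ge> \<phi> t * exp (- K * t)"
    proof (rule DERIV_nonpos_imp_decreasing_open[OF True])
      fix z assume z: "s < z" "z < t"
      have "\<phi>' z + - K * \<phi> z \<le> 0" using bd[OF zJ[of s z t]] z s t by (simp add: abs_le_iff)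
      then have "(\<phi>' z + - K * \<phi> z) * exp (- K * z) \<le> 0" by (simp add: mult_le_0_iff)
      then show "\<exists>d. ((\<lambda>z. \<phi> z * exp (- K * z)) has_real_derivative d) (at z) \<and> d \<le> 0"
        using der[OF z s(1) t] by blast
    qed (rule c[OF s(1) t])
    then have "\<phi> t \<le> 0" using s by (simp add: mult_le_0_iff)
    then show ?thesis using nn[OF t] by simp
  next
    case False
    have "\<phi> t * exp (K * t) \<le> \<phi> s * exp (K * s)"
    proof (rule DERIV_nonneg_imp_increasing_open[of t s])
      fix z assume z: "t < z" "z < s"
      have "\<phi>' z + K * \<phi> z \<ge> 0" using bd[OF zJ[of t z s]] z s t by (simp add: abs_le_iff)
      then have "(\<phi>' z + K * \<phi> z) * exp (K * z) \<ge> 0" by simp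
      then show "\<exists>d. ((\<lambda>z. \<phi> z * exp (K * z)) has_real_derivative d) (at z) \<and> d \<ge> 0"
        using der[OF z t s(1)] by blast
    qed (use False in simp, rule c[OF t s(1)])
    then have "\<phi> t \<le> 0" using s by (simp add: mult_le_0_iff)
    then show ?thesis using nn[OF t] by simp
  qed
qed

lemma positive_definite_invertible:
  fixes A :: "real^'n::finite^'n"
  assumes "\<And>v. v \<noteq> 0 \<Longrightarrow> v \<bullet> (A *v v) > 0"
  shows "invertible A"
  unfolding invertible_left_inverse matrix_left_invertible_ker using assms by fastforce

theorem proposition1p5:
  fixes A :: "('a::{t2_space, second_countable_topology}, 'n::finite) chart set"
    and g :: "('a, 'n) chart \<Rightarrow> real^'n \<Rightarrow> real^'n^'n"
    and p :: 'a and W :: "'a set" and U :: "'a \<Rightarrow> real"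
    and \<mu> :: "('a, 'n) chart \<Rightarrow> real^'n \<Rightarrow> real^'n"
    and c :: "('a, 'n) chart"
    and T :: "real set" and x :: "real \<Rightarrow> 'a" and v :: "('a, 'n) chart \<Rightarrow> real \<Rightarrow> real^'n"
  assumes manifold: "analytic_riemannian_manifold A g"
    and chart: "c \<in> A" "p \<in> chart_dom c" "chart_map c p = 0" "g c 0 = mat 1"
    and nbhd: "open W" "p \<in> W"
    and U_analytic: "analytic_function_on A W U"
    and U_germ: "\<not> (\<forall>\<^sub>F q in nhds p. U q = 0)"
    and U_p: "U p = 0"
    and dU_p: "frechet_derivative (U \<circ> chart_inv c) (at 0) = (\<lambda>_. 0)"
    and \<mu>_analytic: "analytic_one_form_on A W \<mu>"
    and magnetism: "weak_magnetism (U \<circ> chart_inv c) (\<mu> c)"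
    and orbit: "is_orbit A g W \<mu> U T x v"
    and unbounded: "\<not> bdd_above T"
    and nonconstant: "\<not> x constant_on T"
    and convergence: "converges_to_rest A x v p"
  shows "\<exists>\<Sigma> \<in> components {q. sphere_critical_point (first_jet (U \<circ> chart_inv c)) q
                              \<and> first_jet (U \<circ> chart_inv c) q \<le> 0}.
           asymptotic_to (\<lambda>t. chart_map c (x t)) \<Sigma>"
proof -

  \<comment> \<open>The data of the manifold read in the chart\<close>
  define u where "u = U \<circ> chart_inv c"
  define G where "G = g c"
  define m where "m = \<mu> c"
  define Y where "Y = (\<lambda>t. chart_map c (x t))"
  define V where "V = v c"
  have ic: "is_chart c"
    using manifold chart(1) unfolding analytic_riemannian_manifold_def analytic_atlas_def by blast
  have dom: "open (chart_dom c)" and inj: "inj_on (chart_map c) (chart_dom c)"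
    and cmap: "continuous_on (chart_dom c) (chart_map c)"
    using ic unfolding is_chart_def homeomorphism_def by blast+
  have inv: "chart_inv c (chart_map c q) = q" if "q \<in> chart_dom c" for q
    using inv_into_f_f[OF inj that] by (simp add: chart_inv_def)
  have metric: "\<forall>i j. real_analytic_on (\<lambda>y. G y $ i $ j) (chart_map c ` chart_dom c)"
    "\<forall>y\<in>chart_map c ` chart_dom c. transpose (G y) = G y \<and> (\<forall>v. v \<noteq> 0 \<longrightarrow> v \<bullet> (G y *v v) > 0)"
    using manifold chart(1) unfolding analytic_riemannian_manifold_def analytic_metric_def G_def by blast+
  have zero: "0 \<in> chart_map c ` (chart_dom c \<inter> W)" "0 \<in> chart_map c ` chart_dom c"
    using chart nbhd by (metis IntI image_eqI, metis image_eqI)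
  have anG: "real_analytic_at (\<lambda>y. G y $ i $ j) 0" for i j
    using metric(1) zero(2) unfolding real_analytic_on_def by blast
  have an: "real_analytic_at u 0"
    using U_analytic chart(1) zero(1) unfolding analytic_function_on_def real_analytic_on_def u_def by blast
  have anm: "real_analytic_at (\<lambda>y. m y $ i) 0" for i
    using \<mu>_analytic chart(1) zero(1) unfolding analytic_one_form_on_def real_analytic_on_def m_def by blast
  have G0: "G 0 = mat 1" using chart(4) by (simp add: G_def)
  have inv0: "chart_inv c 0 = p" using inv[OF chart(2)] chart(3) by simp
  have u0: "u 0 = 0" using U_p inv0 by (simp add: u_def)
  have opre: "open (chart_dom c \<inter> chart_map c -` S)" if "open S" for S
    using continuous_on_open_vimage[OF dom, of "chart_map c"] cmap that by (metis Int_commute)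
  \<comment> \<open>The chart is a homeomorphism, so a neighbourhood of 0 on which \<open>u\<close>
    vanishes pulls back to a neighbourhood of \<open>p\<close> on which \<open>U\<close>
    vanishes.\<close>
  have nz: "\<not> (\<forall>\<^sub>F y in nhds 0. u y = 0)"
  proof
    assume "\<forall>\<^sub>F y in nhds 0. u y = 0"
    then obtain S where S: "open S" "0 \<in> S" "\<And>y. y \<in> S \<Longrightarrow> u y = 0" unfolding eventually_nhds by blast
    have "\<forall>q\<in>chart_dom c \<inter> chart_map c -` S. U q = 0"
    proof
      fix q assume q: "q \<in> chart_dom c \<inter> chart_map c -` S"
      then have "u (chart_map c q) = 0" by (intro S(3)) simp
      then show "U q = 0" using q inv[of q] by (simp add: u_def)
    qed
    moreover have "p \<in> chart_dom c \<inter> chart_map c -` S" using chart S by simp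
    ultimately have "\<forall>\<^sub>F q in nhds p. U q = 0"
      unfolding eventually_nhds using opre[OF S(1)] by blast
    with U_germ show False by blast
  qed
  define P where "P = first_jet u"
  define l where "l = first_degree u"
  have du: "frechet_derivative u (at 0) = (\<lambda>_. 0)" using dU_p by (simp add: u_def)
  have weak: "weak_magnetism u m" using magnetism by (simp add: u_def m_def)
  have l2: "l \<ge> 2" unfolding l_def by (rule first_degree_ge_2[OF an nz u0 du])
  have hom: "P (t *\<^sub>R y) = t ^ l * P y" for t y
    unfolding P_def l_def first_jet_def by (rule real_analytic_at_taylor(2)[OF an])
  have Ppol: "real_polynomial_function P"
    unfolding P_def first_jet_def by (rule real_analytic_at_taylor(1)[OF an])
  obtain D where D: "\<And>i. real_polynomial_function (\<lambda>y. D y $ i)"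
    "\<And>y. (P has_derivative (\<lambda>h. D y \<bullet> h)) (at y)"
    using real_polynomial_function_gradient[OF Ppol] by blast
  obtain \<epsilon> K where \<epsilon>: "\<epsilon> > 0" and K: "K > 0" and
    est: "\<forall>y. norm y < \<epsilon> \<longrightarrow> norm y < 1 \<and> u differentiable (at y) \<and>
    (\<forall>i j. (\<lambda>z. G z $ i $ j) differentiable (at y)) \<and>
    (\<forall>v. energy G u y v = 0 \<longrightarrow> (norm v)\<^sup>2 \<le> K * norm y ^ l \<and>
      \<bar>(v \<bullet> v) / 2 + P y\<bar> \<le> K * norm y ^ Suc l \<and>
      (\<forall>a. y \<noteq> 0 \<longrightarrow> G y *v a = - ((\<chi> i. partial i u y) + contract_d m y v + christoffel_form G y v) \<longrightarrow>
        norm (a + D y) \<le> K * norm y ^ l))"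
    using zero_energy_estimates[OF anG G0 an nz u0 du anm weak D(1) D(2)[unfolded P_def]]
    unfolding l_def P_def by blast

  \<comment> \<open>Equation of motion and energy while the orbit is near the rest point\<close>
  define N where "N = chart_dom c \<inter> chart_map c -` ball 0 \<epsilon>"
  have N: "open N" "p \<in> N" using opre[OF open_ball] chart \<epsilon> by (auto simp: N_def)
  have NY: "norm (Y t) < \<epsilon>" "x t \<in> chart_dom c" if "x t \<in> N" for t
    using that by (auto simp: N_def Y_def)
  have xp: "x t = p" if "x t \<in> N" "Y t = 0" for t
    using inv[OF NY(2)[OF that(1)]] that(2) inv0 by (simp add: Y_def)
  have T: "is_interval T" and contx: "continuous_on T x"
    using orbit unfolding is_orbit_def by blast+
  have Y': "(Y has_vector_derivative V t) (at t within T)" if "t \<in> T" "x t \<in> N" for t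
    using orbit chart(1) that(1) NY(2)[OF that(2)] unfolding is_orbit_def Y_def V_def by blast
  have V': "\<exists>a. (V has_vector_derivative a) (at t within T) \<and>
      G (Y t) *v a = - ((\<chi> i. partial i u (Y t)) + contract_d m (Y t) (V t) + christoffel_form G (Y t) (V t))"
    if t: "t \<in> T" "x t \<in> N" for t
  proof -
    obtain a where a: "(V has_vector_derivative a) (at t within T)"
      "covariant_acceleration G (Y t) (V t) a = - gradient G u (Y t) - riesz G (Y t) (contract_d m (Y t) (V t))"
      using orbit chart(1) t(1) NY(2)[OF t(2)]
      unfolding is_orbit_def Y_def V_def G_def u_def m_def Let_def by blast
    have "invertible (G (Y t))"
      using metric(2) NY(2)[OF t(2)] by (intro positive_definite_invertible) (simp add: Y_def)
    from lowered_euler_lagrange[OF this a(2)] a(1) show ?thesis by blast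
  qed
  have E': "((\<lambda>s. energy G u (Y s) (V s)) has_real_derivative 0) (at t within T)"
    if t: "t \<in> T" "x t \<in> N" for t
  proof -
    obtain a where a: "(V has_vector_derivative a) (at t within T)"
      "G (Y t) *v a = - ((\<chi> i. partial i u (Y t)) + contract_d m (Y t) (V t) + christoffel_form G (Y t) (V t))"
      using V'[OF t] by blast
    have "transpose (G (Y t)) = G (Y t)" using metric(2) NY(2)[OF t(2)] by (simp add: Y_def)
    then show ?thesis
      using est NY(1)[OF t(2)] by (intro energy_derivative[OF Y'[OF t] a(1) _ _ _ a(2)]) auto
  qed
  have E_const: "\<exists>e. \<forall>t\<in>J. energy G u (Y t) (V t) = e"
    if J: "is_interval J" "J \<subseteq> T" "\<And>t. t \<in> J \<Longrightarrow> x t \<in> N" for J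
  proof (rule has_field_derivative_zero_constant)
    show "convex J" using J(1) by (simp add: is_interval_convex_1)
    show "((\<lambda>s. energy G u (Y s) (V s)) has_real_derivative 0) (at t within J)" if "t \<in> J" for t
      using E' J(2,3) that by (meson DERIV_subset subsetD)
  qed
  \<comment> \<open>As l \<ge> 2 and \<open>norm (Y z) < 1\<close>, zero energy bounds the squared
    speed by \<open>K\<close> times the squared norm of \<open>Y z\<close>. Since
    \<open>2 * \<bar>Y z \<bullet> V z\<bar>\<close> is at most the sum of the two squares, the
    constant for Gronwall's argument is \<open>1 + K\<close>.\<close>
  have stay: "Y t = 0" if J: "is_interval J" "J \<subseteq> T" "\<And>t. t \<in> J \<Longrightarrow> x t \<in> N"
    and E0: "\<And>t. t \<in> J \<Longrightarrow> energy G u (Y t) (V t) = 0" and s: "s \<in> J" "Y s = 0" and t: "t \<in> J" for J s t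
  proof -
    have "Y t \<bullet> Y t = 0"
    proof (rule vanishes_on_interval[OF J(1) _ _ _ s(1) _ t, where K = "1 + K"])
      fix z assume z: "z \<in> J"
      have "(Y has_vector_derivative V z) (at z within J)"
        using Y'[OF subsetD[OF J(2) z] J(3)[OF z]] J(2) by (rule has_vector_derivative_within_subset)
      from bounded_bilinear.has_vector_derivative[OF bounded_bilinear_inner this this]
      show "((\<lambda>t. Y t \<bullet> Y t) has_real_derivative 2 * (Y z \<bullet> V z)) (at z within J)"
        by (simp add: has_real_derivative_iff_has_vector_derivative inner_commute)
      have y1: "norm (Y z) < 1" using est NY(1)[OF J(3)[OF z]] by blast
      have "(norm (V z))\<^sup>2 \<le> K * norm (Y z) ^ l" using est NY(1)[OF J(3)[OF z]] E0[OF z] by blast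
      also have "\<dots> \<le> K * (norm (Y z))\<^sup>2"
        using y1 K l2 by (intro mult_left_mono power_decreasing) auto
      finally have V2: "(norm (V z))\<^sup>2 \<le> K * (norm (Y z))\<^sup>2" .
      have "2 * \<bar>Y z \<bullet> V z\<bar> \<le> 2 * norm (Y z) * norm (V z)"
        using Cauchy_Schwarz_ineq2[of "Y z" "V z"] by simp
      also have "\<dots> \<le> (norm (Y z))\<^sup>2 + (norm (V z))\<^sup>2" by (rule sum_squares_bound)
      also have "\<dots> \<le> (1 + K) * (norm (Y z))\<^sup>2" using V2 by (simp add: distrib_right)
      finally show "\<bar>2 * (Y z \<bullet> V z)\<bar> \<le> (1 + K) * (Y z \<bullet> Y z)"
        by (simp add: power2_norm_eq_inner[symmetric] abs_mult)
    qed (use s in auto)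
    then show ?thesis by simp
  qed
  have "\<forall>\<^sub>F t in at_top. x t \<in> N"
    using convergence N unfolding converges_to_rest_def by (metis topological_tendstoD)
  then obtain t1 where t1: "\<And>t. t \<ge> t1 \<Longrightarrow> x t \<in> N" unfolding eventually_at_top_linorder by blast

  \<comment> \<open>The late orbit has zero energy\<close>
  have large: "\<exists>t\<in>T. t > s" for s using unbounded unfolding bdd_above_def by (meson not_le)
  then obtain t0 where t0: "t0 \<in> T" "t0 > t1" by blast
  have tail: "t \<in> T" if "t \<ge> s" "s \<in> T" for s t
    using large[of t] mem_is_interval_1_I[OF T that(2) _ that(1)] by (meson less_imp_le)
  have t0N: "t \<in> T" "x t \<in> N" if "t \<ge> t0" for t using that tail[OF that t0(1)] t1[of t] t0(2) by auto
  have ray: "is_interval {t0..}" "{t0..} \<subseteq> T" "\<And>t. t \<in> {t0..} \<Longrightarrow> x t \<in> N"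
    using t0N by (auto simp: subset_iff)
  have Ylim: "(Y \<longlongrightarrow> 0) at_top"
  proof -
    have "isCont (chart_map c) p" using cmap dom chart(2) by (simp add: continuous_on_eq_continuous_at)
    from isCont_tendsto_compose[OF this] show ?thesis
      using convergence chart(3) unfolding converges_to_rest_def Y_def by fastforce
  qed
  have Vlim: "(V \<longlongrightarrow> 0) at_top"
    using convergence chart unfolding converges_to_rest_def V_def by blast
  \<comment> \<open>The energy is constant on the ray and tends to its value at position 0 and
    velocity 0, which is \<open>u 0 = 0\<close>.\<close>
  have E0: "energy G u (Y t) (V t) = 0" if "t \<ge> t0" for t
  proof -
    obtain e where e: "\<And>t. t \<ge> t0 \<Longrightarrow> energy G u (Y t) (V t) = e"
      using E_const[OF ray] by auto
    have est0: "u differentiable (at 0)" "\<And>i j. (\<lambda>z. G z $ i $ j) differentiable (at 0)"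
      using est \<epsilon> by auto
    have ulim: "((\<lambda>t. u (Y t)) \<longlongrightarrow> u 0) at_top"
      by (rule isCont_tendsto_compose[OF differentiable_imp_continuous_within[OF est0(1)] Ylim])
    have Glim: "((\<lambda>t. G (Y t) $ i $ j) \<longlongrightarrow> G 0 $ i $ j) at_top" for i j
      by (rule isCont_tendsto_compose[OF differentiable_imp_continuous_within[OF est0(2)] Ylim])
    have "((\<lambda>t. G (Y t) *v V t) \<longlongrightarrow> G 0 *v 0) at_top"
    proof (rule vec_tendstoI)
      show "((\<lambda>t. (G (Y t) *v V t) $ i) \<longlongrightarrow> (G 0 *v 0) $ i) at_top" for i
        unfolding matrix_vector_mult_def vec_lambda_beta
        by (intro tendsto_sum tendsto_mult Glim tendsto_vec_nth Vlim)
    qed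
    then have "((\<lambda>t. energy G u (Y t) (V t)) \<longlongrightarrow> (0 \<bullet> (G 0 *v 0)) / 2 + u 0) at_top"
      unfolding energy_def by (intro tendsto_add tendsto_divide tendsto_inner Vlim tendsto_const ulim) auto
    then have "((\<lambda>t. energy G u (Y t) (V t)) \<longlongrightarrow> 0) at_top" by (simp add: u0)
    moreover have "((\<lambda>t. energy G u (Y t) (V t)) \<longlongrightarrow> e) at_top"
      by (rule tendsto_eventually) (use e in \<open>auto simp: eventually_at_top_linorder\<close>)
    ultimately have "e = 0" by (metis tendsto_unique trivial_limit_at_top_linorder)
    with e that show ?thesis by simp
  qed

  \<comment> \<open>The late orbit avoids the rest point\<close>
  have Ynz: "Y t \<noteq> 0" if "t \<ge> t0" for t
  proof
    assume "Y t = 0"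
    have Y0: "Y s = 0" if "s \<ge> t0" for s
      by (rule stay[OF ray, of t s]) (use E0 \<open>Y t = 0\<close> \<open>t \<ge> t0\<close> that in auto)
    then have xt: "x s = p" if "s \<ge> t0" for s using xp t0N that by blast
    \<comment> \<open>From \<open>t0\<close> on the orbit now rests, so non-constancy refers to
      earlier times, at which neither the chart nor the energy is known. At the supremum
      \<open>r\<close> of \<open>Z\<close>, where rest begins, zero energy is established
      anew.\<close>
    define Z where "Z = {t \<in> T. x t \<noteq> p}"
    obtain t2 where t2: "t2 \<in> Z"
      using nonconstant xt unfolding Z_def constant_on_def by blast
    have bdd: "bdd_above Z"
    proof (rule bdd_aboveI[of _ t0])
      fix z assume "z \<in> Z"
      then show "z \<le> t0" using xt[of z] by (cases "t0 \<le> z") (auto simp: Z_def)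
    qed
    define r where "r = Sup Z"
    have rZ: "z \<le> r" if "z \<in> Z" for z unfolding r_def using that bdd by (rule cSup_upper)
    have rT: "r \<in> T" using tail[OF rZ[OF t2]] t2 by (simp add: Z_def)
    have after: "x t = p" if "t > r" for t
    proof (rule ccontr)
      assume "x t \<noteq> p"
      moreover have "t \<in> T" using tail[OF _ rT, of t] that by simp
      ultimately have "t \<in> Z" by (simp add: Z_def)
      from rZ[OF this] that show False by simp
    qed
    have near: "\<exists>d>0. \<forall>t\<in>T. \<bar>t - r\<bar> < d \<longrightarrow> x t \<in> S" if S: "open S" "x r \<in> S" for S
    proof -
      have "(x \<longlongrightarrow> x r) (at r within T)" using contx rT by (simp add: continuous_on_def)
      then have "\<forall>\<^sub>F t in at r within T. x t \<in> S" using S by (rule topological_tendstoD)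
      then show ?thesis using S(2) unfolding eventually_at dist_real_def by fastforce
    qed
    \<comment> \<open>Otherwise continuity would keep \<open>x\<close> away from \<open>p\<close>
      also just after \<open>r\<close>, points being closed.\<close>
    have xr: "x r = p"
    proof (rule ccontr)
      assume "x r \<noteq> p"
      then obtain d where d: "d > 0" "\<And>t. t \<in> T \<Longrightarrow> \<bar>t - r\<bar> < d \<Longrightarrow> x t \<in> - {p}"
        using near[of "- {p}"] by auto
      have "x (r + d / 2) \<in> - {p}" using d(1) tail[OF _ rT] by (intro d(2)) auto
      then show False using after[of "r + d / 2"] d(1) by simp
    qed
    then obtain d where d: "d > 0" "\<And>t. t \<in> T \<Longrightarrow> \<bar>t - r\<bar> < d \<Longrightarrow> x t \<in> N"
      using near[OF N(1)] N(2) by auto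
    obtain t3 where t3: "t3 \<in> Z" "r - d < t3"
      using less_cSup_iff[OF _ bdd, of "r - d"] t2 d(1) unfolding r_def[symmetric] by auto
    have t3T: "t3 \<in> T" "t3 \<le> r" using t3 rZ by (auto simp: Z_def)
    have J: "is_interval {t3..r}" "{t3..r} \<subseteq> T" by (auto simp: is_interval_cc intro: tail[OF _ t3T(1)])
    have JN: "x t \<in> N" if "t \<in> {t3..r}" for t
      using that t3(2) J(2) by (intro d(2)) auto
    have Yr: "Y t = 0" if "t \<ge> r" for t
      using after[of t] xr that chart(3) by (cases "t = r") (auto simp: Y_def)
    \<comment> \<open>From \<open>r\<close> on the curve is constant, and the derivative from the
      right already determines \<open>V r\<close>; so velocity and energy vanish at
      \<open>r\<close>.\<close>
    have "(Y has_vector_derivative V r) (at r within {r..})"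
      by (rule has_vector_derivative_within_subset[OF Y'[OF rT]])
        (use xr N(2) tail[OF _ rT] in auto)
    moreover have "(Y has_vector_derivative 0) (at r within {r..})"
      by (rule has_vector_derivative_transform[of r "{r..}" Y "\<lambda>_. 0"]) (use Yr in auto)
    moreover have "at r within {r..} \<noteq> bot"
      by (simp add: at_within_Ici_at_right)
    ultimately have "V r = 0" using vector_derivative_unique_within by blast
    then have Er: "energy G u (Y r) (V r) = 0" using Yr[of r] u0 by (simp add: energy_def)
    \<comment> \<open>Constancy of the energy carries the value 0 from \<open>r\<close> back to
      \<open>t3\<close>, and \<open>stay\<close> then puts \<open>x t3\<close> at \<open>p\<close>
      although \<open>t3\<close> is in \<open>Z\<close>.\<close>
    obtain e where e: "\<And>t. t \<in> {t3..r} \<Longrightarrow> energy G u (Y t) (V t) = e"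
      using E_const[OF J JN] by blast
    have "e = 0" using e[of r] Er t3T by simp
    then have "Y t3 = 0"
      using stay[OF J JN, of r t3] e Yr[of r] t3T by auto
    moreover have "x t3 \<in> N" using JN t3T by simp
    ultimately show False using xp t3(1) by (simp add: Z_def)
  qed

  \<comment> \<open>Limit directions of the late orbit\<close>
  have atT: "at t within T = at t" if "t \<ge> t0 + 1" for t
  \<comment> \<open>The time \<open>t0\<close> may be the left endpoint of \<open>T\<close>; one
    unit later all derivatives are two-sided.\<close>
  proof (rule at_within_interior, rule interiorI[of "{t0<..}"])
    show "{t0<..} \<subseteq> T" using t0N by auto
  qed (use that in auto)
  have "\<exists>a. (V has_vector_derivative a) (at t) \<and> norm (a + D (Y t)) \<le> K * norm (Y t) ^ l" if t: "t \<ge> t0 + 1" for t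
  proof -
    have t: "t \<ge> t0" and tt: "t \<ge> t0 + 1" using t by auto
    obtain a where "(V has_vector_derivative a) (at t within T)"
      "G (Y t) *v a = - ((\<chi> i. partial i u (Y t)) + contract_d m (Y t) (V t) + christoffel_form G (Y t) (V t))"
      using V'[OF t0N[OF t]] by blast
    then show ?thesis using est NY(1)[OF t0N(2)[OF t]] E0[OF t] Ynz[OF t] atT[OF tt] by metis
  qed
  then obtain a where a: "\<And>t. t \<ge> t0 + 1 \<Longrightarrow> (V has_vector_derivative a t) (at t)"
    "\<And>t. t \<ge> t0 + 1 \<Longrightarrow> norm (a t + D (Y t)) \<le> K * norm (Y t) ^ l" by metis
  have Yd: "(Y has_vector_derivative V t) (at t)" if "t \<ge> t0 + 1" for t
    using Y'[OF t0N, of t] atT[OF that] that by simp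
  have en: "\<bar>(V t \<bullet> V t) / 2 + P (Y t)\<bar> \<le> K * norm (Y t) ^ Suc l" if "t \<ge> t0 + 1" for t
    using est NY(1)[OF t0N(2)] E0 that by simp
  have "\<exists>L\<le>0. ((\<lambda>t. P (Y t /\<^sub>R norm (Y t))) \<longlongrightarrow> L) at_top \<and>
    ((\<lambda>t. D (Y t /\<^sub>R norm (Y t)) - (D (Y t /\<^sub>R norm (Y t)) \<bullet> (Y t /\<^sub>R norm (Y t))) *\<^sub>R (Y t /\<^sub>R norm (Y t)))
      \<longlongrightarrow> 0) at_top"
    by (rule direction_limit[OF hom D(2) D(1) _ Yd a en _ Ylim K]) (use l2 Ynz in auto)
  then obtain L where L: "L \<le> 0" "((\<lambda>t. P (Y t /\<^sub>R norm (Y t))) \<longlongrightarrow> L) at_top"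
    "((\<lambda>t. D (Y t /\<^sub>R norm (Y t)) - (D (Y t /\<^sub>R norm (Y t)) \<bullet> (Y t /\<^sub>R norm (Y t))) *\<^sub>R (Y t /\<^sub>R norm (Y t)))
      \<longlongrightarrow> 0) at_top" by blast
  have Dcont: "continuous_on UNIV D" by (rule polynomial_field_continuous[OF D(1)])
  have "\<exists>\<Sigma>\<in>components {q. sphere_critical_point P q \<and> P q \<le> 0}. asymptotic_to Y \<Sigma>"
  proof (rule asymptotic_to_component[of "t0 + 1" Y P L "\<lambda>z. D z - (D z \<bullet> z) *\<^sub>R z"])
    show "continuous_on {t0 + 1..} Y"
      using Yd by (meson atLeast_iff continuous_at_imp_continuous_on has_vector_derivative_continuous)
    show "continuous_on UNIV P"
      using D(2) by (meson continuous_at_imp_continuous_on has_derivative_continuous)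
    show "continuous_on UNIV (\<lambda>z. D z - (D z \<bullet> z) *\<^sub>R z)" by (intro continuous_intros Dcont)
    fix z assume z: "norm z = 1" "D z - (D z \<bullet> z) *\<^sub>R z = 0" "P z = L"
    have "frechet_derivative P (at z) = (\<lambda>h. D z \<bullet> h)" by (intro frechet_derivative_at[symmetric] D)
    \<comment> \<open>The gradient at \<open>z\<close> is a multiple of \<open>z\<close>, hence
      annihilates the tangent space of the sphere.\<close>
    moreover have "D z \<bullet> h = 0" if "z \<bullet> h = 0" for h
    proof -
      have "D z = (D z \<bullet> z) *\<^sub>R z" using z(2) by simp
      then have "D z \<bullet> h = (D z \<bullet> z) * (z \<bullet> h)" by (metis inner_scaleR_left)
      then show ?thesis using that by simp
    qed
    ultimately show "z \<in> {q. sphere_critical_point P q \<and> P q \<le> 0}"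
      using z L(1) by (simp add: sphere_critical_point_def)
  qed (use Ynz L in auto)
  then show ?thesis by (simp only: P_def u_def Y_def)
qed

end
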